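(* Let $u\in L^2(\mathbb{R}^d)$ and $0\le\sigma<\eta<s\le1$, with $\eta=\theta s+(1-\theta)\sigma$, $\theta\in(0,1)$. Then $$[u]^*_{H^\eta(\mathbb{R}^d)}\le\big([u]^*_{H^s(\mathbb{R}^d)}\big)^\theta\big([u]^*_{H^\sigma(\mathbb{R}^d)}\big)^{1-\theta},$$ (that is, the interpolation inequality for $[\cdot]^*$ with $p=2$ holds with constant $1$), and $$[u]_{H^\eta(\mathbb{R}^d)}\le\widetilde N_2(\sigma,\eta,s)\,[u]_{H^s(\mathbb{R}^d)}^\theta\,[u]_{H^\sigma(\mathbb{R}^d)}^{1-\theta},$$ where $$\widetilde N_2(\sigma,\eta,s)=\Big(\frac{B_{d,2,s}^\theta B_{d,2,\sigma}^{1-\theta}}{B_{d,2,\eta}}\Big)^{1/2}\le\sqrt{2d}.$$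
   Context: $|\mathbb{S}^{d-1}|=2\pi^{d/2}/\Gamma(d/2)$. $H^s=W^{s,2}$. For $0<s<1$ let $C_{d,s}=\frac{s(1-s)2^{2s}\Gamma(\frac{d+2s}{2})}{\pi^{d/2}\Gamma(2-s)}$, and define $[u]^{*2}_{H^s(\mathbb{R}^d)}=\frac{C_{d,s}}2\iint_{\mathbb{R}^d\times\mathbb{R}^d}\frac{|u(x)-u(y)|^2}{|x-y|^{d+2s}}\,dy\,dx$, $[u]^*_{H^0}=\|u\|_{L^2}$, $[u]^*_{H^1}=\|\nabla u\|_{L^2}$. Further $[u]^2_{H^s(\mathbb{R}^d)}=s(1-s)\iint_{\mathbb{R}^d\times\mathbb{R}^d}\frac{|u(x)-u(y)|^2}{|x-y|^{d+2s}}\,dy\,dx$ for $0<s<1$, $[u]^2_{H^0}=|\mathbb{S}^{d-1}|\,\|u\|^2_{L^2}$, $[u]^2_{H^1}=\frac{|\mathbb{S}^{d-1}|}{2d}\|\nabla u\|^2_{L^2}$. Seminorms are $+\infty$ when $u\notin H^s(\mathbb{R}^d)$. Finally $B_{d,2,s}=\frac{C_{d,s}}{2s(1-s)}=\frac{2^{2s-1}\Gamma(\frac{d+2s}{2})}{\pi^{d/2}\Gamma(2-s)}$ for $0<s<1$, $B_{d,2,0}=\frac1{|\mathbb{S}^{d-1}|}$, $B_{d,2,1}=\frac{2d}{|\mathbb{S}^{d-1}|}$, so that $[u]^{*2}_{H^s}=B_{d,2,s}[u]^2_{H^s}$ for $s\in[0,1]$. *)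

theory Defs
  imports "HOL-Analysis.Analysis"
begin

text \<open>
  The space $\mathbb{R}^d$ is a Euclidean space \<open>'a\<close> with \<open>d = DIM('a)\<close>.  Functions take
  values in a Euclidean space \<open>'b\<close>, so that \<open>real\<close> and \<open>complex\<close> valued functions are both
  instances.
\<close>

section \<open>Square-integrable functions and $H^1$\<close>

definition L2 :: "('a::euclidean_space \<Rightarrow> 'b::euclidean_space) set" where
  "L2 = {u. u \<in> borel_measurable lebesgue \<and> integrable lebesgue (\<lambda>x. (norm (u x))\<^sup>2)}"

text \<open>Classical $C^k$ functions: differentiable with all first partial derivatives $C^{k-1}$.\<close>

primrec Ck :: "nat \<Rightarrow> ('a::euclidean_space \<Rightarrow> real) \<Rightarrow> bool" where
  "Ck 0 f \<longleftrightarrow> continuous_on UNIV f"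
| "Ck (Suc k) f \<longleftrightarrow> (\<forall>x. f differentiable (at x)) \<and>
     (\<forall>e\<in>Basis. Ck k (\<lambda>x. frechet_derivative f (at x) e))"

definition test_function :: "('a::euclidean_space \<Rightarrow> real) \<Rightarrow> bool" where
  "test_function \<phi> \<longleftrightarrow> (\<forall>k. Ck k \<phi>) \<and> compact (closure {x. \<phi> x \<noteq> 0})"

text \<open>\<open>v\<close> is the distributional derivative of \<open>u\<close> in direction \<open>e\<close>.  Only used for \<open>u\<close> and \<open>v\<close>
  in \<open>L2\<close>, where both integrals exist.\<close>

definition has_weak_partial ::
    "('a::euclidean_space \<Rightarrow> 'b::euclidean_space) \<Rightarrow> 'a \<Rightarrow> ('a \<Rightarrow> 'b) \<Rightarrow> bool" where
  "has_weak_partial u e v \<longleftrightarrow>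
     (\<forall>\<phi>. test_function \<phi> \<longrightarrow>
        integral\<^sup>L lebesgue (\<lambda>x. frechet_derivative \<phi> (at x) e *\<^sub>R u x) =
        - integral\<^sup>L lebesgue (\<lambda>x. \<phi> x *\<^sub>R v x))"

definition has_L2_weak_grad ::
    "('a::euclidean_space \<Rightarrow> 'b::euclidean_space) \<Rightarrow> ('a \<Rightarrow> 'a \<Rightarrow> 'b) \<Rightarrow> bool" where
  "has_L2_weak_grad u G \<longleftrightarrow> (\<forall>e\<in>Basis. G e \<in> L2 \<and> has_weak_partial u e (G e))"

text \<open>The components of a weak gradient are unique up to null sets, so the norm below does not depend
  on the choice made here.\<close>

definition weak_grad :: "('a::euclidean_space \<Rightarrow> 'b::euclidean_space) \<Rightarrow> 'a \<Rightarrow> 'a \<Rightarrow> 'b" where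
  "weak_grad u = (SOME G. has_L2_weak_grad u G)"

definition L2_norm :: "('a::euclidean_space \<Rightarrow> 'b::euclidean_space) \<Rightarrow> real" where
  "L2_norm u = sqrt (integral\<^sup>L lebesgue (\<lambda>x. (norm (u x))\<^sup>2))"

definition L2_norm_grad :: "('a::euclidean_space \<Rightarrow> 'b::euclidean_space) \<Rightarrow> real" where
  "L2_norm_grad u =
     sqrt (integral\<^sup>L lebesgue (\<lambda>x. \<Sum>e\<in>Basis. (norm (weak_grad u e x))\<^sup>2))"

section \<open>Fractional seminorms\<close>

text \<open>The double integral over $\mathbb{R}^d\times\mathbb{R}^d$; the integrand is 0 for \<open>y = x\<close>, as \<open>0 / 0 = 0\<close>.\<close>

definition gagliardo_integral ::
    "real \<Rightarrow> ('a::euclidean_space \<Rightarrow> 'b::euclidean_space) \<Rightarrow> ennreal" where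
  "gagliardo_integral s u =
     (\<integral>\<^sup>+x. (\<integral>\<^sup>+y. ennreal ((norm (u x - u y))\<^sup>2 / norm (x - y) powr (real DIM('a) + 2 * s))
        \<partial>lebesgue) \<partial>lebesgue)"

text \<open>$H^s = W^{s,2}$, for \<open>0 \<le> s \<le> 1\<close> only.\<close>

definition in_H :: "real \<Rightarrow> ('a::euclidean_space \<Rightarrow> 'b::euclidean_space) \<Rightarrow> bool" where
  "in_H s u \<longleftrightarrow> u \<in> L2 \<and>
     (if s = 0 then True
      else if s = 1 then (\<exists>G. has_L2_weak_grad u G)
      else gagliardo_integral s u < \<infinity>)"

definition sphere_area :: "nat \<Rightarrow> real" where
  "sphere_area d = 2 * pi powr (real d / 2) / Gamma (real d / 2)"

definition C_const :: "nat \<Rightarrow> real \<Rightarrow> real" where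
  "C_const d s = s * (1 - s) * 2 powr (2 * s) * Gamma ((real d + 2 * s) / 2) /
     (pi powr (real d / 2) * Gamma (2 - s))"

definition B_const :: "nat \<Rightarrow> real \<Rightarrow> real" where
  "B_const d s =
     (if s = 0 then 1 / sphere_area d
      else if s = 1 then 2 * real d / sphere_area d
      else C_const d s / (2 * s * (1 - s)))"

definition H_seminorm_star ::
    "real \<Rightarrow> ('a::euclidean_space \<Rightarrow> 'b::euclidean_space) \<Rightarrow> ennreal" where
  "H_seminorm_star s u =
     (if \<not> in_H s u then \<infinity>
      else if s = 0 then ennreal (L2_norm u)
      else if s = 1 then ennreal (L2_norm_grad u)
      else ennreal (sqrt (C_const DIM('a) s / 2 * enn2real (gagliardo_integral s u))))"

definition H_seminorm ::
    "real \<Rightarrow> ('a::euclidean_space \<Rightarrow> 'b::euclidean_space) \<Rightarrow> ennreal" where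
  "H_seminorm s u =
     (if \<not> in_H s u then \<infinity>
      else if s = 0 then ennreal (sqrt (sphere_area DIM('a) * (L2_norm u)\<^sup>2))
      else if s = 1 then
        ennreal (sqrt (sphere_area DIM('a) / (2 * real DIM('a)) * (L2_norm_grad u)\<^sup>2))
      else ennreal (sqrt (s * (1 - s) * enn2real (gagliardo_integral s u))))"

section \<open>Interpolation\<close>

text \<open>Powers of extended nonnegative reals with exponent \<open>a > 0\<close>.\<close>

definition ennreal_powr :: "ennreal \<Rightarrow> real \<Rightarrow> ennreal" where
  "ennreal_powr x a = (if x = \<infinity> then \<infinity> else ennreal (enn2real x powr a))"

text \<open>\<open>\<theta>\<close> is determined by \<open>\<eta> = \<theta> * s + (1 - \<theta>) * \<sigma>\<close>.\<close>

definition N_tilde :: "nat \<Rightarrow> real \<Rightarrow> real \<Rightarrow> real \<Rightarrow> real" where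
  "N_tilde d \<sigma> \<eta> s =
     (let \<theta> = (\<eta> - \<sigma>) / (s - \<sigma>)
      in sqrt (B_const d s powr \<theta> * B_const d \<sigma> powr (1 - \<theta>) / B_const d \<eta>))"

end

theory Submission
  imports Defs "HOL-Probability.Distributions"
begin

text \<open>
  In terms of the spectral measure \<open>\<nu>\<close> of $-\Delta$ at \<open>u\<close>, the squared star seminorm of order \<open>s\<close> is
  $\int \lambda^s\,d\nu(\lambda)$; Hoelder's inequality makes it log-convex in \<open>s\<close>, which is the first
  inequality.  The proof below follows this idea without constructing \<open>\<nu>\<close> and without the Fourier
  transform: the heat semigroup replaces them.

  Let $R(h) = \int u(x+h)\cdot u(x)\,dx$ be the autocorrelation and $p_t$ the heat kernel.  Then
  $g(t) = \int R\,p_t = \langle e^{t\Delta}u, u\rangle$ has the deficit $f(t) = g(0) - g(t)$ and the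
  dissipation $h(t) = -g'(t)$.  Two facts connect these with the seminorms.  First, the Gagliardo
  integral is $2\int (R(0) - R(h))\,|h|^{-d-2s}\,dh$, and $|h|^{-d-2s}$ is a mixture of heat kernels over all
  times (\<open>subordination\<close>); integrating by parts in time, the squared star seminorm is the normalised
  Mellin moment $\frac{1}{\Gamma(1-s)}\int_0^\infty h(t)\,t^{-s}\,dt$ (\<open>spectral_eq_gagliardo\<close>).  Second, \<open>R\<close> is
  positive definite (\<open>autocorr_posdef\<close>), and since the heat kernel satisfies
  $-\Delta p_{a+b} = -\nabla p_a * \nabla p_b$, so is the kernel $h(a+b)$ on the half-line.

  Cauchy--Schwarz for the form $\iint \phi(a)\psi(b)\,h(a+b)\,da\,db$ at power weights, evaluated by Beta
  integrals, gives log-convexity of the moments at midpoints with constant exactly 1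
  (\<open>spectral_midpoint\<close>), and continuity in the exponent extends it to all convex combinations
  (\<open>spectral_interpolation\<close>).  The endpoint of order 0 needs only that the total dissipation is at most
  the energy (\<open>moment_one_le\<close>).  For the endpoint of order 1, the weak gradient bounds the \<open>L\<^sup>2\<close> modulus of
  continuity, tested against smooth functions of bounded support, which are dense
  (\<open>weak_derivative_translation\<close>); hence $f(t) \le t\,\|\nabla u\|^2$ (\<open>deficit_le_gradient\<close>), and the case of
  order 1 is the limit of the cases below 1 (\<open>spectral_interpolation_one\<close>).

  The second inequality is the first one rescaled, because the two seminorms of order \<open>s\<close> differ by the factor
  \<open>sqrt (B_const d s)\<close>.  Its constant is bounded by log-convexity of the Gamma function
  (\<open>B_const_interpolation_le\<close>), which even gives \<open>sqrt 2\<close>.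
\<close>

section \<open>Gaussian integrals and the heat kernel\<close>

lemma lborel_shift_minus: "distr lborel borel (\<lambda>v. v - m) = (lborel :: 'a::euclidean_space measure)"
proof -
  have "(\<lambda>v. v - m) = (+) (- m)" by auto
  then show ?thesis using lborel_distr_plus[of "-m"] by simp
qed

lemma lborel_reflect_shift: "distr lborel borel (\<lambda>v. m - v) = (lborel :: 'a::euclidean_space measure)"
proof -
  have "lborel = density (distr lborel borel (\<lambda>x::'a. m + (-1) *\<^sub>R x)) (\<lambda>_. ennreal (\<bar>-1\<bar> ^ DIM('a)))"
    using lborel_affine[of "-1" m] by simp
  then show ?thesis by (simp add: density_1)
qed

lemma nn_integral_shift_minus:
  assumes [measurable]: "f \<in> borel_measurable borel"
  shows "(\<integral>\<^sup>+v. f (v - m) \<partial>lborel) = (\<integral>\<^sup>+v. f v \<partial>(lborel :: 'a::euclidean_space measure))"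
  by (subst (2) lborel_shift_minus[of m, symmetric], subst nn_integral_distr) auto

lemma has_bochner_integral_shift_minus:
  fixes f :: "'a::euclidean_space \<Rightarrow> 'b::euclidean_space"
  assumes "has_bochner_integral lborel f I"
  shows "has_bochner_integral lborel (\<lambda>v. f (v - m)) I"
proof -
  have [measurable]: "f \<in> borel_measurable borel"
    using assms borel_measurable_has_bochner_integral by fastforce
  have "has_bochner_integral (distr lborel borel (\<lambda>v. v - m)) f I"
    using assms by (simp add: lborel_shift_minus)
  then show ?thesis
    by (simp add: has_bochner_integral_iff integrable_distr_eq integral_distr)
qed

lemma has_bochner_integral_reflect_shift:
  fixes f :: "'a::euclidean_space \<Rightarrow> 'b::euclidean_space"
  assumes "has_bochner_integral lborel f I"
  shows "has_bochner_integral lborel (\<lambda>v. f (m - v)) I"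
proof -
  have [measurable]: "f \<in> borel_measurable borel"
    using assms borel_measurable_has_bochner_integral by fastforce
  have "has_bochner_integral (distr lborel borel (\<lambda>v. m - v)) f I"
    using assms by (simp add: lborel_reflect_shift)
  then show ?thesis
    by (simp add: has_bochner_integral_iff integrable_distr_eq integral_distr)
qed

text \<open>
  Lebesgue measure on a Euclidean space is the product of its coordinate measures, so Gaussian
  integrals reduce to the one-dimensional moments.
\<close>
lemma has_bochner_integral_lborel_prod:
  fixes f :: "'a::euclidean_space \<Rightarrow> real \<Rightarrow> real"
  assumes "\<And>b. b \<in> Basis \<Longrightarrow> has_bochner_integral lborel (f b) (I b)"
  shows "has_bochner_integral lborel (\<lambda>x::'a. \<Prod>b\<in>Basis. f b (x \<bullet> b)) (\<Prod>b\<in>Basis. I b)"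
proof -
  interpret product_sigma_finite "\<lambda>_::'a. lborel :: real measure" ..
  have int: "integrable lborel (f b)" and I: "I b = integral\<^sup>L lborel (f b)" if "b \<in> Basis" for b
    using assms[OF that] by (auto simp: has_bochner_integral_iff)
  have m [measurable]: "f b \<in> borel_measurable borel" if "b \<in> Basis" for b
    using borel_measurable_integrable[OF int[OF that]] by simp
  have m2: "(\<lambda>x::'a. \<Prod>b\<in>Basis. f b (x \<bullet> b)) \<in> borel_measurable borel"
    by (intro borel_measurable_prod measurable_compose[OF _ m]) auto
  have eq: "(\<Prod>b\<in>Basis. f b ((\<Sum>c\<in>Basis. y c *\<^sub>R c) \<bullet> b)) = (\<Prod>b\<in>Basis. f b (y b))" for y :: "'a \<Rightarrow> real"
    by (intro prod.cong refl) (simp add: inner_sum_left inner_Basis if_distrib cong: if_cong)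
  have ms: "(\<lambda>y. \<Sum>b\<in>Basis. y b *\<^sub>R b) \<in> (\<Pi>\<^sub>M b\<in>(Basis::'a set). lborel) \<rightarrow>\<^sub>M borel"
    by (intro borel_measurable_sum borel_measurable_scaleR measurable_component_singleton) auto
  have "integrable (\<Pi>\<^sub>M b\<in>(Basis::'a set). lborel) (\<lambda>y. \<Prod>b\<in>Basis. f b (y b))"
    by (rule product_integrable_prod) (auto intro: int)
  moreover have "integral\<^sup>L (\<Pi>\<^sub>M b\<in>(Basis::'a set). lborel) (\<lambda>y. \<Prod>b\<in>Basis. f b (y b)) = (\<Prod>b\<in>Basis. I b)"
    by (subst product_integral_prod) (auto intro: int simp: I)
  ultimately have "has_bochner_integral (\<Pi>\<^sub>M b\<in>(Basis::'a set). lborel) (\<lambda>y. \<Prod>b\<in>Basis. f b (y b)) (\<Prod>b\<in>Basis. I b)"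
    by (simp add: has_bochner_integral_iff)
  then show ?thesis
    by (subst lborel_eq, intro has_bochner_integral_distr[OF m2 ms]) (simp_all add: eq)
qed

text \<open>
  The Gauss--Weierstrass kernel of $\partial_t - \Delta$.
\<close>
definition heat :: "real \<Rightarrow> 'a::euclidean_space \<Rightarrow> real" where
  "heat t w = (4 * pi * t) powr (- (real DIM('a) / 2)) * exp (- (norm w)\<^sup>2 / (4 * t))"

lemma heat_nonneg [simp]: "0 \<le> heat t w"
  by (simp add: heat_def)

lemma measurable_heat [measurable (raw)]:
  assumes [measurable]: "f \<in> borel_measurable M" "g \<in> borel_measurable M"
  shows "(\<lambda>x. heat (f x) (g x)) \<in> borel_measurable M"
  unfolding heat_def by measurable

lemma heat_eq_prod:
  fixes w :: "'a::euclidean_space"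
  assumes "0 < t"
  shows "heat t w = (\<Prod>b\<in>Basis. normal_density 0 (sqrt (2 * t)) (w \<bullet> b))"
proof -
  have nd: "normal_density 0 (sqrt (2 * t)) x = (4 * pi * t) powr (- (1/2)) * exp (- x\<^sup>2 / (4 * t))" for x
    using assms unfolding normal_density_def
    by (simp add: powr_minus powr_half_sqrt inverse_eq_divide mult_ac)
  have "(\<Prod>b\<in>Basis. normal_density 0 (sqrt (2 * t)) (w \<bullet> b)) =
      ((4 * pi * t) powr (- (1/2))) ^ DIM('a) * exp (\<Sum>b\<in>Basis. - (w \<bullet> b)\<^sup>2 / (4 * t))"
    by (simp add: nd prod.distrib exp_sum)
  also have "((4 * pi * t) powr (- (1/2))) ^ DIM('a) = (4 * pi * t) powr (- (real DIM('a) / 2))"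
    using assms by (simp add: powr_realpow[symmetric] powr_powr)
  also have "(\<Sum>b\<in>Basis. - (w \<bullet> b)\<^sup>2 / (4 * t)) = - (norm w)\<^sup>2 / (4 * t)"
    unfolding power2_norm_eq_inner euclidean_inner[of w w]
    by (simp only: sum_negf sum_divide_distrib[symmetric] power2_eq_square)
  finally show ?thesis
    by (simp add: heat_def)
qed

lemma normal_moments:
  assumes "0 < t"
  shows "has_bochner_integral lborel (\<lambda>x. normal_density 0 (sqrt (2 * t)) x) 1"
    "has_bochner_integral lborel (\<lambda>x. normal_density 0 (sqrt (2 * t)) x * x) 0"
    "has_bochner_integral lborel (\<lambda>x. normal_density 0 (sqrt (2 * t)) x * x * x) (2 * t)"
proof -
  have p: "0 < sqrt (2 * t)" using assms by simp
  show "has_bochner_integral lborel (\<lambda>x. normal_density 0 (sqrt (2 * t)) x) 1"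
    using p by (simp add: has_bochner_integral_iff)
  show "has_bochner_integral lborel (\<lambda>x. normal_density 0 (sqrt (2 * t)) x * x) 0"
    using normal_moment_nz_1[OF p, of 0] by simp
  show "has_bochner_integral lborel (\<lambda>x. normal_density 0 (sqrt (2 * t)) x * x * x) (2 * t)"
    using normal_moment_even[OF p, of 0 1] assms
    by (simp add: power2_eq_square mult.assoc fact_2)
qed

lemma heat_integral:
  assumes "0 < t"
  shows "has_bochner_integral lborel (heat t :: 'a::euclidean_space \<Rightarrow> real) 1"
  using has_bochner_integral_lborel_prod[of "\<lambda>b::'a. normal_density 0 (sqrt (2 * t))" "\<lambda>_. 1"]
    normal_moments(1)[OF assms] by (simp add: heat_eq_prod[OF assms, abs_def])

lemma heat_moment1_Basis:
  fixes b :: "'a::euclidean_space"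
  assumes "0 < t" "b \<in> Basis"
  shows "has_bochner_integral lborel (\<lambda>w. heat t w * (w \<bullet> b)) 0"
proof -
  let ?f = "\<lambda>c x. normal_density 0 (sqrt (2 * t)) x * (if c = b then x else 1)"
  have "has_bochner_integral lborel (\<lambda>w::'a. \<Prod>c\<in>Basis. ?f c (w \<bullet> c)) (\<Prod>c\<in>(Basis::'a set). if c = b then 0 else 1)"
    by (rule has_bochner_integral_lborel_prod) (use normal_moments[OF assms(1)] in auto)
  moreover have "(\<Prod>c\<in>Basis. ?f c (w \<bullet> c)) = heat t w * (w \<bullet> b)" for w :: 'a
    using assms(2) by (simp add: prod.distrib heat_eq_prod[OF assms(1)])
  ultimately show ?thesis using assms(2) by simp
qed

lemma heat_moment2_Basis:
  fixes b b' :: "'a::euclidean_space"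
  assumes "0 < t" "b \<in> Basis" "b' \<in> Basis"
  shows "has_bochner_integral lborel (\<lambda>w. heat t w * (w \<bullet> b) * (w \<bullet> b')) (2 * t * (b \<bullet> b'))"
proof -
  let ?f = "\<lambda>c x. normal_density 0 (sqrt (2 * t)) x * (if c = b then x else 1) * (if c = b' then x else 1)"
  let ?I = "\<lambda>c. if b = b' then (if c = b then 2 * t else 1) else (if c = b then 0 else 1) * (if c = b' then 0 else 1)"
  have "has_bochner_integral lborel (\<lambda>w::'a. \<Prod>c\<in>Basis. ?f c (w \<bullet> c)) (\<Prod>c\<in>(Basis::'a set). ?I c)"
    by (rule has_bochner_integral_lborel_prod) (use normal_moments[OF assms(1)] in auto)
  moreover have "(\<Prod>c\<in>Basis. ?f c (w \<bullet> c)) = heat t w * (w \<bullet> b) * (w \<bullet> b')" for w :: 'a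
    using assms(2,3) by (simp add: prod.distrib heat_eq_prod[OF assms(1)])
  moreover have "(\<Prod>c\<in>(Basis::'a set). ?I c) = 2 * t * (b \<bullet> b')"
    using assms(2,3) by (auto simp: inner_Basis prod.distrib)
  ultimately show ?thesis by simp
qed

lemma heat_moment1:
  fixes c :: "'a::euclidean_space"
  assumes "0 < t"
  shows "has_bochner_integral lborel (\<lambda>w. heat t w * (w \<bullet> c)) 0"
proof -
  have "has_bochner_integral lborel (\<lambda>w::'a. \<Sum>b\<in>Basis. (heat t w * (w \<bullet> b)) * (c \<bullet> b)) (\<Sum>b\<in>(Basis::'a set). 0 * (c \<bullet> b))"
    by (intro has_bochner_integral_sum has_bochner_integral_mult_left heat_moment1_Basis assms) auto
  moreover have "(\<Sum>b\<in>Basis. (heat t w * (w \<bullet> b)) * (c \<bullet> b)) = heat t w * (w \<bullet> c)" for w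
    by (subst euclidean_inner) (simp add: sum_distrib_left mult_ac)
  ultimately show ?thesis by simp
qed

lemma heat_moment2:
  fixes c :: "'a::euclidean_space"
  assumes "0 < t"
  shows "has_bochner_integral lborel (\<lambda>w::'a. heat t w * (norm w)\<^sup>2) (2 * t * real DIM('a))"
proof -
  have "has_bochner_integral lborel (\<lambda>w::'a. \<Sum>b\<in>Basis. heat t w * (w \<bullet> b) * (w \<bullet> b)) (\<Sum>b\<in>(Basis::'a set). 2 * t * (b \<bullet> b))"
    by (intro has_bochner_integral_sum heat_moment2_Basis assms) auto
  moreover have "(\<Sum>b\<in>Basis. heat t w * (w \<bullet> b) * (w \<bullet> b)) = heat t w * (norm w)\<^sup>2" for w :: 'a
    by (subst power2_norm_eq_inner, subst euclidean_inner) (simp add: sum_distrib_left mult_ac)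
  ultimately show ?thesis by (simp add: mult_ac)
qed

text \<open>
  Completing the square in \<open>v\<close>: a product of two Gaussians in \<open>v\<close> is a Gaussian around the weighted mean
  of their centres.  The semigroup law and the gradient identity below are the moments of order
  at most 2 of this one identity.
\<close>
lemma heat_mult:
  fixes v r :: "'a::euclidean_space"
  assumes "0 < a" "0 < b"
  shows "heat a v * heat b (v - r) =
    heat (a + b) r * heat (a * b / (a + b)) (v - (a / (a + b)) *\<^sub>R r)"
proof -
  have ab: "0 < a + b" using assms by simp
  have c: "(4 * pi * a) * (4 * pi * b) = (4 * pi * (a + b)) * (4 * pi * (a * b / (a + b)))"
    using ab by (simp add: field_simps)
  have 1: "(4 * pi * a) powr x * (4 * pi * b) powr x =
    (4 * pi * (a + b)) powr x * (4 * pi * (a * b / (a + b))) powr x" for x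
    using assms ab by (subst (1 2) powr_mult[symmetric]) (simp_all only: c)
  have n: "(norm (x - y))\<^sup>2 = (norm x)\<^sup>2 - 2 * (x \<bullet> y) + (norm y)\<^sup>2" for x y :: 'a
    by (simp add: power2_norm_eq_inner inner_diff inner_commute)
  have 2: "- (norm v)\<^sup>2 / (4 * a) + - (norm (v - r))\<^sup>2 / (4 * b) =
    - (norm r)\<^sup>2 / (4 * (a + b)) + - (norm (v - (a / (a + b)) *\<^sub>R r))\<^sup>2 / (4 * (a * b / (a + b)))"
    unfolding n using assms ab by (simp add: power_mult_distrib divide_simps) (simp add: algebra_simps power2_eq_square)
  have "heat a v * heat b (v - r) = ((4 * pi * a) powr (- (real DIM('a) / 2)) * (4 * pi * b) powr (- (real DIM('a) / 2))) *
    exp (- (norm v)\<^sup>2 / (4 * a) + - (norm (v - r))\<^sup>2 / (4 * b))"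
    unfolding heat_def exp_add by (simp add: mult_ac)
  also have "\<dots> = heat (a + b) r * heat (a * b / (a + b)) (v - (a / (a + b)) *\<^sub>R r)"
    unfolding 1 2 unfolding heat_def exp_add by (simp add: mult_ac)
  finally show ?thesis .
qed

lemma heat_conv:
  fixes r :: "'a::euclidean_space"
  assumes "0 < a" "0 < b"
  shows "has_bochner_integral lborel (\<lambda>v. heat a v * heat b (v - r)) (heat (a + b) r)"
proof -
  have "0 < a * b / (a + b)" using assms by simp
  from has_bochner_integral_mult_right[OF has_bochner_integral_shift_minus[OF heat_integral[OF this]], of "heat (a + b) r" "(a / (a + b)) *\<^sub>R r"]
  show ?thesis by (simp add: heat_mult[OF assms])
qed

text \<open>
  This is $-\partial_t$ of \<open>heat\<close>, which equals $-\Delta$ of \<open>heat\<close>.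
\<close>
definition heat_decay :: "real \<Rightarrow> 'a::euclidean_space \<Rightarrow> real" where
  "heat_decay t w = (real DIM('a) / (2 * t) - (norm w)\<^sup>2 / (4 * t\<^sup>2)) * heat t w"

lemma measurable_heat_decay [measurable (raw)]:
  assumes [measurable]: "f \<in> borel_measurable M" "g \<in> borel_measurable M"
  shows "(\<lambda>x. heat_decay (f x) (g x)) \<in> borel_measurable M"
  unfolding heat_decay_def by measurable

text \<open>
  Since $\nabla p_a * \nabla p_b = \Delta p_{a+b}$, the decay of the kernel at time \<open>a + b\<close> splits into two
  gradient factors.  This factorisation is what makes \<open>dissipation\<close> below positive definite in
  \<open>(a, b)\<close>.
\<close>
lemma heat_gradient_conv:
  fixes r :: "'a::euclidean_space"
  assumes "0 < a" "0 < b"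
  shows "has_bochner_integral lborel (\<lambda>v. (v \<bullet> (v - r)) / (4 * a * b) * (heat a v * heat b (v - r))) (heat_decay (a + b) r)"
proof -
  let ?c = "a * b / (a + b)" and ?k = "a / (a + b)"
  let ?m = "?k *\<^sub>R r"
  have ab: "a + b > 0" using assms by simp
  have c: "0 < ?c" using assms by simp
  let ?F = "\<lambda>y::'a. heat ?c y * (norm y)\<^sup>2 + heat ?c y * (y \<bullet> (2 *\<^sub>R ?m - r)) + heat ?c y * (?m \<bullet> (?m - r))"
  have "has_bochner_integral lborel ?F (2 * ?c * real DIM('a) + 0 + 1 * (?m \<bullet> (?m - r)))"
    by (intro has_bochner_integral_add heat_moment1 heat_moment2 has_bochner_integral_mult_left heat_integral c)
  from has_bochner_integral_mult_right[OF has_bochner_integral_shift_minus[OF this], of "heat (a + b) r / (4 * a * b)" ?m]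
  have *: "has_bochner_integral lborel (\<lambda>v. heat (a + b) r / (4 * a * b) * ?F (v - ?m))
     (heat (a + b) r / (4 * a * b) * (2 * ?c * real DIM('a) + 0 + 1 * (?m \<bullet> (?m - r))))" by simp
  have 1: "heat (a + b) r / (4 * a * b) * ?F (v - ?m) = (v \<bullet> (v - r)) / (4 * a * b) * (heat a v * heat b (v - r))" for v
  proof -
    have "?F y = heat ?c y * ((?m + y) \<bullet> (?m + y - r))" for y
      unfolding power2_norm_eq_inner inner_diff_right inner_add_left inner_add_right inner_scaleR_right
      by (simp add: algebra_simps inner_commute)
    from this[of "v - ?m"] show ?thesis
      unfolding heat_mult[OF assms] by simp
  qed
  have k: "?m \<bullet> (?m - r) = - (a * b / (a + b)\<^sup>2) * (norm r)\<^sup>2"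
  proof -
    have "?m \<bullet> (?m - r) = ?k * (?k - 1) * (norm r)\<^sup>2"
      by (simp add: power2_norm_eq_inner algebra_simps inner_diff_right)
    also have "?k * (?k - 1) = - (a * b / (a + b)\<^sup>2)"
      using ab by (simp add: field_simps power2_eq_square)
    finally show ?thesis .
  qed
  have 2: "heat (a + b) r / (4 * a * b) * (2 * ?c * real DIM('a) + 0 + 1 * (?m \<bullet> (?m - r))) = heat_decay (a + b) r"
  proof -
    have "1 / (4 * a * b) * (2 * ?c * real DIM('a) - a * b / (a + b)\<^sup>2 * (norm r)\<^sup>2) =
        real DIM('a) / (2 * (a + b)) - (norm r)\<^sup>2 / (4 * (a + b)\<^sup>2)"
      using assms ab by (simp add: right_diff_distrib)
    then have "heat (a + b) r * (1 / (4 * a * b) * (2 * ?c * real DIM('a) - a * b / (a + b)\<^sup>2 * (norm r)\<^sup>2)) =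
        heat (a + b) r * (real DIM('a) / (2 * (a + b)) - (norm r)\<^sup>2 / (4 * (a + b)\<^sup>2))" by (rule arg_cong)
    then show ?thesis unfolding k heat_decay_def by simp
  qed
  show ?thesis using * unfolding 1 2 .
qed

section \<open>The autocorrelation of a square-integrable function\<close>

lemma integrable_pair_mult:
  fixes f :: "'x \<Rightarrow> real" and g :: "'y \<Rightarrow> real"
  assumes "sigma_finite_measure M" "sigma_finite_measure N"
    and f [measurable]: "integrable M f" and g [measurable]: "integrable N g"
  shows "integrable (M \<Otimes>\<^sub>M N) (\<lambda>p. f (fst p) * g (snd p))"
proof -
  interpret pair_sigma_finite M N using assms by (simp add: pair_sigma_finite.intro)
  show ?thesis
  proof (rule Fubini_integrable)
    show "integrable M (\<lambda>x. \<integral>y. norm (f (fst (x, y)) * g (snd (x, y))) \<partial>N)"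
      using f by (simp add: abs_mult)
  qed (use g in auto)
qed

text \<open>
  A Borel representative, so that Fubini applies on product spaces.
\<close>
locale square_integrable =
  fixes u :: "'a::euclidean_space \<Rightarrow> 'b::euclidean_space"
  assumes measurable_u [measurable]: "u \<in> borel_measurable borel"
    and integrable_u: "integrable lborel (\<lambda>x. (norm (u x))\<^sup>2)"
begin

definition energy :: real where
  "energy = (\<integral>x. (norm (u x))\<^sup>2 \<partial>lborel)"

definition autocorr :: "'a \<Rightarrow> real" where
  "autocorr h = (\<integral>x. u (x + h) \<bullet> u x \<partial>lborel)"

lemma energy_nonneg: "0 \<le> energy"
  by (simp add: energy_def)

lemma energy_shift: "has_bochner_integral lborel (\<lambda>x. (norm (u (x - h)))\<^sup>2) energy"
  using has_bochner_integral_shift_minus[of "\<lambda>x. (norm (u x))\<^sup>2" energy h] integrable_u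
  by (simp add: has_bochner_integral_iff energy_def)

lemma inner_shift_dominated:
  "has_bochner_integral lborel (\<lambda>x. ((norm (u (x - h)))\<^sup>2 + (norm (u (x - k)))\<^sup>2) / 2) energy"
proof -
  have "has_bochner_integral lborel (\<lambda>x. ((norm (u (x - h)))\<^sup>2 + (norm (u (x - k)))\<^sup>2) / 2) ((energy + energy) / 2)"
    by (intro has_bochner_integral_divide_zero has_bochner_integral_add energy_shift)
  then show ?thesis by simp
qed

lemma norm_mult_le_mean: "norm (u x) * norm (u y) \<le> ((norm (u x))\<^sup>2 + (norm (u y))\<^sup>2) / 2"
  using sum_squares_bound[of "norm (u x)" "norm (u y)"] by simp

lemma integrable_norm_shift: "integrable lborel (\<lambda>x. norm (u (x - h)) * norm (u (x - k)))"
  and integral_norm_shift_le: "(\<integral>x. norm (u (x - h)) * norm (u (x - k)) \<partial>lborel) \<le> energy"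
proof -
  note dom = inner_shift_dominated[of h k]
  show 1: "integrable lborel (\<lambda>x. norm (u (x - h)) * norm (u (x - k)))"
    by (rule Bochner_Integration.integrable_bound[OF has_bochner_integral_iff[THEN iffD1, OF dom, THEN conjunct1]])
       (use norm_mult_le_mean in \<open>auto intro!: AE_I2\<close>)
  show "(\<integral>x. norm (u (x - h)) * norm (u (x - k)) \<partial>lborel) \<le> energy"
    using integral_mono[OF 1 _ norm_mult_le_mean] dom by (simp add: has_bochner_integral_iff)
qed

lemma integrable_inner_shift: "integrable lborel (\<lambda>x. u (x - h) \<bullet> u (x - k))"
  by (rule Bochner_Integration.integrable_bound[OF integrable_norm_shift[of h k]])
     (auto simp: Cauchy_Schwarz_ineq2)

lemma measurable_autocorr [measurable]: "autocorr \<in> borel_measurable borel"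
  unfolding autocorr_def by measurable

lemma autocorr_shift: "(\<integral>x. u (x - h) \<bullet> u (x - k) \<partial>lborel) = autocorr (k - h)"
proof -
  have "has_bochner_integral lborel (\<lambda>x. u (x - h) \<bullet> u (x - k)) (\<integral>x. u (x - h) \<bullet> u (x - k) \<partial>lborel)"
    using integrable_inner_shift by (simp add: has_bochner_integral_iff)
  from has_bochner_integral_shift_minus[OF this, of "- k"] show ?thesis
    by (simp add: has_bochner_integral_iff autocorr_def algebra_simps)
qed

lemma abs_autocorr_le: "\<bar>autocorr h\<bar> \<le> energy"
proof -
  have "\<bar>autocorr h\<bar> = \<bar>\<integral>x. u (x - (- h)) \<bullet> u (x - 0) \<partial>lborel\<bar>"
    by (subst autocorr_shift) simp
  also have "\<dots> \<le> (\<integral>x. \<bar>u (x - (- h)) \<bullet> u (x - 0)\<bar> \<partial>lborel)"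
    by (rule integral_abs_bound)
  also have "\<dots> \<le> (\<integral>x. norm (u (x - (- h))) * norm (u (x - 0)) \<partial>lborel)"
    by (intro integral_mono integrable_norm_shift integrable_abs integrable_inner_shift) (simp add: Cauchy_Schwarz_ineq2)
  also have "\<dots> \<le> energy" by (rule integral_norm_shift_le)
  finally show ?thesis .
qed

lemma nn_integral_diff_square:
  "(\<integral>\<^sup>+x. ennreal ((norm (u (x + h) - u x))\<^sup>2) \<partial>lborel) = ennreal (2 * (energy - autocorr h))"
proof -
  have "has_bochner_integral lborel (\<lambda>x. (norm (u (x - (- h))))\<^sup>2 + (norm (u (x - 0)))\<^sup>2 - 2 * (u (x - (- h)) \<bullet> u (x - 0)))
      (energy + energy - 2 * autocorr h)"
    using autocorr_shift[of "- h" 0] integrable_inner_shift[of "- h" 0]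
    by (intro has_bochner_integral_diff has_bochner_integral_add has_bochner_integral_mult_right energy_shift)
      (simp add: has_bochner_integral_iff)
  moreover have "(norm (u (x - (- h))))\<^sup>2 + (norm (u (x - 0)))\<^sup>2 - 2 * (u (x - (- h)) \<bullet> u (x - 0)) = (norm (u (x + h) - u x))\<^sup>2" for x
    by (simp add: power2_norm_eq_inner inner_diff inner_commute)
  ultimately show ?thesis
    by (subst nn_integral_eq_integral) (auto simp: has_bochner_integral_iff)
qed

text \<open>
  The autocorrelation is a positive definite function: by Fubini the double integral is
  $\int |\int \Psi(\xi)\, u(z - V(\xi))\, d\xi|^2 dz$.  The index \<open>\<xi>\<close> ranges over an arbitrary
  measure space so that a time variable can be carried along with the space variable.
\<close>
lemma autocorr_posdef:
  fixes \<Psi> :: "'n \<Rightarrow> real"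
  assumes "sigma_finite_measure N" and \<Psi>: "integrable N \<Psi>" and V [measurable]: "V \<in> borel_measurable N"
  shows "integrable (N \<Otimes>\<^sub>M N) (\<lambda>p. \<Psi> (fst p) * \<Psi> (snd p) * autocorr (V (snd p) - V (fst p)))"
    and "0 \<le> (\<integral>p. \<Psi> (fst p) * \<Psi> (snd p) * autocorr (V (snd p) - V (fst p)) \<partial>(N \<Otimes>\<^sub>M N))"
proof -
  interpret N: sigma_finite_measure N by fact
  interpret NN: pair_sigma_finite N N ..
  interpret P: pair_sigma_finite "N \<Otimes>\<^sub>M N" "lborel :: 'a measure"
    by (intro pair_sigma_finite.intro sigma_finite_lborel NN.sigma_finite_measure_axioms)
  have m [measurable]: "\<Psi> \<in> borel_measurable N" using \<Psi> by simp
  have intE: "integrable (N \<Otimes>\<^sub>M N) (\<lambda>p. \<bar>\<Psi> (fst p)\<bar> * \<bar>\<Psi> (snd p)\<bar>)"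
    by (intro integrable_pair_mult) (use \<Psi> assms(1) in auto)
  show "integrable (N \<Otimes>\<^sub>M N) (\<lambda>p. \<Psi> (fst p) * \<Psi> (snd p) * autocorr (V (snd p) - V (fst p)))"
    by (rule Bochner_Integration.integrable_bound[OF integrable_mult_left[OF intE, of energy]])
       (use abs_autocorr_le energy_nonneg in \<open>auto simp: abs_mult intro!: mult_left_mono\<close>)
  \<comment> \<open>The majorant \<open>?G\<close> serves twice: it justifies Fubini, and for almost every \<open>z\<close> it makes \<open>?w z\<close> integrable.\<close>
  let ?w = "\<lambda>z \<xi>. \<Psi> \<xi> *\<^sub>R u (z - V \<xi>)"
  let ?F = "\<lambda>p z. ?w z (fst p) \<bullet> ?w z (snd p)"
  let ?G = "\<lambda>p z. norm (?w z (fst p)) * norm (?w z (snd p))"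
  have G: "integrable ((N \<Otimes>\<^sub>M N) \<Otimes>\<^sub>M lborel) (case_prod ?G)"
  proof (rule P.Fubini_integrable)
    have "(\<integral>z. norm (?G p z) \<partial>lborel) \<le> \<bar>\<Psi> (fst p)\<bar> * \<bar>\<Psi> (snd p)\<bar> * energy" for p
    proof -
      have "(\<integral>z. norm (?G p z) \<partial>lborel) = \<bar>\<Psi> (fst p)\<bar> * \<bar>\<Psi> (snd p)\<bar> * (\<integral>z. norm (u (z - V (fst p))) * norm (u (z - V (snd p))) \<partial>lborel)"
        by (subst integral_mult_right_zero[symmetric]) (simp add: abs_mult mult_ac)
      also have "\<dots> \<le> \<bar>\<Psi> (fst p)\<bar> * \<bar>\<Psi> (snd p)\<bar> * energy"
        by (intro mult_left_mono integral_norm_shift_le) auto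
      finally show ?thesis .
    qed
    then show "integrable (N \<Otimes>\<^sub>M N) (\<lambda>p. \<integral>z. norm (case_prod ?G (p, z)) \<partial>lborel)"
      by (intro Bochner_Integration.integrable_bound[OF integrable_mult_left[OF intE, of energy]])
         (auto simp: abs_mult energy_nonneg intro!: AE_I2)
    show "AE p in N \<Otimes>\<^sub>M N. integrable lborel (\<lambda>z. case_prod ?G (p, z))"
    proof (rule AE_I2)
      fix p show "integrable lborel (\<lambda>z. case_prod ?G (p, z))"
        using integrable_mult_right[OF integrable_norm_shift[of "V (fst p)" "V (snd p)"], of "\<bar>\<Psi> (fst p)\<bar> * \<bar>\<Psi> (snd p)\<bar>"]
        by (simp add: mult_ac)
    qed
  qed measurable
  have F: "integrable ((N \<Otimes>\<^sub>M N) \<Otimes>\<^sub>M lborel) (case_prod ?F)"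
    by (rule Bochner_Integration.integrable_bound[OF G])
       (use Cauchy_Schwarz_ineq2[of "?w z (fst p)" "?w z (snd p)" for z p] in \<open>auto simp: case_prod_unfold simp del: inner_scaleR_left inner_scaleR_right norm_scaleR intro!: AE_I2\<close>)
  have "(\<integral>p. \<Psi> (fst p) * \<Psi> (snd p) * autocorr (V (snd p) - V (fst p)) \<partial>(N \<Otimes>\<^sub>M N)) = (\<integral>p. (\<integral>z. ?F p z \<partial>lborel) \<partial>(N \<Otimes>\<^sub>M N))"
    unfolding autocorr_shift[symmetric] by (simp add: mult_ac)
  also have "\<dots> = (\<integral>z. (\<integral>p. ?F p z \<partial>(N \<Otimes>\<^sub>M N)) \<partial>lborel)"
    by (rule P.Fubini_integral[OF F, symmetric])
  also have "\<dots> \<ge> 0"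
  proof (rule integral_nonneg_AE)
    show "AE z in lborel. 0 \<le> (\<integral>p. ?F p z \<partial>(N \<Otimes>\<^sub>M N))"
      using P.AE_integrable_snd[OF G] P.AE_integrable_snd[OF F]
    proof eventually_elim
      case (elim z)
      \<comment> \<open>The square of the integral is finite, hence so is the integral.\<close>
      have "(\<integral>\<^sup>+\<xi>. norm (?w z \<xi>) \<partial>N) * (\<integral>\<^sup>+\<xi>. norm (?w z \<xi>) \<partial>N) = (\<integral>\<^sup>+\<xi>. (\<integral>\<^sup>+\<xi>'. norm (?w z \<xi>) * norm (?w z \<xi>') \<partial>N) \<partial>N)"
        by (simp add: ennreal_mult nn_integral_cmult nn_integral_multc del: norm_scaleR)
      also have "\<dots> = (\<integral>\<^sup>+p. ennreal (norm (?G p z)) \<partial>(N \<Otimes>\<^sub>M N))"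
        by (subst N.nn_integral_fst[symmetric]) (auto simp del: norm_scaleR)
      also have "\<dots> < \<infinity>"
        using elim(1) unfolding integrable_iff_bounded by blast
      finally have "(\<integral>\<^sup>+\<xi>. norm (?w z \<xi>) \<partial>N) < \<infinity>"
        by (cases "(\<integral>\<^sup>+\<xi>. norm (?w z \<xi>) \<partial>N) = \<infinity>") (auto simp: less_top simp del: norm_scaleR)
      then have w: "integrable N (?w z)"
        by (intro integrableI_bounded) auto
      have "(\<integral>p. ?F p z \<partial>(N \<Otimes>\<^sub>M N)) = (\<integral>\<xi>. (\<integral>\<xi>'. ?w z \<xi> \<bullet> ?w z \<xi>' \<partial>N) \<partial>N)"
        using NN.integral_fst'[OF elim(2)] by simp
      also have "\<dots> = (\<integral>\<xi>. ?w z \<xi> \<bullet> (\<integral>\<xi>'. ?w z \<xi>' \<partial>N) \<partial>N)"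
        by (subst integral_inner_right) (use w in auto)
      also have "\<dots> = (\<integral>\<xi>. ?w z \<xi> \<partial>N) \<bullet> (\<integral>\<xi>'. ?w z \<xi>' \<partial>N)"
        by (subst integral_inner_left) (use w in auto)
      finally show ?case by simp
    qed
  qed
  finally show "0 \<le> (\<integral>p. \<Psi> (fst p) * \<Psi> (snd p) * autocorr (V (snd p) - V (fst p)) \<partial>(N \<Otimes>\<^sub>M N))" .
qed

lemma autocorr_uminus [simp]: "autocorr (- h) = autocorr h"
  using autocorr_shift[of h 0] autocorr_shift[of 0 h] by (simp add: inner_commute)

lemma abs_mult_autocorr_le: "\<bar>c * autocorr h\<bar> \<le> \<bar>c\<bar> * energy"
  using mult_left_mono[OF abs_autocorr_le[of h], of "\<bar>c\<bar>"] by (simp add: abs_mult)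

text \<open>
  The case in which an index is a time \<open>a\<close> together with a point \<open>v\<close>: after integrating out the two points,
  what remains is a positive definite kernel \<open>L\<close> in the two times.
\<close>
lemma autocorr_posdef_fibres:
  fixes \<Psi> :: "real \<Rightarrow> 'a \<Rightarrow> real"
  assumes \<Psi>: "integrable (lborel \<Otimes>\<^sub>M lborel) (case_prod \<Psi>)" and fib: "\<And>a. integrable lborel (\<Psi> a)"
  defines "L \<equiv> \<lambda>a b. \<integral>v. (\<integral>w. \<Psi> a v * \<Psi> b w * autocorr (w - v) \<partial>lborel) \<partial>lborel"
  shows "integrable (lborel \<Otimes>\<^sub>M lborel) (case_prod L)"
    and "0 \<le> (\<integral>p. case_prod L p \<partial>(lborel \<Otimes>\<^sub>M lborel))"
proof -
  let ?N = "lborel \<Otimes>\<^sub>M lborel :: (real \<times> 'a) measure"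
  interpret NN: pair_sigma_finite ?N ?N
    by (intro pair_sigma_finite.intro lborel_pair.sigma_finite_measure_axioms)
  have [measurable]: "case_prod \<Psi> \<in> borel_measurable (borel \<Otimes>\<^sub>M borel)" 
    using borel_measurable_integrable[OF \<Psi>] by simp
  note [measurable] = measurable_compose_Pair1
  let ?P = "\<lambda>a. \<integral>v. \<bar>\<Psi> a v\<bar> \<partial>lborel"
  have P: "integrable lborel ?P"
    using lborel_pair.integrable_fst'[OF integrable_abs[OF \<Psi>]] by simp
  have in_w: "integrable lborel (\<lambda>w. \<Psi> b w * autocorr (w - v))" for b v
    by (rule Bochner_Integration.integrable_bound[OF integrable_mult_left[OF fib[of b], of energy]])
       (use abs_autocorr_le energy_nonneg in \<open>auto simp: abs_mult intro!: mult_left_mono\<close>)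
  have le_w: "\<bar>\<integral>w. \<Psi> b w * autocorr (w - v) \<partial>lborel\<bar> \<le> energy * ?P b" for b v
  proof -
    have "\<bar>\<integral>w. \<Psi> b w * autocorr (w - v) \<partial>lborel\<bar> \<le> (\<integral>w. \<bar>\<Psi> b w\<bar> * energy \<partial>lborel)"
      by (rule integral_abs_bound_integral[OF in_w]) 
        (use abs_mult_autocorr_le fib in auto)
    then show ?thesis by (simp add: mult.commute)
  qed
  define G where "G b v = (\<integral>w. \<Psi> b w * autocorr (w - v) \<partial>lborel)" for b v
  have G_meas [measurable]: "(\<lambda>(b, v). G b v) \<in> borel_measurable (borel \<Otimes>\<^sub>M borel)"
    unfolding G_def by measurable
  have L_eq: "L a b = (\<integral>v. \<Psi> a v * G b v \<partial>lborel)" for a b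
    unfolding L_def G_def by (simp add: mult.assoc)
  have L_meas: "case_prod L \<in> borel_measurable (lborel \<Otimes>\<^sub>M lborel)"
    unfolding L_eq[abs_def] by measurable
  have L_le: "\<bar>L a b\<bar> \<le> ?P a * ?P b * energy" for a b
  proof -
    have "\<bar>L a b\<bar> \<le> (\<integral>v. \<bar>\<Psi> a v\<bar> * (energy * ?P b) \<partial>lborel)"
      unfolding L_eq
    proof (rule integral_abs_bound_integral)
      show "integrable lborel (\<lambda>v. \<Psi> a v * G b v)"
        by (rule Bochner_Integration.integrable_bound[OF integrable_mult_left[OF fib[of a], of "energy * ?P b"]])
          (use le_w[of b] energy_nonneg fib in \<open>auto simp: abs_mult G_def intro!: AE_I2 mult_left_mono\<close>)
    qed (use le_w[of b] fib in \<open>auto simp: abs_mult G_def intro!: mult_left_mono\<close>)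
    then show ?thesis by (simp add: mult_ac)
  qed
  show Li: "integrable (lborel \<Otimes>\<^sub>M lborel) (case_prod L)"
    by (rule Bochner_Integration.integrable_bound[OF integrable_mult_left[OF integrable_pair_mult[OF _ _ P P], of energy] L_meas])
       (use L_le in \<open>auto simp: abs_mult energy_nonneg intro: order_trans[OF _ abs_ge_self] sigma_finite_lborel\<close>)
  let ?F = "\<lambda>p q. case_prod \<Psi> p * case_prod \<Psi> q * autocorr (snd q - snd p)"
  have F: "integrable (?N \<Otimes>\<^sub>M ?N) (case_prod ?F)" and F0: "0 \<le> (\<integral>x. case_prod ?F x \<partial>(?N \<Otimes>\<^sub>M ?N))"
    using autocorr_posdef[OF lborel_pair.sigma_finite_measure_axioms \<Psi>, of snd] by (simp_all add: case_prod_unfold)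
  have inner: "(\<integral>q. ?F p q \<partial>?N) = case_prod \<Psi> p * (\<integral>b. G b (snd p) \<partial>lborel)" for p
  proof -
    have "integrable ?N (\<lambda>q. case_prod \<Psi> q * autocorr (snd q - snd p))"
      by (rule Bochner_Integration.integrable_bound[OF integrable_mult_left[OF \<Psi>, of energy]])
       (use abs_autocorr_le energy_nonneg in \<open>auto simp: abs_mult intro!: mult_left_mono\<close>)
    from lborel_pair.integral_fst'[OF this] show ?thesis
      by (simp add: G_def mult.assoc)
  qed
  have "(\<integral>x. case_prod ?F x \<partial>(?N \<Otimes>\<^sub>M ?N)) = (\<integral>p. case_prod \<Psi> p * (\<integral>b. G b (snd p) \<partial>lborel) \<partial>?N)"
    using NN.integral_fst'[OF F] by (simp only: prod.case inner)
  also have "\<dots> = (\<integral>a. (\<integral>v. \<Psi> a v * (\<integral>b. G b v \<partial>lborel) \<partial>lborel) \<partial>lborel)"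
    using NN.integrable_fst'[OF F] by (subst lborel_pair.integral_fst'[symmetric]) (simp_all only: prod.case inner snd_conv)
  also have "\<dots> = (\<integral>a. (\<integral>b. L a b \<partial>lborel) \<partial>lborel)"
  proof (intro Bochner_Integration.integral_cong refl)
    fix a
    have "integrable (lborel \<Otimes>\<^sub>M lborel) (\<lambda>(v, b). \<Psi> a v * G b v)"
      by (rule Bochner_Integration.integrable_bound[OF integrable_mult_left[OF integrable_pair_mult[OF _ _ fib[of a] P], of energy]])
       (use mult_left_mono[OF le_w, of "\<bar>\<Psi> a v\<bar>" b v for b v] energy_nonneg in \<open>auto simp: abs_mult G_def mult_ac sigma_finite_lborel intro!: AE_I2\<close>)
    from lborel_pair.Fubini_integral[OF this]
    have "(\<integral>b. L a b \<partial>lborel) = (\<integral>v. (\<integral>b. \<Psi> a v * G b v \<partial>lborel) \<partial>lborel)"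
      by (simp add: L_eq)
    then show "(\<integral>v. \<Psi> a v * (\<integral>b. G b v \<partial>lborel) \<partial>lborel) = (\<integral>b. L a b \<partial>lborel)"
      by simp
  qed
  also have "\<dots> = (\<integral>p. case_prod L p \<partial>(lborel \<Otimes>\<^sub>M lborel))"
    using lborel_pair.integral_fst'[OF Li] by simp
  finally show "0 \<le> (\<integral>p. case_prod L p \<partial>(lborel \<Otimes>\<^sub>M lborel))"
    using F0 by simp
qed

text \<open>
  The substitution \<open>w = v - r\<close> turns the double integral into an integral of the autocorrelation
  against the correlation of \<open>f\<close> with \<open>g\<close>.
\<close>
lemma autocorr_kernel:
  assumes f: "integrable lborel f" and g: "integrable lborel g"
  shows "integrable (lborel \<Otimes>\<^sub>M lborel) (\<lambda>(v, r). f v * g (v - r) * autocorr r)"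
    and "(\<integral>v. (\<integral>w. f v * g w * autocorr (w - v) \<partial>lborel) \<partial>lborel) = (\<integral>r. (\<integral>v. f v * g (v - r) * autocorr r \<partial>lborel) \<partial>lborel)"
proof -
  have [measurable]: "f \<in> borel_measurable borel" "g \<in> borel_measurable borel"
    using borel_measurable_integrable[OF f] borel_measurable_integrable[OF g] by simp_all
  have g_refl: "has_bochner_integral lborel (\<lambda>r. \<bar>g (v - r)\<bar>) (\<integral>r. \<bar>g r\<bar> \<partial>lborel)" for v
    using has_bochner_integral_reflect_shift[of "\<lambda>r. \<bar>g r\<bar>" "\<integral>r. \<bar>g r\<bar> \<partial>lborel" v] g by (simp add: has_bochner_integral_iff)
  have in_r: "integrable lborel (\<lambda>r. f v * g (v - r) * autocorr r)" for v
    by (rule Bochner_Integration.integrable_bound[OF integrable_mult_right[OF has_bochner_integral_iff[THEN iffD1, OF g_refl, THEN conjunct1], of "\<bar>f v\<bar> * energy" v]])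
      (use mult_left_mono[OF abs_autocorr_le, of "\<bar>f v * g (v - r)\<bar>" r for r] energy_nonneg in \<open>auto simp: abs_mult mult_ac intro!: AE_I2\<close>)
  show I: "integrable (lborel \<Otimes>\<^sub>M lborel) (\<lambda>(v, r). f v * g (v - r) * autocorr r)"
  proof (rule lborel_pair.Fubini_integrable)
    show "integrable lborel (\<lambda>v. \<integral>r. norm (case (v, r) of (v, r) \<Rightarrow> f v * g (v - r) * autocorr r) \<partial>lborel)"
    proof (rule Bochner_Integration.integrable_bound[OF integrable_mult_left[OF f, of "energy * (\<integral>r. \<bar>g r\<bar> \<partial>lborel)"]])
      have B: "(\<integral>r. \<bar>f v * g (v - r) * autocorr r\<bar> \<partial>lborel) \<le> (\<integral>r. \<bar>f v\<bar> * energy * \<bar>g (v - r)\<bar> \<partial>lborel)" for v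
        using g_refl[of v] abs_mult_autocorr_le[of "f v * g (v - r)" r for r]
        by (intro integral_mono[OF integrable_abs[OF in_r] integrable_mult_right])
          (simp_all add: has_bochner_integral_iff abs_mult mult_ac)
      have "(\<integral>r. \<bar>f v * g (v - r) * autocorr r\<bar> \<partial>lborel) \<le> \<bar>f v\<bar> * (energy * (\<integral>r. \<bar>g r\<bar> \<partial>lborel))" for v
        using B[of v] g_refl[of v] by (simp add: has_bochner_integral_iff mult.assoc)
      then show "AE v in lborel. norm (\<integral>r. norm (case (v, r) of (v, r) \<Rightarrow> f v * g (v - r) * autocorr r) \<partial>lborel) \<le> norm (f v * (energy * (\<integral>r. \<bar>g r\<bar> \<partial>lborel)))"
        by (simp add: abs_mult energy_nonneg)
    qed measurable
  qed (use in_r in auto)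
  have "(\<integral>w. f v * g w * autocorr (w - v) \<partial>lborel) = (\<integral>r. f v * g (v - r) * autocorr r \<partial>lborel)" for v
  proof -
    have "(\<integral>r. f v * g (v - r) * autocorr r \<partial>lborel) = (\<integral>r. f v * g (v - (v - r)) * autocorr (v - r) \<partial>lborel)"
      using has_bochner_integral_reflect_shift[of "\<lambda>r. f v * g (v - r) * autocorr r" _ v] in_r[of v]
      by (simp add: has_bochner_integral_iff)
    also have "\<dots> = (\<integral>w. f v * g w * autocorr (w - v) \<partial>lborel)"
      by (intro Bochner_Integration.integral_cong refl) (simp add: autocorr_uminus[of "w - v" for w, simplified])
    finally show ?thesis by simp
  qed
  then show "(\<integral>v. (\<integral>w. f v * g w * autocorr (w - v) \<partial>lborel) \<partial>lborel) = (\<integral>r. (\<integral>v. f v * g (v - r) * autocorr r \<partial>lborel) \<partial>lborel)"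
    using lborel_pair.Fubini_integral[OF I] by simp
qed

end

section \<open>Energy dissipation along the heat flow\<close>

lemma has_derivative_heat:
  fixes w :: "'a::euclidean_space"
  assumes "0 < \<tau>"
  shows "((\<lambda>\<tau>. heat \<tau> w) has_real_derivative - heat_decay \<tau> w) (at \<tau>)"
proof -
  have "((\<lambda>\<tau>. (4 * pi * \<tau>) powr (- (real DIM('a) / 2)) * exp (- (norm w)\<^sup>2 / (4 * \<tau>))) has_real_derivative
    (4 * pi * \<tau>) powr (- (real DIM('a) / 2)) * (exp (- (norm w)\<^sup>2 / (4 * \<tau>)) * ((norm w)\<^sup>2 / (4 * \<tau>\<^sup>2)))
     + (- (real DIM('a) / 2)) * (4 * pi * \<tau>) powr (- (real DIM('a) / 2) - 1) * (4 * pi) * exp (- (norm w)\<^sup>2 / (4 * \<tau>))) (at \<tau>)"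
    using assms by (auto intro!: derivative_eq_intros simp: power2_eq_square field_simps)
  then have D: "((\<lambda>\<tau>. heat \<tau> w) has_real_derivative
    (4 * pi * \<tau>) powr (- (real DIM('a) / 2)) * (exp (- (norm w)\<^sup>2 / (4 * \<tau>)) * ((norm w)\<^sup>2 / (4 * \<tau>\<^sup>2)))
     + (- (real DIM('a) / 2)) * (4 * pi * \<tau>) powr (- (real DIM('a) / 2) - 1) * (4 * pi) * exp (- (norm w)\<^sup>2 / (4 * \<tau>))) (at \<tau>)"
    unfolding heat_def .
  have P: "(4 * pi * \<tau>) powr (- (real DIM('a) / 2) - 1) = (4 * pi * \<tau>) powr (- (real DIM('a) / 2)) / (4 * pi * \<tau>)"
    using assms by (simp add: powr_diff)
  show ?thesis
    using assms by (intro DERIV_cong[OF D]) (simp add: P heat_def heat_decay_def, simp add: field_simps power2_eq_square)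
qed

lemma heat_decay_bound:
  assumes "0 < t"
  shows "has_bochner_integral lborel (\<lambda>w::'a::euclidean_space. (real DIM('a) / (2 * t) + (norm w)\<^sup>2 / (4 * t\<^sup>2)) * heat t w) (real DIM('a) / t)"
    and "\<bar>heat_decay t w\<bar> \<le> (real DIM('a) / (2 * t) + (norm w)\<^sup>2 / (4 * t\<^sup>2)) * heat t (w::'a)"
proof -
  have "has_bochner_integral lborel (\<lambda>w::'a. real DIM('a) / (2 * t) * heat t w + 1 / (4 * t\<^sup>2) * (heat t w * (norm w)\<^sup>2))
     (real DIM('a) / (2 * t) * 1 + 1 / (4 * t\<^sup>2) * (2 * t * real DIM('a)))"
    by (intro has_bochner_integral_add has_bochner_integral_mult_right heat_integral heat_moment2 assms)
  moreover have "real DIM('a) / (2 * t) * 1 + 1 / (4 * t\<^sup>2) * (2 * t * real DIM('a)) = real DIM('a) / t"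
    using assms by (simp add: field_simps power2_eq_square)
  ultimately show "has_bochner_integral lborel (\<lambda>w::'a. (real DIM('a) / (2 * t) + (norm w)\<^sup>2 / (4 * t\<^sup>2)) * heat t w) (real DIM('a) / t)"
    by (simp add: algebra_simps)
  have "\<bar>real DIM('a) / (2 * t) - (norm w)\<^sup>2 / (4 * t\<^sup>2)\<bar> \<le> real DIM('a) / (2 * t) + (norm w)\<^sup>2 / (4 * t\<^sup>2)"
  proof -
    have "0 \<le> real DIM('a) / (2 * t)" "0 \<le> (norm w)\<^sup>2 / (4 * t\<^sup>2)" using assms by auto
    then show ?thesis by linarith
  qed
  then show "\<bar>heat_decay t w\<bar> \<le> (real DIM('a) / (2 * t) + (norm w)\<^sup>2 / (4 * t\<^sup>2)) * heat t w"
    unfolding heat_decay_def abs_mult by (simp add: mult_right_mono)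
qed

lemma integrable_heat_decay: "0 < t \<Longrightarrow> integrable lborel (heat_decay t :: 'a::euclidean_space \<Rightarrow> real)"
  by (rule Bochner_Integration.integrable_bound[OF has_bochner_integral_iff[THEN iffD1, OF heat_decay_bound(1), THEN conjunct1]])
    (auto intro!: AE_I2 order_trans[OF heat_decay_bound(2)])

lemma integral_abs_heat_decay_le:
  assumes "0 < t"
  shows "(\<integral>w. \<bar>heat_decay t (w::'a::euclidean_space)\<bar> \<partial>lborel) \<le> real DIM('a) / t"
proof -
  have "(\<integral>w. \<bar>heat_decay t (w::'a)\<bar> \<partial>lborel) \<le> (\<integral>w. (real DIM('a) / (2 * t) + (norm w)\<^sup>2 / (4 * t\<^sup>2)) * heat t (w::'a) \<partial>lborel)"
    using heat_decay_bound[OF assms, where 'a='a] integrable_heat_decay[OF assms, where 'a='a]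
    by (intro integral_mono) (simp_all add: has_bochner_integral_iff)
  then show ?thesis
    using heat_decay_bound(1)[OF assms, where 'a='a] by (simp add: has_bochner_integral_iff)
qed

text \<open>
  Up to sign, the derivative of the heat kernel in direction \<open>e\<close>.
\<close>
definition heat_slope :: "'a::euclidean_space \<Rightarrow> real \<Rightarrow> 'a \<Rightarrow> real" where
  "heat_slope e a v = (v \<bullet> e) / (2 * a) * heat a v"

lemma measurable_heat_slope [measurable (raw)]:
  assumes [measurable]: "f \<in> borel_measurable M" "g \<in> borel_measurable M"
  shows "(\<lambda>x. heat_slope e (f x) (g x)) \<in> borel_measurable M"
  unfolding heat_slope_def by measurable

lemma heat_slope_bound:
  fixes e :: "'a::euclidean_space"
  assumes "e \<in> Basis" "0 < a"
  shows "integrable lborel (heat_slope e a)" "(\<integral>v. \<bar>heat_slope e a v\<bar> \<partial>lborel) \<le> (1 + 2 * a * real DIM('a)) / (2 * a)"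
proof -
  have "has_bochner_integral lborel (\<lambda>v::'a. 1 / (2 * a) * (heat a v + heat a v * (norm v)\<^sup>2)) (1 / (2 * a) * (1 + 2 * a * real DIM('a)))"
    by (intro has_bochner_integral_add has_bochner_integral_mult_right heat_integral heat_moment2 assms)
  then have I: "integrable lborel (\<lambda>v::'a. 1 / (2 * a) * (heat a v + heat a v * (norm v)\<^sup>2))"
    and E: "(\<integral>v. 1 / (2 * a) * (heat a v + heat a v * (norm v)\<^sup>2) \<partial>(lborel::'a measure)) = 1 / (2 * a) * (1 + 2 * a * real DIM('a))"
    by (auto simp: has_bochner_integral_iff)
  have *: "\<bar>heat_slope e a v\<bar> \<le> 1 / (2 * a) * (heat a v + heat a v * (norm v)\<^sup>2)" for v
  proof -
    have "\<bar>v \<bullet> e\<bar> \<le> norm v" using assms(1) by (rule Basis_le_norm)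
    also have "norm v \<le> 1 + (norm v)\<^sup>2"
      using sum_squares_bound[of "norm v" 1] by (smt (verit) norm_ge_zero one_power2 mult.right_neutral)
    finally have "\<bar>v \<bullet> e\<bar> * heat a v \<le> (1 + (norm v)\<^sup>2) * heat a v" by (rule mult_right_mono) simp
    then show ?thesis using assms(2) by (simp add: heat_slope_def abs_mult field_simps)
  qed
  show 1: "integrable lborel (heat_slope e a)"
    by (rule Bochner_Integration.integrable_bound[OF I]) (use * assms(2) in \<open>auto intro!: AE_I2 simp: heat_slope_def\<close>)
  show "(\<integral>v. \<bar>heat_slope e a v\<bar> \<partial>lborel) \<le> (1 + 2 * a * real DIM('a)) / (2 * a)"
    using integral_mono[OF integrable_abs[OF 1] I *] unfolding E by simp
qed

lemma heat_slope_conv: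
  fixes r :: "'a::euclidean_space"
  assumes "0 < a" "0 < b"
  shows "has_bochner_integral lborel (\<lambda>v. \<Sum>e\<in>Basis. heat_slope e a v * heat_slope e b (v - r)) (heat_decay (a + b) r)"
proof -
  have "(\<Sum>e\<in>Basis. heat_slope e a v * heat_slope e b (v - r)) = (v \<bullet> (v - r)) / (4 * a * b) * (heat a v * heat b (v - r))" for v
    unfolding heat_slope_def euclidean_inner[of v "v - r"]
    by (simp add: sum_distrib_left sum_distrib_right sum_divide_distrib mult_ac)
  then show ?thesis using heat_gradient_conv[OF assms, of r] by simp
qed

context square_integrable
begin

text \<open>
  With $g(t) = \langle e^{t\Delta}u, u\rangle$ this is $g(0) - g(t)$.
\<close>
definition deficit :: "real \<Rightarrow> real" where
  "deficit t = (\<integral>w. heat t w * (energy - autocorr w) \<partial>lborel)"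

text \<open>
  This is $-g'(t) = \|\nabla e^{t\Delta/2}u\|^2$, the spectral integral $\int \lambda e^{-t\lambda}\,d\nu(\lambda)$.
\<close>
definition dissipation :: "real \<Rightarrow> real" where
  "dissipation t = (\<integral>w. heat_decay t w * autocorr w \<partial>lborel)"

lemma measurable_deficit [measurable]: "deficit \<in> borel_measurable borel"
  unfolding deficit_def by measurable

lemma measurable_dissipation [measurable]: "dissipation \<in> borel_measurable borel"
  unfolding dissipation_def by measurable

lemma integrable_mult_autocorr:
  assumes "integrable lborel f"
  shows "integrable lborel (\<lambda>w. f w * autocorr w)"
  by (rule Bochner_Integration.integrable_bound[OF integrable_mult_left[OF assms, of energy]])
    (use borel_measurable_integrable[OF assms] abs_mult_autocorr_le energy_nonneg in \<open>auto simp: abs_mult[of _ energy]\<close>)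

lemma integrable_heat: "0 < t \<Longrightarrow> integrable lborel (heat t :: 'a \<Rightarrow> real)"
  and integral_heat: "0 < t \<Longrightarrow> integral\<^sup>L lborel (heat t :: 'a \<Rightarrow> real) = 1"
  using heat_integral[of t, where 'a='a] by (simp_all add: has_bochner_integral_iff)

lemma deficit_eq:
  assumes "0 < t"
  shows "deficit t = energy - (\<integral>w. heat t w * autocorr w \<partial>lborel)"
proof -
  have "deficit t = (\<integral>w. heat t w * energy - heat t w * autocorr w \<partial>lborel)"
    by (simp add: deficit_def algebra_simps)
  also have "\<dots> = energy - (\<integral>w. heat t w * autocorr w \<partial>lborel)"
    using integrable_mult_autocorr[OF integrable_heat[OF assms]] integrable_heat[OF assms] integral_heat[OF assms]
    by (subst Bochner_Integration.integral_diff) auto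
  finally show ?thesis .
qed

lemma nn_deficit:
  assumes "0 < t"
  shows "ennreal (deficit t) = (\<integral>\<^sup>+w. ennreal (heat t w * (energy - autocorr w)) \<partial>lborel)"
  unfolding deficit_def
proof (rule nn_integral_eq_integral[symmetric])
  show "integrable lborel (\<lambda>w. heat t w * (energy - autocorr w))"
    using integrable_mult_autocorr[OF integrable_heat[OF assms]] integrable_heat[OF assms]
    by (simp add: right_diff_distrib)
qed (use abs_autocorr_le in \<open>auto intro!: AE_I2 mult_nonneg_nonneg simp: abs_le_iff\<close>)

lemma deficit_nonneg: "0 \<le> deficit t"
  unfolding deficit_def by (intro Bochner_Integration.integral_nonneg) (use abs_autocorr_le in \<open>auto simp: abs_le_iff\<close>)

lemma abs_dissipation_le:
  assumes "0 < t"
  shows "\<bar>dissipation t\<bar> \<le> energy * real DIM('a) / t"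
proof -
  have "\<bar>dissipation t\<bar> \<le> (\<integral>w. \<bar>heat_decay t (w::'a)\<bar> * energy \<partial>lborel)"
    unfolding dissipation_def
    using integrable_heat_decay[OF assms, where 'a='a]
    by (intro order_trans[OF integral_abs_bound] integral_mono integrable_abs integrable_mult_autocorr integrable_mult_left abs_mult_autocorr_le)
  also have "\<dots> = (\<integral>w. \<bar>heat_decay t (w::'a)\<bar> \<partial>lborel) * energy"
    by simp
  also have "\<dots> \<le> real DIM('a) / t * energy"
    by (intro mult_right_mono integral_abs_heat_decay_le assms energy_nonneg)
  finally show ?thesis by (simp add: mult.commute)
qed

text \<open>
  The time enters only as a sum \<open>a + b\<close>, while the right-hand side is an inner product of a
  vector depending on \<open>a\<close> with one depending on \<open>b\<close>.
\<close>
lemma dissipation_sum: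
  assumes "0 < a" "0 < b"
  shows "dissipation (a + b) = (\<Sum>e\<in>Basis. \<integral>v. (\<integral>w. heat_slope e a v * heat_slope e b w * autocorr (w - v) \<partial>lborel) \<partial>lborel)"
proof -
  let ?H = "\<lambda>e v r. heat_slope e a v * heat_slope e b (v - r) * autocorr r"
  have I: "integrable (lborel \<Otimes>\<^sub>M lborel) (\<lambda>(v, r). ?H e v r)" if "e \<in> Basis" for e
    using that by (intro autocorr_kernel heat_slope_bound assms)
  have "(\<Sum>e\<in>Basis. \<integral>v. (\<integral>w. heat_slope e a v * heat_slope e b w * autocorr (w - v) \<partial>lborel) \<partial>lborel)
     = (\<Sum>e\<in>Basis. \<integral>r. (\<integral>v. ?H e v r \<partial>lborel) \<partial>lborel)"
    by (intro sum.cong refl autocorr_kernel heat_slope_bound assms)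
  also have "\<dots> = (\<integral>r. (\<Sum>e\<in>Basis. \<integral>v. ?H e v r \<partial>lborel) \<partial>lborel)"
    by (rule Bochner_Integration.integral_sum[symmetric]) (intro lborel_pair.integrable_snd I)
  also have "\<dots> = (\<integral>r. (\<integral>v. (\<Sum>e\<in>Basis. ?H e v r) \<partial>lborel) \<partial>lborel)"
  proof (rule integral_cong_AE)
    have "AE r in lborel. \<forall>e\<in>Basis. integrable lborel (\<lambda>v. ?H e v r)"
      by (intro AE_finite_allI lborel_pair.AE_integrable_snd I) auto
    then show "AE r in lborel. (\<Sum>e\<in>Basis. \<integral>v. ?H e v r \<partial>lborel) = (\<integral>v. (\<Sum>e\<in>Basis. ?H e v r) \<partial>lborel)"
      by eventually_elim (rule Bochner_Integration.integral_sum[symmetric], blast)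
  qed measurable
  also have "\<dots> = (\<integral>r. heat_decay (a + b) r * autocorr r \<partial>lborel)"
    using heat_slope_conv[OF assms, where 'a='a]
    by (simp add: sum_distrib_right[symmetric] has_bochner_integral_iff)
  finally show ?thesis by (simp add: dissipation_def)
qed

lemma dissipation_nonneg:
  assumes "0 < t"
  shows "0 \<le> dissipation t"
proof -
  have t: "0 < t / 2" using assms by simp
  have "dissipation (t / 2 + t / 2) \<ge> 0"
    unfolding dissipation_sum[OF t t]
  proof (rule sum_nonneg)
    fix e :: 'a assume e: "e \<in> Basis"
    note i = heat_slope_bound(1)[OF e t]
    have "(\<integral>v. (\<integral>w. heat_slope e (t/2) v * heat_slope e (t/2) w * autocorr (w - v) \<partial>lborel) \<partial>lborel)
       = (\<integral>p. heat_slope e (t/2) (fst p) * heat_slope e (t/2) (snd p) * autocorr (snd p - fst p) \<partial>(lborel \<Otimes>\<^sub>M lborel))"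
      using lborel_pair.integral_fst'[OF autocorr_posdef(1)[OF sigma_finite_lborel i, of "\<lambda>x. x"]] by simp
    also have "\<dots> \<ge> 0"
      using autocorr_posdef(2)[OF sigma_finite_lborel i, of "\<lambda>x. x"] by simp
    finally show "0 \<le> (\<integral>v. (\<integral>w. heat_slope e (t/2) v * heat_slope e (t/2) w * autocorr (w - v) \<partial>lborel) \<partial>lborel)" .
  qed
  then show ?thesis by simp
qed

text \<open>
  Fundamental theorem of calculus for each fixed increment, then Fubini; the bound
  \<open>DIM('a) / \<tau>\<close> on the $L^1$ norm of the kernel makes the double integral absolutely convergent away
  from time 0.
\<close>
lemma deficit_diff:
  assumes "0 < \<epsilon>" "\<epsilon> \<le> t"
  shows "has_bochner_integral lborel (\<lambda>\<tau>. dissipation \<tau> * indicator {\<epsilon>..t} \<tau>) (deficit t - deficit \<epsilon>)"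
proof -
  let ?F = "\<lambda>w \<tau>. heat_decay \<tau> w * indicator {\<epsilon>..t} \<tau> * autocorr w"
  have ftc: "has_bochner_integral lborel (\<lambda>\<tau>. heat_decay \<tau> w * indicator {\<epsilon>..t} \<tau>) (heat \<epsilon> w - heat t w)" for w :: 'a
  proof -
    have "has_bochner_integral lborel (\<lambda>\<tau>. - heat_decay \<tau> w * indicator {\<epsilon>..t} \<tau>) (heat t w - heat \<epsilon> w)"
    proof (rule has_bochner_integral_FTC_Icc_real[OF assms(2)])
      fix x assume x: "\<epsilon> \<le> x" "x \<le> t"
      then show "DERIV (\<lambda>\<tau>. heat \<tau> w) x :> - heat_decay x w"
        using assms by (intro has_derivative_heat) auto
      show "isCont (\<lambda>x. - heat_decay x w) x"
        unfolding heat_decay_def heat_def using x assms by (intro continuous_intros) auto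
    qed
    from has_bochner_integral_minus[OF this] show ?thesis by simp
  qed
  have ind: "indicator {\<epsilon>..t} \<tau> * (\<integral>w. \<bar>heat_decay \<tau> (w::'a)\<bar> \<partial>lborel) \<le> real DIM('a) / \<epsilon> * indicator {\<epsilon>..t} \<tau>" for \<tau> :: real
  proof (cases "\<tau> \<in> {\<epsilon>..t}")
    case True
    then have "real DIM('a) / \<tau> \<le> real DIM('a) / \<epsilon>" using assms by (auto intro!: divide_left_mono)
    then show ?thesis using True integral_abs_heat_decay_le[of \<tau>, where 'a='a] assms by auto
  qed simp
  have I0: "integrable (lborel \<Otimes>\<^sub>M lborel) (\<lambda>(\<tau>, w::'a). heat_decay \<tau> w * indicator {\<epsilon>..t} \<tau>)"
  proof (rule lborel_pair.Fubini_integrable)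
    have "integrable lborel (\<lambda>\<tau>::real. real DIM('a) / \<epsilon> * indicator {\<epsilon>..t} \<tau>)"
      by (intro integrable_mult_right integrable_real_indicator emeasure_compact_finite) auto
    then show "integrable lborel (\<lambda>\<tau>. \<integral>w. norm (case (\<tau>, w::'a) of (\<tau>, w) \<Rightarrow> heat_decay \<tau> w * indicator {\<epsilon>..t} \<tau>) \<partial>lborel)"
      by (rule Bochner_Integration.integrable_bound)
        (use ind assms in \<open>auto simp: abs_mult mult.commute intro!: AE_I2 intro: order_trans\<close>)
    show "AE \<tau> in lborel. integrable lborel (\<lambda>w::'a. case (\<tau>, w) of (\<tau>, w) \<Rightarrow> heat_decay \<tau> w * indicator {\<epsilon>..t} \<tau>)"
    proof (rule AE_I2)
      fix \<tau> :: real
      show "integrable lborel (\<lambda>w::'a. case (\<tau>, w) of (\<tau>, w) \<Rightarrow> heat_decay \<tau> w * indicator {\<epsilon>..t} \<tau>)"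
        using integrable_heat_decay[of \<tau>, where 'a='a] assms by (cases "\<tau> \<in> {\<epsilon>..t}") auto
    qed
  qed measurable
  have I: "integrable (lborel \<Otimes>\<^sub>M lborel) (\<lambda>(\<tau>, w). ?F w \<tau>)"
    by (rule Bochner_Integration.integrable_bound[OF integrable_mult_left[OF I0, of energy]])
      (use abs_mult_autocorr_le[of "heat_decay \<tau> w * indicator {\<epsilon>..t} \<tau>" w for \<tau> w] energy_nonneg in \<open>auto simp: abs_mult\<close>)
  have eq1: "(\<integral>w. ?F w \<tau> \<partial>lborel) = dissipation \<tau> * indicator {\<epsilon>..t} \<tau>" for \<tau>
    unfolding dissipation_def by (subst integral_mult_left_zero[symmetric]) (simp add: mult_ac)
  have eq2: "(\<integral>\<tau>. ?F w \<tau> \<partial>lborel) = heat \<epsilon> w * autocorr w - heat t w * autocorr w" for w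
    using ftc[of w] by (simp add: has_bochner_integral_iff left_diff_distrib)
  have "integrable lborel (\<lambda>\<tau>. dissipation \<tau> * indicator {\<epsilon>..t} \<tau>)"
    using lborel_pair.integrable_fst[OF I] unfolding eq1 .
  moreover have "(\<integral>\<tau>. dissipation \<tau> * indicator {\<epsilon>..t} \<tau> \<partial>lborel) = (\<integral>w. heat \<epsilon> w * autocorr w - heat t w * autocorr w \<partial>lborel)"
    using lborel_pair.Fubini_integral[OF I] unfolding eq1 eq2 by simp
  moreover have "\<dots> = deficit t - deficit \<epsilon>"
    using assms by (subst Bochner_Integration.integral_diff)
      (auto simp: deficit_eq integrable_mult_autocorr integrable_heat)
  ultimately show ?thesis by (simp add: has_bochner_integral_iff)
qed

end

section \<open>Cauchy--Schwarz for moments of the dissipation\<close>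

lemma nn_integral_Beta:
  assumes "0 < x" "0 < y"
  shows "(\<integral>\<^sup>+s. ennreal (s powr (x - 1) * (1 - s) powr (y - 1)) * indicator {0..1} s \<partial>lborel) = ennreal (Beta x y)"
  by (rule nn_integral_has_integral_lebesgue'[OF _ has_integral_Beta_real[OF assms]]) auto

lemma nn_integral_Beta_scaled:
  assumes "0 < x" "0 < y" "0 < \<tau>"
  shows "(\<integral>\<^sup>+a. ennreal (a powr (x - 1) * (\<tau> - a) powr (y - 1)) * indicator {0..\<tau>} a \<partial>lborel) = ennreal (\<tau> powr (x + y - 1) * Beta x y)"
proof -
  have "(\<integral>\<^sup>+a. ennreal (a powr (x - 1) * (\<tau> - a) powr (y - 1)) * indicator {0..\<tau>} a \<partial>lborel)
    = ennreal \<bar>\<tau>\<bar> * (\<integral>\<^sup>+s. ennreal ((0 + \<tau> * s) powr (x - 1) * (\<tau> - (0 + \<tau> * s)) powr (y - 1)) * indicator {0..\<tau>} (0 + \<tau> * s) \<partial>lborel)"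
    using assms by (intro nn_integral_real_affine) auto
  also have "(\<integral>\<^sup>+s. ennreal ((0 + \<tau> * s) powr (x - 1) * (\<tau> - (0 + \<tau> * s)) powr (y - 1)) * indicator {0..\<tau>} (0 + \<tau> * s) \<partial>lborel)
    = (\<integral>\<^sup>+s. ennreal (\<tau> powr (x - 1) * \<tau> powr (y - 1)) * (ennreal (s powr (x - 1) * (1 - s) powr (y - 1)) * indicator {0..1} s) \<partial>lborel)"
  proof (rule nn_integral_cong)
    fix s :: real
    show "ennreal ((0 + \<tau> * s) powr (x - 1) * (\<tau> - (0 + \<tau> * s)) powr (y - 1)) * indicator {0..\<tau>} (0 + \<tau> * s)
      = ennreal (\<tau> powr (x - 1) * \<tau> powr (y - 1)) * (ennreal (s powr (x - 1) * (1 - s) powr (y - 1)) * indicator {0..1} s)"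
    proof (cases "s \<in> {0..1}")
      case True
      then have m: "0 + \<tau> * s \<in> {0..\<tau>}" using assms by (auto simp: mult_left_le)
      have "\<tau> - (0 + \<tau> * s) = \<tau> * (1 - s)" by (simp add: algebra_simps)
      then have "(0 + \<tau> * s) powr (x - 1) * (\<tau> - (0 + \<tau> * s)) powr (y - 1) = (\<tau> powr (x - 1) * \<tau> powr (y - 1)) * (s powr (x - 1) * (1 - s) powr (y - 1))"
        using True assms by (simp add: powr_mult)
      then show ?thesis using m True by (simp add: ennreal_mult)
    next
      case False
      then have "0 + \<tau> * s \<notin> {0..\<tau>}" using assms by (auto simp: zero_le_mult_iff)
      then show ?thesis using False by simp
    qed
  qed
  also have "\<dots> = ennreal (\<tau> powr (x - 1) * \<tau> powr (y - 1)) * ennreal (Beta x y)"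
    using nn_integral_Beta[OF assms(1,2)] by (subst nn_integral_cmult) auto
  also have "ennreal \<bar>\<tau>\<bar> * (ennreal (\<tau> powr (x - 1) * \<tau> powr (y - 1)) * ennreal (Beta x y)) = ennreal (\<tau> powr (x + y - 1) * Beta x y)"
  proof -
    have "\<tau> * (\<tau> powr (x - 1) * \<tau> powr (y - 1)) = \<tau> powr 1 * (\<tau> powr (x - 1) * \<tau> powr (y - 1))" using assms by simp
    also have "\<dots> = \<tau> powr (x + y - 1)" unfolding powr_add[symmetric] by (simp add: algebra_simps)
    finally have "\<tau> powr (x + y - 1) = \<tau> * (\<tau> powr (x - 1) * \<tau> powr (y - 1))" ..
    moreover have "0 \<le> Beta x y" using assms by (simp add: Beta_def)
    ultimately show ?thesis
      using assms by (simp add: ennreal_mult[symmetric] mult_ac)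
  qed
  finally show ?thesis .
qed

lemma quadratic_form_Cauchy_Schwarz:
  fixes A B C :: real
  assumes "\<And>c. 0 \<le> A + 2 * c * B + c\<^sup>2 * C"
  shows "B\<^sup>2 \<le> A * C"
proof (cases "C = 0")
  case True
  have "B = 0"
  proof (rule ccontr)
    assume "B \<noteq> 0"
    then show False using assms[of "- (A + 1) / (2 * B)"] True by (simp add: field_simps)
  qed
  then show ?thesis using True by simp
next
  case False
  have "0 \<le> C"
  proof (rule ccontr)
    assume "\<not> 0 \<le> C"
    \<comment> \<open>large enough for the quadratic term to dominate\<close>
    define c where "c = (\<bar>A\<bar> + 2 * \<bar>B\<bar> + 1) / \<bar>C\<bar> + 1"
    have c: "1 \<le> c" "c * \<bar>C\<bar> \<ge> \<bar>A\<bar> + 2 * \<bar>B\<bar> + 1"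
      using False by (auto simp: c_def field_simps)
    have "c * (\<bar>A\<bar> + 2 * \<bar>B\<bar> + 1) \<le> c * (c * \<bar>C\<bar>)" using c by (intro mult_left_mono) auto
    moreover have "\<bar>A\<bar> + 1 \<le> c * (\<bar>A\<bar> + 1)" using mult_right_mono[OF c(1), of "\<bar>A\<bar> + 1"] by simp
    moreover have "2 * c * B \<le> 2 * c * \<bar>B\<bar>" using c by simp
    ultimately show False using assms[of c] \<open>\<not> 0 \<le> C\<close>
      by (simp add: power2_eq_square algebra_simps)
  qed
  with False have "0 < C" by simp
  then show ?thesis using assms[of "- B / C"] by (simp add: field_simps power2_eq_square)
qed

context square_integrable
begin

lemma dissipation_weighted_integrable:
  assumes [measurable]: "\<phi> \<in> borel_measurable borel" "\<psi> \<in> borel_measurable borel" and "0 < c"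
    and \<phi>: "\<And>a. \<phi> a \<noteq> 0 \<Longrightarrow> a \<in> {c..C}" "\<And>a. \<bar>\<phi> a\<bar> \<le> M"
    and \<psi>: "\<And>a. \<psi> a \<noteq> 0 \<Longrightarrow> a \<in> {c..C}" "\<And>a. \<bar>\<psi> a\<bar> \<le> M"
  shows "integrable (lborel \<Otimes>\<^sub>M lborel) (\<lambda>p. \<phi> (fst p) * \<psi> (snd p) * dissipation (fst p + snd p))"
proof -
  have "integrable lborel (\<lambda>a. M * indicator {c..C} a)"
    by (intro integrable_mult_right integrable_real_indicator emeasure_compact_finite) auto
  note I = integrable_mult_left[OF integrable_pair_mult[OF sigma_finite_lborel sigma_finite_lborel this this], of "energy * real DIM('a) / c"]
  have M: "0 \<le> M" using \<phi>(2)[of 0] by linarith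
  have "\<bar>\<phi> a * \<psi> b * dissipation (a + b)\<bar> \<le> M * indicator {c..C} a * (M * indicator {c..C} b) * (energy * real DIM('a) / c)" for a b
  proof (cases "\<phi> a = 0 \<or> \<psi> b = 0")
    case True
    then show ?thesis using M energy_nonneg assms(3) by (auto intro!: mult_nonneg_nonneg divide_nonneg_nonneg)
  next
    case False
    then have ab: "a \<in> {c..C}" "b \<in> {c..C}" using \<phi> \<psi> by auto
    have "\<bar>dissipation (a + b)\<bar> \<le> energy * real DIM('a) / (a + b)"
      using ab assms(3) by (intro abs_dissipation_le) auto
    also have "\<dots> \<le> energy * real DIM('a) / c"
      using ab assms(3) energy_nonneg by (intro divide_left_mono) auto
    finally have "\<bar>\<phi> a\<bar> * \<bar>\<psi> b\<bar> * \<bar>dissipation (a + b)\<bar> \<le> M * M * (energy * real DIM('a) / c)"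
      using \<phi>(2)[of a] \<psi>(2)[of b] M by (intro mult_mono mult_nonneg_nonneg) auto
    then show ?thesis using ab by (simp add: abs_mult)
  qed
  note bound = order_trans[OF this abs_ge_self]
  show ?thesis
  proof (rule Bochner_Integration.integrable_bound[OF I])
    show "AE p in lborel \<Otimes>\<^sub>M lborel. norm (\<phi> (fst p) * \<psi> (snd p) * dissipation (fst p + snd p))
        \<le> norm (M * indicator {c..C} (fst p) * (M * indicator {c..C} (snd p)) * (energy * real DIM('a) / c))"
      unfolding real_norm_def by (rule AE_I2, rule bound)
  qed measurable
qed

text \<open>
  For each basis direction the weight \<open>\<phi>\<close> multiplies \<open>heat_slope\<close>, and the resulting kernel in time and
  space is an admissible \<open>\<Psi>\<close> for the positive definiteness of the autocorrelation.  Keeping the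
  support of \<open>\<phi>\<close> away from 0 makes it integrable.
\<close>
lemma dissipation_posdef:
  assumes [measurable]: "\<phi> \<in> borel_measurable borel" and "0 < c"
    and \<phi>: "\<And>a. \<phi> a \<noteq> 0 \<Longrightarrow> a \<in> {c..C}" "\<And>a. \<bar>\<phi> a\<bar> \<le> M"
  shows "0 \<le> (\<integral>p. \<phi> (fst p) * \<phi> (snd p) * dissipation (fst p + snd p) \<partial>(lborel \<Otimes>\<^sub>M lborel))"
proof -
  have M: "0 \<le> M" using \<phi>(2)[of 0] by linarith
  let ?\<Psi> = "\<lambda>e a v. \<phi> a * heat_slope e a (v::'a)"
  let ?L = "\<lambda>e a b. \<integral>v. (\<integral>w. ?\<Psi> e a v * ?\<Psi> e b w * autocorr (w - v) \<partial>lborel) \<partial>lborel"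
  have fib: "integrable lborel (?\<Psi> e a)" if "e \<in> Basis" for e a
    using heat_slope_bound(1)[OF that, of a] \<phi>(1)[of a] assms(2) by (cases "\<phi> a = 0") auto
  have I: "integrable (lborel \<Otimes>\<^sub>M lborel) (\<lambda>(a, v). ?\<Psi> e a v)" if e: "e \<in> Basis" for e
  proof (rule lborel_pair.Fubini_integrable)
    have B: "integrable lborel (\<lambda>a::real. M * ((1 + 2 * C * real DIM('a)) / (2 * c)) * indicator {c..C} a)"
      by (intro integrable_mult_right integrable_real_indicator emeasure_compact_finite) auto
    have "\<bar>\<phi> a\<bar> * (\<integral>v. \<bar>heat_slope e a v\<bar> \<partial>lborel) \<le> M * ((1 + 2 * C * real DIM('a)) / (2 * c)) * indicator {c..C} a" for a
    proof (cases "\<phi> a = 0")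
      case True
      then show ?thesis using M assms(2) by (auto simp: indicator_def intro!: mult_nonneg_nonneg divide_nonneg_nonneg)
    next
      case False
      then have a: "c \<le> a" "a \<le> C" using \<phi>(1)[of a] by auto
      have "(\<integral>v. \<bar>heat_slope e a v\<bar> \<partial>lborel) \<le> (1 + 2 * a * real DIM('a)) / (2 * a)"
        using a assms(2) by (intro heat_slope_bound e) auto
      also have "\<dots> \<le> (1 + 2 * C * real DIM('a)) / (2 * c)"
        using a assms(2) by (intro frac_le) (auto intro!: mult_right_mono)
      finally have "\<bar>\<phi> a\<bar> * (\<integral>v. \<bar>heat_slope e a v\<bar> \<partial>lborel) \<le> M * ((1 + 2 * C * real DIM('a)) / (2 * c))"
        using \<phi>(2)[of a] M by (intro mult_mono) auto
      then show ?thesis using a by simp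
    qed
    then have "\<bar>\<integral>v. \<bar>?\<Psi> e a v\<bar> \<partial>lborel\<bar> \<le> \<bar>M * ((1 + 2 * C * real DIM('a)) / (2 * c)) * indicator {c..C} a\<bar>" for a
      by (intro order_trans[OF _ abs_ge_self]) (simp add: abs_mult)
    then show "integrable lborel (\<lambda>a. \<integral>v. norm (case (a, v) of (a, v) \<Rightarrow> ?\<Psi> e a v) \<partial>lborel)"
      unfolding prod.case real_norm_def
      by (intro Bochner_Integration.integrable_bound[OF B] AE_I2) (simp_all only: real_norm_def, measurable)
  qed (use fib[OF e] in auto)
  have L: "integrable (lborel \<Otimes>\<^sub>M lborel) (\<lambda>p. ?L e (fst p) (snd p))" "0 \<le> (\<integral>p. ?L e (fst p) (snd p) \<partial>(lborel \<Otimes>\<^sub>M lborel))"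
    if "e \<in> Basis" for e
    using autocorr_posdef_fibres[OF I fib, OF that that] by (simp_all add: case_prod_unfold)
  have "\<phi> a * \<phi> b * dissipation (a + b) = (\<Sum>e\<in>Basis. ?L e a b)" for a b
  proof (cases "\<phi> a = 0 \<or> \<phi> b = 0")
    case True
    then show ?thesis by auto
  next
    case False
    then have ab: "0 < a" "0 < b" using \<phi>(1)[of a] \<phi>(1)[of b] assms(2) by auto
    have "?L e a b = \<phi> a * \<phi> b * (\<integral>v. (\<integral>w. heat_slope e a v * heat_slope e b w * autocorr (w - v) \<partial>lborel) \<partial>lborel)" for e
      unfolding integral_mult_right_zero[symmetric] by (simp add: mult_ac)
    then show ?thesis unfolding dissipation_sum[OF ab] by (simp add: sum_distrib_left)
  qed
  then have "(\<integral>p. \<phi> (fst p) * \<phi> (snd p) * dissipation (fst p + snd p) \<partial>(lborel \<Otimes>\<^sub>M lborel))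
    = (\<Sum>e\<in>Basis. \<integral>p. ?L e (fst p) (snd p) \<partial>(lborel \<Otimes>\<^sub>M lborel))"
    by (simp add: L(1))
  also have "\<dots> \<ge> 0" by (intro sum_nonneg L)
  finally show ?thesis .
qed

lemma dissipation_Cauchy_Schwarz:
  assumes [measurable]: "\<phi> \<in> borel_measurable borel" "\<psi> \<in> borel_measurable borel" and "0 < c"
    and \<phi>: "\<And>a. \<phi> a \<noteq> 0 \<Longrightarrow> a \<in> {c..C}" "\<And>a. \<bar>\<phi> a\<bar> \<le> M"
    and \<psi>: "\<And>a. \<psi> a \<noteq> 0 \<Longrightarrow> a \<in> {c..C}" "\<And>a. \<bar>\<psi> a\<bar> \<le> M"
  defines "Q \<equiv> \<lambda>\<phi> \<psi>. \<integral>p. \<phi> (fst p) * \<psi> (snd p) * dissipation (fst p + snd p) \<partial>(lborel \<Otimes>\<^sub>M lborel)"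
  shows "(Q \<phi> \<psi>)\<^sup>2 \<le> Q \<phi> \<phi> * Q \<psi> \<psi>"
proof (rule quadratic_form_Cauchy_Schwarz)
  fix k :: real
  let ?I = "\<lambda>\<phi> \<psi>. (\<lambda>p. \<phi> (fst p) * \<psi> (snd p) * dissipation (fst p + snd p))"
  have i: "integrable (lborel \<Otimes>\<^sub>M lborel) (?I \<phi> \<phi>)" "integrable (lborel \<Otimes>\<^sub>M lborel) (?I \<phi> \<psi>)"
     "integrable (lborel \<Otimes>\<^sub>M lborel) (?I \<psi> \<phi>)" "integrable (lborel \<Otimes>\<^sub>M lborel) (?I \<psi> \<psi>)"
    by (rule dissipation_weighted_integrable[OF assms(1,1,3) \<phi> \<phi>] dissipation_weighted_integrable[OF assms(1,2,3) \<phi> \<psi>]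
        dissipation_weighted_integrable[OF assms(2,1,3) \<psi> \<phi>] dissipation_weighted_integrable[OF assms(2,2,3) \<psi> \<psi>], assumption+)+
  have sym: "Q \<psi> \<phi> = Q \<phi> \<psi>"
  proof -
    have "Q \<psi> \<phi> = (\<integral>(x, y). (?I \<phi> \<psi>) (y, x) \<partial>(lborel \<Otimes>\<^sub>M lborel))"
      unfolding Q_def by (simp add: case_prod_unfold mult_ac add.commute)
    also have "\<dots> = Q \<phi> \<psi>"
      unfolding Q_def by (rule lborel_pair.integral_product_swap) measurable
    finally show ?thesis .
  qed
  \<comment> \<open>Expand the form at \<open>\<phi> + k * \<psi>\<close>; it is nonnegative for every \<open>k\<close>.\<close>
  have "0 \<le> Q (\<lambda>a. \<phi> a + k * \<psi> a) (\<lambda>a. \<phi> a + k * \<psi> a)"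
    unfolding Q_def
  proof (rule dissipation_posdef[where c = c and C = C and M = "M + \<bar>k\<bar> * M"])
    show "\<bar>\<phi> a + k * \<psi> a\<bar> \<le> M + \<bar>k\<bar> * M" for a
      using \<phi>(2)[of a] mult_left_mono[OF \<psi>(2)[of a], of "\<bar>k\<bar>"] by (simp add: abs_mult[symmetric])
    show "a \<in> {c..C}" if "\<phi> a + k * \<psi> a \<noteq> 0" for a
      using \<phi>(1)[of a] \<psi>(1)[of a] that by fastforce
  qed (use assms in auto)
  also have "Q (\<lambda>a. \<phi> a + k * \<psi> a) (\<lambda>a. \<phi> a + k * \<psi> a) = (\<integral>p. ?I \<phi> \<phi> p + k * ?I \<phi> \<psi> p + k * ?I \<psi> \<phi> p + k\<^sup>2 * ?I \<psi> \<psi> p \<partial>(lborel \<Otimes>\<^sub>M lborel))"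
    unfolding Q_def by (intro Bochner_Integration.integral_cong refl) (simp add: algebra_simps power2_eq_square)
  also have "\<dots> = Q \<phi> \<phi> + k * Q \<phi> \<psi> + k * Q \<psi> \<phi> + k\<^sup>2 * Q \<psi> \<psi>"
    unfolding Q_def using i by simp
  finally show "0 \<le> Q \<phi> \<phi> + 2 * k * Q \<phi> \<psi> + k\<^sup>2 * Q \<psi> \<psi>" by (simp add: sym)
qed

text \<open>
  The Mellin transform of the dissipation.
\<close>
definition moment :: "real \<Rightarrow> ennreal" where
  "moment p = (\<integral>\<^sup>+\<tau>. ennreal (\<tau> powr (p - 1) * dissipation \<tau>) * indicator {0<..} \<tau> \<partial>lborel)"

text \<open>
  Powers of \<open>a\<close> and \<open>b\<close> integrated over the segment \<open>a + b = \<tau>\<close> give a Beta function times a power of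
  \<open>\<tau>\<close>.
\<close>
lemma moment_convolution:
  assumes "0 < x" "0 < y"
  shows "(\<integral>\<^sup>+p. ennreal (fst p powr (x - 1) * snd p powr (y - 1) * dissipation (fst p + snd p)) * indicator ({0<..} \<times> {0<..}) p \<partial>(lborel \<Otimes>\<^sub>M lborel))
    = ennreal (Beta x y) * moment (x + y)"
proof -
  have m [measurable]: "{0::real<..} \<times> {0::real<..} \<in> sets (borel \<Otimes>\<^sub>M (borel :: real measure))" by (intro pair_measureI) auto
  have "(\<integral>\<^sup>+p. ennreal (fst p powr (x - 1) * snd p powr (y - 1) * dissipation (fst p + snd p)) * indicator ({0<..} \<times> {0<..}) p \<partial>(lborel \<Otimes>\<^sub>M lborel))
    = (\<integral>\<^sup>+a. (\<integral>\<^sup>+b. ennreal (a powr (x - 1) * b powr (y - 1) * dissipation (a + b)) * (indicator {0<..} a * indicator {0<..} b) \<partial>lborel) \<partial>lborel)"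
    by (subst lborel.nn_integral_fst[symmetric]) (auto simp: indicator_times)
  also have "\<dots> = (\<integral>\<^sup>+a. (\<integral>\<^sup>+\<tau>. ennreal (a powr (x - 1) * (\<tau> - a) powr (y - 1) * dissipation \<tau>) * (indicator {0<..} a * indicator {0<..} (\<tau> - a)) \<partial>lborel) \<partial>lborel)"
  proof (rule nn_integral_cong)
    fix a :: real
    show "(\<integral>\<^sup>+b. ennreal (a powr (x - 1) * b powr (y - 1) * dissipation (a + b)) * (indicator {0<..} a * indicator {0<..} b) \<partial>lborel)
      = (\<integral>\<^sup>+\<tau>. ennreal (a powr (x - 1) * (\<tau> - a) powr (y - 1) * dissipation \<tau>) * (indicator {0<..} a * indicator {0<..} (\<tau> - a)) \<partial>lborel)"
      using nn_integral_shift_minus[of "\<lambda>b. ennreal (a powr (x - 1) * b powr (y - 1) * dissipation (a + b)) * (indicator {0<..} a * indicator {0<..} b)" a]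
      by simp
  qed
  also have "\<dots> = (\<integral>\<^sup>+\<tau>. (\<integral>\<^sup>+a. ennreal (a powr (x - 1) * (\<tau> - a) powr (y - 1) * dissipation \<tau>) * (indicator {0<..} a * indicator {0<..} (\<tau> - a)) \<partial>lborel) \<partial>lborel)"
    by (rule lborel_pair.Fubini'[symmetric]) measurable
  also have "\<dots> = (\<integral>\<^sup>+\<tau>. ennreal (Beta x y) * (ennreal (\<tau> powr (x + y - 1) * dissipation \<tau>) * indicator {0<..} \<tau>) \<partial>lborel)"
  proof (rule nn_integral_cong)
    fix \<tau> :: real
    show "(\<integral>\<^sup>+a. ennreal (a powr (x - 1) * (\<tau> - a) powr (y - 1) * dissipation \<tau>) * (indicator {0<..} a * indicator {0<..} (\<tau> - a)) \<partial>lborel)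
      = ennreal (Beta x y) * (ennreal (\<tau> powr (x + y - 1) * dissipation \<tau>) * indicator {0<..} \<tau>)"
    proof (cases "0 < \<tau>")
      case True
      have "(\<integral>\<^sup>+a. ennreal (a powr (x - 1) * (\<tau> - a) powr (y - 1) * dissipation \<tau>) * (indicator {0<..} a * indicator {0<..} (\<tau> - a)) \<partial>lborel)
        = (\<integral>\<^sup>+a. ennreal (dissipation \<tau>) * (ennreal (a powr (x - 1) * (\<tau> - a) powr (y - 1)) * indicator {0..\<tau>} a) \<partial>lborel)"
        using dissipation_nonneg[OF True] by (intro nn_integral_cong) (auto simp: indicator_def ennreal_mult[symmetric] mult_ac)
      also have "\<dots> = ennreal (dissipation \<tau>) * ennreal (\<tau> powr (x + y - 1) * Beta x y)"
        by (subst nn_integral_cmult) (simp_all add: nn_integral_Beta_scaled assms True)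
      also have "\<dots> = ennreal (Beta x y) * (ennreal (\<tau> powr (x + y - 1) * dissipation \<tau>) * indicator {0<..} \<tau>)"
        using True dissipation_nonneg[OF True] assms by (simp add: ennreal_mult[symmetric] Beta_def mult_ac)
      finally show ?thesis .
    next
      case False
      then have *: "ennreal (a powr (x - 1) * (\<tau> - a) powr (y - 1) * dissipation \<tau>) * (indicator {0<..} a * indicator {0<..} (\<tau> - a)) = 0" for a
        by (auto simp: indicator_def)
      show ?thesis using False by (simp only: *) simp
    qed
  qed
  also have "\<dots> = ennreal (Beta x y) * moment (x + y)"
    unfolding moment_def by (rule nn_integral_cmult) measurable
  finally show ?thesis .
qed

text \<open>
  Cauchy--Schwarz for the form $\iint \phi(a)\psi(b)\,h(a+b)\,da\,db$, with $h$ the dissipation, at the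
  power weights $a^{x-1}$ and $b^{y-1}$.  The weights are truncated to \<open>{1 / Suc n..Suc n}\<close> first, where the form is
  finite; positivity of the dissipation allows monotone convergence in \<open>n\<close>.
\<close>
lemma moment_Cauchy_Schwarz:
  assumes x: "0 < x" and y: "0 < y" and fin: "moment (2 * x) < \<infinity>" "moment (2 * y) < \<infinity>"
  shows "ennreal (Beta x y) * moment (x + y) \<le> ennreal (sqrt (Beta x x * enn2real (moment (2 * x)) * (Beta y y * enn2real (moment (2 * y)))))"
proof -
  define S :: "real \<Rightarrow> real \<Rightarrow> real \<times> real \<Rightarrow> ennreal" where
    "S x y p = ennreal (fst p powr (x - 1) * snd p powr (y - 1) * dissipation (fst p + snd p)) * indicator ({0<..} \<times> {0<..}) p" for x y p
  define \<phi> :: "real \<Rightarrow> nat \<Rightarrow> real \<Rightarrow> real" where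
    "\<phi> x n a = a powr (x - 1) * indicator {1 / Suc n..Suc n} a" for x n a
  define Q where "Q x y n = (\<integral>p. \<phi> x n (fst p) * \<phi> y n (snd p) * dissipation (fst p + snd p) \<partial>(lborel \<Otimes>\<^sub>M lborel))" for x y n
  have m [measurable]: "{0::real<..} \<times> {0::real<..} \<in> sets (borel \<Otimes>\<^sub>M (borel :: real measure))" by (intro pair_measureI) auto
  have S_meas [measurable]: "S x y \<in> borel_measurable (lborel \<Otimes>\<^sub>M lborel)" for x y
    unfolding S_def by measurable
  have \<phi>_meas [measurable]: "\<phi> x n \<in> borel_measurable borel" for x n
    unfolding \<phi>_def by measurable
  have \<phi>_supp: "a \<in> {1 / Suc n..Suc n}" if "\<phi> x n a \<noteq> 0" for x n a
    using that by (auto simp: \<phi>_def indicator_def split: if_splits)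
  have \<phi>_bdd: "\<exists>M. \<forall>a. \<bar>\<phi> x n a\<bar> \<le> M" for x n
  proof -
    have "compact ((\<lambda>a. a powr (x - 1)) ` {1 / Suc n..real (Suc n)})"
      by (intro compact_continuous_image continuous_intros) auto
    then obtain M where M: "\<And>a. a \<in> {1 / Suc n..real (Suc n)} \<Longrightarrow> \<bar>a powr (x - 1)\<bar> \<le> M"
      using compact_imp_bounded[THEN bounded_iff[THEN iffD1]] by (metis imageI real_norm_def)
    have "\<bar>\<phi> x n a\<bar> \<le> \<bar>M\<bar>" for a
      using M[of a] by (auto simp: \<phi>_def indicator_def)
    then show ?thesis by blast
  qed
  have Q_nn: "ennreal (Q x y n) = (\<integral>\<^sup>+p. ennreal (\<phi> x n (fst p) * \<phi> y n (snd p) * dissipation (fst p + snd p)) \<partial>(lborel \<Otimes>\<^sub>M lborel))"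
    and Q_nonneg: "0 \<le> Q x y n"
    and CS: "(Q x y n)\<^sup>2 \<le> Q x x n * Q y y n" for x y n
  proof -
    obtain M1 M2 where "\<forall>a. \<bar>\<phi> x n a\<bar> \<le> M1" "\<forall>a. \<bar>\<phi> y n a\<bar> \<le> M2"
      using \<phi>_bdd by meson
    then have M: "\<bar>\<phi> x n a\<bar> \<le> max M1 M2" "\<bar>\<phi> y n a\<bar> \<le> max M1 M2" for a
      by (auto simp: le_max_iff_disj)
    have c: "0 < 1 / real (Suc n)" by simp
    have nn: "0 \<le> \<phi> x n a * \<phi> y n b * dissipation (a + b)" for a b
    proof (cases "\<phi> x n a = 0 \<or> \<phi> y n b = 0")
      case False
      then have "0 < 1 / real (Suc n)" "1 / real (Suc n) \<le> a" "1 / real (Suc n) \<le> b" using \<phi>_supp[of x n a] \<phi>_supp[of y n b] by auto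
      then have "0 < a + b" by linarith
      then show ?thesis by (intro mult_nonneg_nonneg dissipation_nonneg) (auto simp: \<phi>_def)
    qed auto
    show "ennreal (Q x y n) = (\<integral>\<^sup>+p. ennreal (\<phi> x n (fst p) * \<phi> y n (snd p) * dissipation (fst p + snd p)) \<partial>(lborel \<Otimes>\<^sub>M lborel))"
      unfolding Q_def
      by (intro nn_integral_eq_integral[symmetric] dissipation_weighted_integrable[OF \<phi>_meas \<phi>_meas c \<phi>_supp M(1) \<phi>_supp M(2)])
        (use nn in auto)
    show "0 \<le> Q x y n"
      unfolding Q_def by (intro Bochner_Integration.integral_nonneg nn)
    show "(Q x y n)\<^sup>2 \<le> Q x x n * Q y y n"
      unfolding Q_def by (rule dissipation_Cauchy_Schwarz[OF \<phi>_meas \<phi>_meas c \<phi>_supp M(1) \<phi>_supp M(2)])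
  qed
  have total: "(\<integral>\<^sup>+p. S x y p \<partial>(lborel \<Otimes>\<^sub>M lborel)) = ennreal (Beta x y) * moment (x + y)" if "0 < x" "0 < y" for x y
    unfolding S_def by (rule moment_convolution[OF that])
  have Q_le: "Q x x n \<le> Beta x x * enn2real (moment (2 * x))" if x: "0 < x" "moment (2 * x) < \<infinity>" for x n
  proof -
    have "ennreal (Q x x n) \<le> (\<integral>\<^sup>+p. S x x p \<partial>(lborel \<Otimes>\<^sub>M lborel))"
      unfolding Q_nn S_def
    proof (intro nn_integral_mono)
      fix p :: "real \<times> real"
      show "ennreal (\<phi> x n (fst p) * \<phi> x n (snd p) * dissipation (fst p + snd p)) \<le>
        ennreal (fst p powr (x - 1) * snd p powr (x - 1) * dissipation (fst p + snd p)) * indicator ({0<..} \<times> {0<..}) p"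
      proof (cases "fst p \<in> {1 / Suc n..Suc n} \<and> snd p \<in> {1 / Suc n..Suc n}")
        case True
        moreover have "0 < 1 / real (Suc n)" by simp
        ultimately have "0 < fst p" "0 < snd p" using less_le_trans by (metis atLeastAtMost_iff)+
        then have "p \<in> {0<..} \<times> {0<..}" by (cases p) auto
        then show ?thesis using True by (simp add: \<phi>_def)
      qed (auto simp: \<phi>_def)
    qed
    also have "\<dots> = ennreal (Beta x x) * moment (2 * x)" using total[of x x] x by simp
    also have "\<dots> = ennreal (Beta x x * enn2real (moment (2 * x)))"
    proof -
      have "0 \<le> Beta x x" using x by (simp add: Beta_def)
      then show ?thesis using x by (simp add: ennreal_mult)
    qed
    finally show ?thesis
      using x by (subst (asm) ennreal_le_iff) (auto simp: Beta_def)
  qed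
  have lim: "(\<lambda>n. ennreal (Q x y n)) \<longlonglongrightarrow> (\<integral>\<^sup>+p. S x y p \<partial>(lborel \<Otimes>\<^sub>M lborel))"
    unfolding Q_nn
  proof (rule nn_integral_LIMSEQ)
    show "incseq (\<lambda>n p. ennreal (\<phi> x n (fst p) * \<phi> y n (snd p) * dissipation (fst p + snd p)))"
    proof (intro incseq_SucI le_funI ennreal_leI)
      fix n and p :: "real \<times> real"
      show "\<phi> x n (fst p) * \<phi> y n (snd p) * dissipation (fst p + snd p) \<le> \<phi> x (Suc n) (fst p) * \<phi> y (Suc n) (snd p) * dissipation (fst p + snd p)"
      proof (cases "\<phi> x n (fst p) = 0 \<or> \<phi> y n (snd p) = 0")
        case True
        have "0 \<le> \<phi> x (Suc n) (fst p) * \<phi> y (Suc n) (snd p) * dissipation (fst p + snd p)"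
        proof (cases "\<phi> x (Suc n) (fst p) = 0 \<or> \<phi> y (Suc n) (snd p) = 0")
          case False
          then have "0 < 1 / real (Suc (Suc n))" "1 / real (Suc (Suc n)) \<le> fst p" "1 / real (Suc (Suc n)) \<le> snd p"
            using \<phi>_supp[of x "Suc n" "fst p"] \<phi>_supp[of y "Suc n" "snd p"] by auto
          then have "0 < fst p + snd p" by linarith
          then show ?thesis by (intro mult_nonneg_nonneg dissipation_nonneg) (auto simp: \<phi>_def)
        qed auto
        then show ?thesis using True by auto
      next
        case False
        have mono: "a \<in> {1 / real (Suc (Suc n))..Suc (Suc n)}" if "a \<in> {1 / real (Suc n)..Suc n}" for a :: real
        proof -
          have "1 / real (Suc (Suc n)) \<le> 1 / real (Suc n)" by (intro divide_left_mono) auto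
          then show ?thesis using that by auto
        qed
        have "\<phi> x (Suc n) (fst p) = \<phi> x n (fst p)" "\<phi> y (Suc n) (snd p) = \<phi> y n (snd p)"
          using False \<phi>_supp[of x n "fst p"] \<phi>_supp[of y n "snd p"] mono unfolding \<phi>_def by auto
        then show ?thesis by simp
      qed
    qed
    show "(\<lambda>n. ennreal (\<phi> x n (fst p) * \<phi> y n (snd p) * dissipation (fst p + snd p))) \<longlonglongrightarrow> S x y p" for p
    proof (cases "p \<in> {0<..} \<times> {0<..}")
      case True
      then have ab: "0 < fst p" "0 < snd p" by (cases p; auto)+
      have ev: "\<forall>\<^sub>F n in sequentially. a \<in> {1 / real (Suc n)..Suc n}" if "0 < a" for a :: real
      proof -
        have "(\<lambda>n. 1 / real (Suc n)) \<longlonglongrightarrow> 0" by (rule LIMSEQ_Suc[OF lim_1_over_n])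
        then have "\<forall>\<^sub>F n in sequentially. 1 / real (Suc n) < a" using that by (rule order_tendstoD)
        moreover have "\<forall>\<^sub>F n in sequentially. a \<le> real n" by (rule eventually_sequentiallyI[of "nat \<lceil>a\<rceil>"]) linarith
        ultimately show ?thesis by eventually_elim auto
      qed
      have "\<forall>\<^sub>F n in sequentially. ennreal (\<phi> x n (fst p) * \<phi> y n (snd p) * dissipation (fst p + snd p)) = S x y p"
        using ev[OF ab(1)] ev[OF ab(2)] by eventually_elim (use True in \<open>simp add: \<phi>_def S_def\<close>)
      then show ?thesis by (rule tendsto_eventually)
    next
      case False
      have *: "\<phi> x n (fst p) * \<phi> y n (snd p) = 0" for n
      proof (rule ccontr)
        assume "\<phi> x n (fst p) * \<phi> y n (snd p) \<noteq> 0"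
        then have "0 < 1 / real (Suc n)" "1 / real (Suc n) \<le> fst p" "1 / real (Suc n) \<le> snd p"
          using \<phi>_supp[of x n "fst p"] \<phi>_supp[of y n "snd p"] by auto
        then have "0 < fst p" "0 < snd p" by linarith+
        then show False using False by (cases p) auto
      qed
      show ?thesis using False by (simp only: * mult_zero_left ennreal_0) (simp add: S_def)
    qed
  qed measurable
  have bound: "ennreal (Q x y n) \<le> ennreal (sqrt (Beta x x * enn2real (moment (2 * x)) * (Beta y y * enn2real (moment (2 * y)))))" for n
  proof (intro ennreal_leI real_le_rsqrt)
    have "(Q x y n)\<^sup>2 \<le> Q x x n * Q y y n" by (rule CS)
    also have "\<dots> \<le> Beta x x * enn2real (moment (2 * x)) * (Beta y y * enn2real (moment (2 * y)))"
      using Q_nonneg fin x y by (intro mult_mono Q_le) (auto simp: Beta_def)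
    finally show "(Q x y n)\<^sup>2 \<le> Beta x x * enn2real (moment (2 * x)) * (Beta y y * enn2real (moment (2 * y)))" .
  qed
  show ?thesis
    by (rule LIMSEQ_le_const2[OF lim[unfolded total[OF x y]]]) (use bound in simp)
qed

text \<open>
  For a spectral measure $\nu$ with $h(t) = \int \lambda e^{-t\lambda}\,d\nu(\lambda)$ this is
  $\int \lambda^\gamma\,d\nu(\lambda)$, because $\int_0^\infty t^{-\gamma} e^{-t\lambda}\,dt = \Gamma(1-\gamma)\lambda^{\gamma-1}$.
  No such measure is constructed.
\<close>
definition spectral :: "real \<Rightarrow> real" where
  "spectral \<gamma> = enn2real (moment (1 - \<gamma>)) / Gamma (1 - \<gamma>)"

text \<open>
  The Gamma factors of the three Beta functions in \<open>moment_Cauchy_Schwarz\<close> are exactly those that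
  normalise the three moments, so the constant is 1.
\<close>
lemma spectral_midpoint:
  assumes "\<alpha> < 1" "\<beta> < 1" "moment (1 - \<alpha>) < \<infinity>" "moment (1 - \<beta>) < \<infinity>"
  shows "(spectral ((\<alpha> + \<beta>) / 2))\<^sup>2 \<le> spectral \<alpha> * spectral \<beta>"
proof -
  define x where "x = (1 - \<alpha>) / 2"
  define y where "y = (1 - \<beta>) / 2"
  have xy: "0 < x" "0 < y" "2 * x = 1 - \<alpha>" "2 * y = 1 - \<beta>" "x + y = 1 - (\<alpha> + \<beta>) / 2"
    using assms by (auto simp: x_def y_def field_simps)
  define m where "m p = enn2real (moment p)" for p
  have m0: "0 \<le> m p" for p by (simp add: m_def)
  have B: "0 < Beta x y" "0 \<le> Beta x x" "0 \<le> Beta y y" using xy by (auto simp: Beta_def)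
  have "ennreal (Beta x y) * moment (x + y) \<le> ennreal (sqrt (Beta x x * m (2 * x) * (Beta y y * m (2 * y))))"
    unfolding m_def using assms xy by (intro moment_Cauchy_Schwarz) auto
  then have "enn2real (ennreal (Beta x y) * moment (x + y)) \<le> sqrt (Beta x x * m (2 * x) * (Beta y y * m (2 * y)))"
    using B m0 by (intro enn2real_leI) auto
  then have "Beta x y * m (x + y) \<le> sqrt (Beta x x * m (2 * x) * (Beta y y * m (2 * y)))"
    using B by (simp add: enn2real_mult m_def)
  then have "(Beta x y * m (x + y))\<^sup>2 \<le> Beta x x * m (2 * x) * (Beta y y * m (2 * y))"
    using B m0 by (metis mult_nonneg_nonneg less_imp_le power_mono real_sqrt_pow2)
  then have "(Gamma x * Gamma y)\<^sup>2 * (m (x + y) / Gamma (x + y))\<^sup>2 \<le> (Gamma x * Gamma y)\<^sup>2 * (m (2 * x) / Gamma (2 * x) * (m (2 * y) / Gamma (2 * y)))"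
    by (simp add: Beta_def power2_eq_square mult_ac)
  moreover have "0 < (Gamma x * Gamma y)\<^sup>2" using xy by (simp add: Gamma_real_pos less_imp_neq[symmetric])
  ultimately have "(m (x + y) / Gamma (x + y))\<^sup>2 \<le> m (2 * x) / Gamma (2 * x) * (m (2 * y) / Gamma (2 * y))"
    by (simp only: mult_le_cancel_left_pos)
  then show ?thesis unfolding spectral_def xy(3,4)[symmetric] m_def[symmetric] xy(5)[symmetric] .
qed

end

section \<open>Fractional seminorms as moments of the dissipation\<close>

text \<open>
  Euler's integral after the substitution \<open>t \<mapsto> c / t\<close>.
\<close>
lemma nn_integral_inverse_Gamma:
  assumes "0 < \<alpha>" "0 < c"
  shows "(\<integral>\<^sup>+t. ennreal (t powr (- \<alpha> - 1) * exp (- c / t)) * indicator {0<..} t \<partial>lborel) = ennreal (Gamma \<alpha> * c powr (- \<alpha>))" (is "?X = _")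
proof -
  let ?f = "\<lambda>t. t powr (\<alpha> - 1) / exp t"
  have G: "(?f has_integral Gamma \<alpha>) {0<..}"
  proof -
    have "((\<lambda>t. if t \<in> {0<..} then ?f t else 0) has_integral Gamma \<alpha>) {0..}"
      by (rule has_integral_spike[OF _ _ Gamma_integral_real[OF assms(1)], of "{0}"]) auto
    also have "?this = ?thesis"
      by (subst has_integral_restrict) auto
    finally show ?thesis .
  qed
  let ?g = "\<lambda>t. c / t" and ?g' = "\<lambda>t. - c / t\<^sup>2"
  have img: "?g ` {0<..} = {0<..}"
  proof -
    have "x \<in> ?g ` {0<..}" if "0 < x" for x
      using that assms by (intro image_eqI[of _ _ "c / x"]) auto
    then show ?thesis using assms by auto
  qed
  have "(?f absolutely_integrable_on ?g ` {0<..} \<and> integral (?g ` {0<..}) ?f = Gamma \<alpha>)"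
    unfolding img using G by (auto simp: has_integral_iff intro!: nonnegative_absolutely_integrable_1)
  then have "(\<lambda>x. \<bar>?g' x\<bar> * ?f (?g x)) absolutely_integrable_on {0<..} \<and> integral {0<..} (\<lambda>x. \<bar>?g' x\<bar> * ?f (?g x)) = Gamma \<alpha>"
    by (subst has_absolute_integral_change_of_variables_1')
      (use assms in \<open>auto intro!: derivative_eq_intros inj_onI simp: power2_eq_square\<close>)
  then have "((\<lambda>x. \<bar>?g' x\<bar> * ?f (?g x)) has_integral Gamma \<alpha>) {0<..}"
    by (auto simp: has_integral_iff dest: set_lebesgue_integral_eq_integral(1))
  then have 1: "(\<integral>\<^sup>+t. ennreal (\<bar>?g' t\<bar> * ?f (?g t)) * indicator {0<..} t \<partial>lborel) = ennreal (Gamma \<alpha>)"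
    by (intro nn_integral_has_integral_lebesgue') auto
  have eq: "\<bar>?g' t\<bar> * ?f (?g t) = c powr \<alpha> * (t powr (- \<alpha> - 1) * exp (- c / t))" if "0 < t" for t
  proof -
    have "\<bar>?g' t\<bar> * ?f (?g t) = (c powr 1 * c powr (\<alpha> - 1)) * (inverse (t powr 2) * inverse (t powr (\<alpha> - 1))) * exp (- c / t)"
      using that assms by (simp add: powr_divide exp_minus field_simps powr_numeral)
    also have "inverse (t powr 2) * inverse (t powr (\<alpha> - 1)) = t powr (- \<alpha> - 1)"
      unfolding powr_minus[symmetric] powr_add[symmetric] by (rule arg_cong[where f = "\<lambda>x. t powr x"]) simp
    also have "c powr 1 * c powr (\<alpha> - 1) = c powr \<alpha>"
      unfolding powr_add[symmetric] by simp
    finally show ?thesis by simp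
  qed
  have "ennreal (c powr \<alpha>) * (\<integral>\<^sup>+t. ennreal (t powr (- \<alpha> - 1) * exp (- c / t)) * indicator {0<..} t \<partial>lborel) = ennreal (Gamma \<alpha>)"
    unfolding 1[symmetric]
  proof (subst nn_integral_cmult[symmetric], measurable, rule nn_integral_cong)
    fix t :: real
    show "ennreal (c powr \<alpha>) * (ennreal (t powr (- \<alpha> - 1) * exp (- c / t)) * indicator {0<..} t) = ennreal (\<bar>?g' t\<bar> * ?f (?g t)) * indicator {0<..} t"
    proof (cases "0 < t")
      case True
      show ?thesis unfolding eq[OF True] by (simp add: ennreal_mult mult.assoc)
    qed simp
  qed
  then have A: "ennreal (c powr \<alpha>) * ?X = ennreal (Gamma \<alpha>)" .
  have B: "ennreal (c powr (- \<alpha>)) * ennreal (c powr \<alpha>) = 1"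
    using assms by (simp add: ennreal_mult[symmetric] powr_add[symmetric])
  have "?X = ennreal (c powr (- \<alpha>)) * ennreal (c powr \<alpha>) * ?X"
    unfolding B by simp
  also have "\<dots> = ennreal (c powr (- \<alpha>)) * ennreal (Gamma \<alpha>)"
    unfolding mult.assoc A ..
  also have "\<dots> = ennreal (Gamma \<alpha> * c powr (- \<alpha>))"
    using assms by (subst ennreal_mult[symmetric]) (auto simp: mult.commute)
  finally show ?thesis .
qed

definition subordination_const :: "nat \<Rightarrow> real \<Rightarrow> real" where
  "subordination_const d s = 4 powr s * Gamma (real d / 2 + s) / pi powr (real d / 2)"

text \<open>
  The fractional kernel is a mixture of heat kernels over all times.
\<close>
lemma subordination:
  fixes w :: "'a::euclidean_space"
  assumes "0 < s" "w \<noteq> 0"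
  shows "(\<integral>\<^sup>+t. ennreal (heat t w * t powr (- 1 - s)) * indicator {0<..} t \<partial>lborel) =
    ennreal (subordination_const DIM('a) s / norm w powr (real DIM('a) + 2 * s))"
proof -
  let ?d = "real DIM('a)"
  let ?\<alpha> = "?d / 2 + s" and ?c = "(norm w)\<^sup>2 / 4"
  have \<alpha>: "0 < ?\<alpha>" and c: "0 < ?c" using assms by (auto intro!: add_nonneg_pos)
  have eq: "heat t w * t powr (- 1 - s) = (4 * pi) powr (- (?d / 2)) * (t powr (- ?\<alpha> - 1) * exp (- ?c / t))" if "0 < t" for t
  proof -
    have "(4 * pi * t) powr (- (?d / 2)) = (4 * pi) powr (- (?d / 2)) * t powr (- (?d / 2))"
      using that by (intro powr_mult) 
    moreover have "t powr (- (?d / 2)) * t powr (- 1 - s) = t powr (- ?\<alpha> - 1)"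
      unfolding powr_add[symmetric] by (rule arg_cong[where f = "\<lambda>x. t powr x"]) simp
    ultimately show ?thesis by (simp add: heat_def mult_ac)
  qed
  have "(\<integral>\<^sup>+t. ennreal (heat t w * t powr (- 1 - s)) * indicator {0<..} t \<partial>lborel)
     = ennreal ((4 * pi) powr (- (?d / 2))) * ennreal (Gamma ?\<alpha> * ?c powr (- ?\<alpha>))"
    unfolding nn_integral_inverse_Gamma[OF \<alpha> c, symmetric]
  proof (subst nn_integral_cmult[symmetric], measurable, rule nn_integral_cong)
    fix t :: real
    show "ennreal (heat t w * t powr (- 1 - s)) * indicator {0<..} t = ennreal ((4 * pi) powr (- (?d / 2))) * (ennreal (t powr (- ?\<alpha> - 1) * exp (- ?c / t)) * indicator {0<..} t)"
    proof (cases "0 < t")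
      case True
      show ?thesis unfolding eq[OF True] by (simp add: ennreal_mult mult.assoc)
    qed simp
  qed
  also have "\<dots> = ennreal ((4 * pi) powr (- (?d / 2)) * (Gamma ?\<alpha> * ?c powr (- ?\<alpha>)))"
    using \<alpha> by (subst ennreal_mult) auto
  also have "(4 * pi) powr (- (?d / 2)) * (Gamma ?\<alpha> * ?c powr (- ?\<alpha>)) = subordination_const DIM('a) s / norm w powr (?d + 2 * s)"
  proof -
    have p1: "(norm w)\<^sup>2 powr (- ?\<alpha>) = norm w powr (- (?d + 2 * s))"
    proof -
      have "(norm w)\<^sup>2 powr (- ?\<alpha>) = norm w powr (2 * (- ?\<alpha>))"
        using assms by (simp only: powr_powr[symmetric] powr_numeral zero_less_norm_iff norm_ge_zero)
      also have "2 * (- ?\<alpha>) = - (?d + 2 * s)" by simp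
      finally show ?thesis .
    qed
    have p2: "(1/4) powr (- ?\<alpha>) = 4 powr ?\<alpha>"
    proof -
      have "(1/4) powr (- ?\<alpha>) = (4 powr (- 1)) powr (- ?\<alpha>)" by (simp add: powr_minus)
      also have "\<dots> = 4 powr ?\<alpha>" unfolding powr_powr by (simp add: add.commute)
      finally show ?thesis .
    qed
    have p3: "?c powr (- ?\<alpha>) = (norm w)\<^sup>2 powr (- ?\<alpha>) * (1/4) powr (- ?\<alpha>)"
      using powr_mult[of "(norm w)\<^sup>2" "1/4" "- ?\<alpha>"] by simp
    have p4: "(4 * pi) powr (- (?d / 2)) = 4 powr (- (?d / 2)) * pi powr (- (?d / 2))"
      by (rule powr_mult)
    have p5: "4 powr (- (?d / 2)) * 4 powr ?\<alpha> = (4::real) powr s"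
      unfolding powr_add[symmetric] by simp
    have "(4 * pi) powr (- (?d / 2)) * (Gamma ?\<alpha> * ?c powr (- ?\<alpha>)) =
        (4 powr (- (?d / 2)) * 4 powr ?\<alpha>) * Gamma ?\<alpha> * pi powr (- (?d / 2)) * norm w powr (- (?d + 2 * s))"
    proof -
      have "(a * b) * (c * (d * e)) = (a * e) * c * b * d" for a b c d e :: real by simp
      then show ?thesis unfolding p4 p3 p2 p1 .
    qed
    also have "\<dots> = subordination_const DIM('a) s / norm w powr (?d + 2 * s)"
      unfolding p5 unfolding subordination_const_def powr_minus by (simp only: divide_inverse)
    finally show ?thesis .
  qed
  finally show ?thesis .
qed

lemma nn_integral_powr_tail:
  assumes "0 < s" "0 < \<tau>"
  shows "(\<integral>\<^sup>+t. ennreal (t powr (- 1 - s)) * indicator {\<tau>..} t \<partial>lborel) = ennreal (\<tau> powr (- s) / s)"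
proof -
  have "(\<integral>\<^sup>+t. ennreal (t powr (- 1 - s)) * indicator {\<tau>..} t \<partial>lborel) = ennreal (0 - (- (\<tau> powr (- s) / s)))"
  proof (rule nn_integral_FTC_atLeast)
    show "((\<lambda>t. - (t powr (- s) / s)) has_real_derivative x powr (- 1 - s)) (at x)" if "\<tau> \<le> x" for x
    proof -
      have "0 < x" using that assms by simp
      then have "((\<lambda>t. - (t powr (- s) / s)) has_real_derivative - ((- s * x powr (- s - 1)) / s)) (at x)"
        by (intro DERIV_minus DERIV_cdivide has_real_derivative_powr)
      moreover have "- s - 1 = - 1 - s" by simp
      ultimately show ?thesis using assms by simp
    qed
    have "((\<lambda>t. - (t powr (- s) / s)) \<longlongrightarrow> - (0 / s)) at_top"
      using assms by (intro tendsto_intros tendsto_neg_powr filterlim_ident) auto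
    then show "((\<lambda>t. - (t powr (- s) / s)) \<longlongrightarrow> 0) at_top" by simp
  qed auto
  then show ?thesis by simp
qed

context square_integrable
begin

text \<open>
  Integrating over the base point first leaves one integral over the increment \<open>h\<close>.
\<close>
definition gagliardo :: "real \<Rightarrow> ennreal" where
  "gagliardo s = (\<integral>\<^sup>+h. ennreal (2 * (energy - autocorr h) / norm h powr (real DIM('a) + 2 * s)) \<partial>lborel)"

lemma gagliardo_integral_eq: "gagliardo_integral s u = gagliardo s"
proof -
  let ?k = "\<lambda>h::'a. norm h powr (real DIM('a) + 2 * s)"
  have "gagliardo_integral s u = (\<integral>\<^sup>+x. (\<integral>\<^sup>+y. ennreal ((norm (u x - u y))\<^sup>2 / ?k (x - y)) \<partial>lborel) \<partial>lborel)"
    unfolding gagliardo_integral_def nn_integral_completion ..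
  also have "\<dots> = (\<integral>\<^sup>+x. (\<integral>\<^sup>+h. ennreal ((norm (u (x + h) - u x))\<^sup>2 / ?k h) \<partial>lborel) \<partial>lborel)"
  proof (rule nn_integral_cong)
    fix x
    show "(\<integral>\<^sup>+y. ennreal ((norm (u x - u y))\<^sup>2 / ?k (x - y)) \<partial>lborel) = (\<integral>\<^sup>+h. ennreal ((norm (u (x + h) - u x))\<^sup>2 / ?k h) \<partial>lborel)"
      using nn_integral_shift_minus[of "\<lambda>h. ennreal ((norm (u (x + h) - u x))\<^sup>2 / ?k h)" x]
      by (simp add: norm_minus_commute)
  qed
  also have "\<dots> = (\<integral>\<^sup>+h. (\<integral>\<^sup>+x. ennreal ((norm (u (x + h) - u x))\<^sup>2 / ?k h) \<partial>lborel) \<partial>lborel)"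
    by (rule lborel_pair.Fubini'[symmetric]) measurable
  also have "\<dots> = (\<integral>\<^sup>+h. ennreal (2 * (energy - autocorr h)) * ennreal (1 / ?k h) \<partial>lborel)"
    unfolding nn_integral_diff_square[symmetric]
    by (intro nn_integral_cong, subst nn_integral_multc[symmetric]) (simp_all add: ennreal_mult[symmetric])
  also have "\<dots> = gagliardo s"
    unfolding gagliardo_def
    using abs_autocorr_le by (intro nn_integral_cong) (simp add: ennreal_mult[symmetric] abs_le_iff)
  finally show ?thesis .
qed

lemma gagliardo_eq_deficit:
  assumes "0 < s"
  shows "(\<integral>\<^sup>+t. ennreal (deficit t * t powr (- 1 - s)) * indicator {0<..} t \<partial>lborel)
    = ennreal (subordination_const DIM('a) s / 2) * gagliardo s"
proof -
  have E: "0 \<le> energy - autocorr w" for w using abs_autocorr_le[of w] by (simp add: abs_le_iff)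
  have sc: "0 \<le> subordination_const DIM('a) s"
    using assms by (auto simp: subordination_const_def intro!: divide_nonneg_nonneg mult_nonneg_nonneg)
  have "(\<integral>\<^sup>+t. ennreal (deficit t * t powr (- 1 - s)) * indicator {0<..} t \<partial>lborel)
    = (\<integral>\<^sup>+t. (\<integral>\<^sup>+w. ennreal ((energy - autocorr w) * (heat t w * t powr (- 1 - s))) * indicator {0<..} t \<partial>lborel) \<partial>lborel)"
  proof (rule nn_integral_cong)
    fix t :: real
    show "ennreal (deficit t * t powr (- 1 - s)) * indicator {0<..} t
      = (\<integral>\<^sup>+w. ennreal ((energy - autocorr w) * (heat t w * t powr (- 1 - s))) * indicator {0<..} t \<partial>lborel)"
    proof (cases "0 < t")
      case True
      have "ennreal (deficit t * t powr (- 1 - s)) = ennreal (deficit t) * ennreal (t powr (- 1 - s))"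
        using deficit_nonneg by (simp add: ennreal_mult)
      also have "\<dots> = (\<integral>\<^sup>+w. ennreal (heat t w * (energy - autocorr w)) * ennreal (t powr (- 1 - s)) \<partial>lborel)"
        unfolding nn_deficit[OF True] by (rule nn_integral_multc[symmetric]) measurable
      also have "\<dots> = (\<integral>\<^sup>+w. ennreal ((energy - autocorr w) * (heat t w * t powr (- 1 - s))) \<partial>lborel)"
        using E by (intro nn_integral_cong) (simp add: ennreal_mult[symmetric] mult_ac)
      finally show ?thesis using True by simp
    qed simp
  qed
  also have "\<dots> = (\<integral>\<^sup>+w. (\<integral>\<^sup>+t. ennreal ((energy - autocorr w) * (heat t w * t powr (- 1 - s))) * indicator {0<..} t \<partial>lborel) \<partial>lborel)"
    by (rule lborel_pair.Fubini') measurable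
  also have "\<dots> = (\<integral>\<^sup>+w. ennreal (subordination_const DIM('a) s / 2) * ennreal (2 * (energy - autocorr w) / norm w powr (real DIM('a) + 2 * s)) \<partial>lborel)"
  proof (rule nn_integral_cong)
    fix w :: 'a
    show "(\<integral>\<^sup>+t. ennreal ((energy - autocorr w) * (heat t w * t powr (- 1 - s))) * indicator {0<..} t \<partial>lborel)
      = ennreal (subordination_const DIM('a) s / 2) * ennreal (2 * (energy - autocorr w) / norm w powr (real DIM('a) + 2 * s))"
    proof (cases "w = 0")
      case True
      have "autocorr 0 = energy" by (simp add: autocorr_def energy_def power2_norm_eq_inner)
      then show ?thesis using True by simp
    next
      case False
      have "(\<integral>\<^sup>+t. ennreal ((energy - autocorr w) * (heat t w * t powr (- 1 - s))) * indicator {0<..} t \<partial>lborel)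
        = ennreal (energy - autocorr w) * (\<integral>\<^sup>+t. ennreal (heat t w * t powr (- 1 - s)) * indicator {0<..} t \<partial>lborel)"
        using E by (subst nn_integral_cmult[symmetric]) (auto intro!: nn_integral_cong simp: ennreal_mult mult.assoc)
      also have "\<dots> = ennreal (subordination_const DIM('a) s / 2) * ennreal (2 * (energy - autocorr w) / norm w powr (real DIM('a) + 2 * s))"
      proof -
        have "X * (k / N) = k / 2 * (2 * X / N)" for X k N :: real by simp
        then show ?thesis
          unfolding subordination[OF assms False] using E[of w] sc
          by (simp only: ennreal_mult[symmetric] divide_nonneg_nonneg zero_le_numeral powr_ge_zero mult_nonneg_nonneg)
      qed
      finally show ?thesis .
    qed
  qed
  also have "\<dots> = ennreal (subordination_const DIM('a) s / 2) * gagliardo s"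
    unfolding gagliardo_def by (rule nn_integral_cmult) measurable
  finally show ?thesis .
qed

lemma deficit_mono:
  assumes "0 < x" "x \<le> y"
  shows "deficit x \<le> deficit y"
proof -
  have "0 \<le> (\<integral>\<tau>. dissipation \<tau> * indicator {x..y} \<tau> \<partial>lborel)"
    using assms dissipation_nonneg by (intro Bochner_Integration.integral_nonneg) (auto simp: indicator_def)
  then show ?thesis using deficit_diff[OF assms] by (simp add: has_bochner_integral_iff)
qed

text \<open>
  This is $g(t) \ge 0$, from the semigroup law and positive definiteness.
\<close>
lemma deficit_le_energy:
  assumes "0 < t"
  shows "deficit t \<le> energy"
proof -
  have t: "0 < t / 2" using assms by simp
  have i: "integrable lborel (heat (t/2) :: 'a \<Rightarrow> real)" by (rule integrable_heat[OF t])
  have "0 \<le> (\<integral>p. heat (t/2) (fst p) * heat (t/2) (snd p) * autocorr (snd p - fst p) \<partial>(lborel \<Otimes>\<^sub>M lborel))"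
    using autocorr_posdef(2)[OF sigma_finite_lborel i, of "\<lambda>x. x"] by simp
  also have "\<dots> = (\<integral>v. (\<integral>w. heat (t/2) v * heat (t/2) w * autocorr (w - v) \<partial>lborel) \<partial>lborel)"
    using lborel_pair.integral_fst'[OF autocorr_posdef(1)[OF sigma_finite_lborel i, of "\<lambda>x. x"]] by simp
  also have "\<dots> = (\<integral>r. (\<integral>v. heat (t/2) v * heat (t/2) (v - r) * autocorr r \<partial>lborel) \<partial>lborel)"
    by (rule autocorr_kernel[OF i i])
  also have "\<dots> = (\<integral>r. heat t r * autocorr r \<partial>lborel)"
    using heat_conv[OF t t, where 'a='a] by (simp add: has_bochner_integral_iff)
  finally show ?thesis using deficit_eq[OF assms] by simp
qed

text \<open>
  The deficit increases with time, so its value at \<open>t\<close> is controlled by the integral over \<open>{t..2 * t}\<close>.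
\<close>
lemma deficit_le_powr:
  assumes "0 < s" and fin: "(\<integral>\<^sup>+t. ennreal (deficit t * t powr (- 1 - s)) * indicator {0<..} t \<partial>lborel) < \<infinity>"
  obtains K where "0 \<le> K" "\<And>t. 0 < t \<Longrightarrow> deficit t \<le> K * t powr s"
proof -
  define I where "I = enn2real (\<integral>\<^sup>+t. ennreal (deficit t * t powr (- 1 - s)) * indicator {0<..} t \<partial>lborel)"
  have "deficit t \<le> 2 powr (1 + s) * I * t powr s" if t: "0 < t" for t
  proof -
    have "ennreal (deficit t * (2 * t) powr (- 1 - s) * t) = (\<integral>\<^sup>+x. ennreal (deficit t * (2 * t) powr (- 1 - s)) * indicator {t..2 * t} x \<partial>lborel)"
      using t deficit_nonneg[of t] by (simp add: nn_integral_cmult_indicator ennreal_mult[symmetric])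
    also have "\<dots> \<le> (\<integral>\<^sup>+t. ennreal (deficit t * t powr (- 1 - s)) * indicator {0<..} t \<partial>lborel)"
    proof (rule nn_integral_mono)
      fix x :: real
      show "ennreal (deficit t * (2 * t) powr (- 1 - s)) * indicator {t..2 * t} x \<le> ennreal (deficit x * x powr (- 1 - s)) * indicator {0<..} x"
      proof (cases "x \<in> {t..2*t}")
        case True
        then have "deficit t * (2 * t) powr (- 1 - s) \<le> deficit x * x powr (- 1 - s)"
          using t assms deficit_nonneg by (intro mult_mono deficit_mono powr_mono2') auto
        then show ?thesis using True t by (auto intro: ennreal_leI)
      qed simp
    qed
    also have "\<dots> = ennreal I" using fin by (simp add: I_def)
    finally have "deficit t * (2 * t) powr (- 1 - s) * t \<le> I"
      by (subst (asm) ennreal_le_iff) (auto simp: I_def)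
    moreover have "(2 * t) powr (- 1 - s) * t = 1 / (2 powr (1 + s) * t powr s)"
    proof -
      have "(2 * t) powr (- 1 - s) = (2 * t) powr (- (1 + s))" by simp
      also have "\<dots> = 1 / (2 powr (1 + s) * (t powr 1 * t powr s))"
        unfolding powr_minus powr_mult powr_add[symmetric, of t] by (simp add: inverse_eq_divide)
      finally show ?thesis using t by simp
    qed
    ultimately have "deficit t * (1 / (2 powr (1 + s) * t powr s)) \<le> I" by (simp add: mult.assoc)
    then show ?thesis using t by (simp add: divide_le_eq mult_ac)
  qed
  then show ?thesis by (intro that[of "2 powr (1 + s) * I"]) (auto simp: I_def)
qed

text \<open>
  $e^{t\Delta}u \to u$ in $L^2$.  Each of the finiteness assumptions that occur gives this directly, in the
  form of a bound by a positive power of \<open>t\<close>.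
\<close>
definition deficit_vanishes :: bool where
  "deficit_vanishes \<longleftrightarrow> (deficit \<longlongrightarrow> 0) (at_right 0)"

lemma deficit_vanishesI:
  assumes "0 < s" "\<And>t. 0 < t \<Longrightarrow> deficit t \<le> K * t powr s"
  shows deficit_vanishes
  unfolding deficit_vanishes_def
proof (rule tendsto_sandwich)
  show "\<forall>\<^sub>F t in at_right 0. 0 \<le> deficit t" by (simp add: deficit_nonneg)
  show "\<forall>\<^sub>F t in at_right 0. deficit t \<le> K * t powr s"
    using assms(2) by (auto simp: eventually_at_right_less eventually_at_filter)
  have "((\<lambda>t. K * t powr s) \<longlongrightarrow> K * 0 powr s) (at_right 0)"
    using assms(1) by (intro tendsto_intros) (auto simp: eventually_at_filter)
  then show "((\<lambda>t. K * t powr s) \<longlongrightarrow> 0) (at_right 0)" using assms(1) by simp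
qed simp

lemma nn_dissipation_Icc:
  assumes "0 < \<epsilon>" "\<epsilon> \<le> t"
  shows "(\<integral>\<^sup>+\<tau>. ennreal (dissipation \<tau>) * indicator {\<epsilon>..t} \<tau> \<partial>lborel) = ennreal (deficit t - deficit \<epsilon>)"
proof -
  have "(\<integral>\<^sup>+\<tau>. ennreal (dissipation \<tau>) * indicator {\<epsilon>..t} \<tau> \<partial>lborel) = (\<integral>\<^sup>+\<tau>. ennreal (dissipation \<tau> * indicator {\<epsilon>..t} \<tau>) \<partial>lborel)"
    by (intro nn_integral_cong) (auto simp: indicator_def)
  also have "\<dots> = ennreal (deficit t - deficit \<epsilon>)"
    using deficit_diff[OF assms] assms dissipation_nonneg
    by (subst nn_integral_eq_integral) (auto simp: has_bochner_integral_iff indicator_def)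
  finally show ?thesis .
qed

lemma nn_dissipation_Ioc:
  assumes deficit_vanishes "0 < t"
  shows "(\<integral>\<^sup>+\<tau>. ennreal (dissipation \<tau>) * indicator {0<..t} \<tau> \<partial>lborel) = ennreal (deficit t)"
proof (rule LIMSEQ_unique)
  let ?\<epsilon> = "\<lambda>n. t / real (Suc n)"
  have \<epsilon>: "0 < ?\<epsilon> n" "?\<epsilon> n \<le> t" for n using assms(2) by (auto simp: field_simps)
  have lim: "filterlim ?\<epsilon> (at_right 0) sequentially"
    unfolding filterlim_at using \<epsilon> LIMSEQ_Suc[OF lim_const_over_n[of t]] by (auto simp: less_imp_neq)
  show "(\<lambda>n. \<integral>\<^sup>+\<tau>. ennreal (dissipation \<tau>) * indicator {?\<epsilon> n..t} \<tau> \<partial>lborel) \<longlonglongrightarrow> (\<integral>\<^sup>+\<tau>. ennreal (dissipation \<tau>) * indicator {0<..t} \<tau> \<partial>lborel)"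
  proof (rule nn_integral_LIMSEQ)
    show "incseq (\<lambda>n \<tau>. ennreal (dissipation \<tau>) * indicator {?\<epsilon> n..t} \<tau>)"
    proof (intro incseq_SucI le_funI)
      fix n \<tau>
      have "?\<epsilon> (Suc n) \<le> ?\<epsilon> n" using assms(2) by (intro divide_left_mono) auto
      then show "ennreal (dissipation \<tau>) * indicator {?\<epsilon> n..t} \<tau> \<le> ennreal (dissipation \<tau>) * indicator {?\<epsilon> (Suc n)..t} \<tau>"
        by (auto simp: indicator_def)
    qed
    show "(\<lambda>n. ennreal (dissipation \<tau>) * indicator {?\<epsilon> n..t} \<tau>) \<longlonglongrightarrow> ennreal (dissipation \<tau>) * indicator {0<..t} \<tau>" for \<tau>
    proof (cases "0 < \<tau>")
      case True
      have "\<forall>\<^sub>F n in sequentially. ?\<epsilon> n < \<tau>"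
        using LIMSEQ_Suc[OF lim_const_over_n[of t]] True by (rule order_tendstoD)
      then have "\<forall>\<^sub>F n in sequentially. ennreal (dissipation \<tau>) * indicator {?\<epsilon> n..t} \<tau> = ennreal (dissipation \<tau>) * indicator {0<..t} \<tau>"
        by eventually_elim (use True in \<open>auto simp: indicator_def\<close>)
      then show ?thesis by (rule tendsto_eventually)
    next
      case False
      then have *: "indicator {?\<epsilon> n..t} \<tau> = (0::ennreal)" for n using \<epsilon>(1)[of n] by (auto simp: indicator_def)
      show ?thesis using False by (simp only: * mult_zero_right) simp
    qed
  qed measurable
  have "(\<lambda>n. ennreal (deficit t - deficit (?\<epsilon> n))) \<longlonglongrightarrow> ennreal (deficit t - 0)"
    using assms(1) unfolding deficit_vanishes_def
    by (intro tendsto_ennrealI tendsto_diff tendsto_const filterlim_compose[OF _ lim])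
  then show "(\<lambda>n. \<integral>\<^sup>+\<tau>. ennreal (dissipation \<tau>) * indicator {?\<epsilon> n..t} \<tau> \<partial>lborel) \<longlonglongrightarrow> ennreal (deficit t)"
    using nn_dissipation_Icc[OF \<epsilon>] by simp
qed

text \<open>
  Tonelli, with the deficit written as the integral of the dissipation from time 0.
\<close>
lemma moment_eq_deficit:
  assumes v: deficit_vanishes and s: "0 < s"
  shows "moment (1 - s) = ennreal s * (\<integral>\<^sup>+t. ennreal (deficit t * t powr (- 1 - s)) * indicator {0<..} t \<partial>lborel)"
proof -
  have "(\<integral>\<^sup>+t. ennreal (deficit t * t powr (- 1 - s)) * indicator {0<..} t \<partial>lborel)
    = (\<integral>\<^sup>+t. (\<integral>\<^sup>+\<tau>. (ennreal (dissipation \<tau>) * indicator {0<..} \<tau>) * (ennreal (t powr (- 1 - s)) * indicator {0..} (t - \<tau>)) \<partial>lborel) \<partial>lborel)"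
  proof (rule nn_integral_cong)
    fix t :: real
    show "ennreal (deficit t * t powr (- 1 - s)) * indicator {0<..} t
      = (\<integral>\<^sup>+\<tau>. (ennreal (dissipation \<tau>) * indicator {0<..} \<tau>) * (ennreal (t powr (- 1 - s)) * indicator {0..} (t - \<tau>)) \<partial>lborel)"
    proof (cases "0 < t")
      case True
      have "ennreal (deficit t * t powr (- 1 - s)) * indicator {0<..} t = ennreal (deficit t) * ennreal (t powr (- 1 - s))"
        using True deficit_nonneg by (simp add: ennreal_mult)
      also have "\<dots> = (\<integral>\<^sup>+\<tau>. (ennreal (dissipation \<tau>) * indicator {0<..t} \<tau>) * ennreal (t powr (- 1 - s)) \<partial>lborel)"
        unfolding nn_dissipation_Ioc[OF v True, symmetric] by (rule nn_integral_multc[symmetric]) measurable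
      also have "\<dots> = (\<integral>\<^sup>+\<tau>. (ennreal (dissipation \<tau>) * indicator {0<..} \<tau>) * (ennreal (t powr (- 1 - s)) * indicator {0..} (t - \<tau>)) \<partial>lborel)"
        by (intro nn_integral_cong) (auto simp: indicator_def)
      finally show ?thesis .
    next
      case False
      then have *: "(ennreal (dissipation \<tau>) * indicator {0<..} \<tau>) * (ennreal (t powr (- 1 - s)) * indicator {0..} (t - \<tau>)) = 0" for \<tau>
        by (auto simp: indicator_def)
      show ?thesis using False by (simp only: *) simp
    qed
  qed
  also have "\<dots> = (\<integral>\<^sup>+\<tau>. (\<integral>\<^sup>+t. (ennreal (dissipation \<tau>) * indicator {0<..} \<tau>) * (ennreal (t powr (- 1 - s)) * indicator {0..} (t - \<tau>)) \<partial>lborel) \<partial>lborel)"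
    by (rule lborel_pair.Fubini') measurable
  also have "\<dots> = (\<integral>\<^sup>+\<tau>. ennreal (1 / s) * (ennreal (\<tau> powr (1 - s - 1) * dissipation \<tau>) * indicator {0<..} \<tau>) \<partial>lborel)"
  proof (rule nn_integral_cong)
    fix \<tau> :: real
    have "(\<integral>\<^sup>+t. (ennreal (dissipation \<tau>) * indicator {0<..} \<tau>) * (ennreal (t powr (- 1 - s)) * indicator {0..} (t - \<tau>)) \<partial>lborel)
      = (ennreal (dissipation \<tau>) * indicator {0<..} \<tau>) * (\<integral>\<^sup>+t. ennreal (t powr (- 1 - s)) * indicator {\<tau>..} t \<partial>lborel)"
      by (subst nn_integral_cmult[symmetric]) (auto intro!: nn_integral_cong simp: indicator_def)
    also have "\<dots> = ennreal (1 / s) * (ennreal (\<tau> powr (1 - s - 1) * dissipation \<tau>) * indicator {0<..} \<tau>)"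
    proof (cases "0 < \<tau>")
      case True
      then show ?thesis
        using nn_integral_powr_tail[OF s True] dissipation_nonneg[OF True] s
        by (simp add: ennreal_mult[symmetric] mult_ac)
    qed simp
    finally show "(\<integral>\<^sup>+t. (ennreal (dissipation \<tau>) * indicator {0<..} \<tau>) * (ennreal (t powr (- 1 - s)) * indicator {0..} (t - \<tau>)) \<partial>lborel)
      = ennreal (1 / s) * (ennreal (\<tau> powr (1 - s - 1) * dissipation \<tau>) * indicator {0<..} \<tau>)" .
  qed
  also have "\<dots> = ennreal (1 / s) * moment (1 - s)"
    unfolding moment_def by (rule nn_integral_cmult) measurable
  finally have "ennreal s * (\<integral>\<^sup>+t. ennreal (deficit t * t powr (- 1 - s)) * indicator {0<..} t \<partial>lborel) = (ennreal s * ennreal (1 / s)) * moment (1 - s)"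
    by (simp add: mult.assoc)
  then show ?thesis using s by (simp add: ennreal_mult[symmetric])
qed

text \<open>
  The total dissipation is at most the initial energy; this is the endpoint \<open>\<gamma> = 0\<close>.
\<close>
lemma moment_one_le: "moment 1 \<le> ennreal energy"
proof (rule LIMSEQ_le_const2)
  show "(\<lambda>n. \<integral>\<^sup>+\<tau>. ennreal (dissipation \<tau>) * indicator {1 / real (Suc n)..real (Suc n)} \<tau> \<partial>lborel) \<longlonglongrightarrow> moment 1"
    unfolding moment_def
  proof (rule nn_integral_LIMSEQ)
    show "incseq (\<lambda>n \<tau>. ennreal (dissipation \<tau>) * indicator {1 / real (Suc n)..real (Suc n)} \<tau>)"
    proof (intro incseq_SucI le_funI)
      fix n and \<tau> :: real
      have "1 / real (Suc (Suc n)) \<le> 1 / real (Suc n)" by (intro divide_left_mono) auto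
      then show "ennreal (dissipation \<tau>) * indicator {1 / real (Suc n)..real (Suc n)} \<tau> \<le> ennreal (dissipation \<tau>) * indicator {1 / real (Suc (Suc n))..real (Suc (Suc n))} \<tau>"
        by (auto simp: indicator_def)
    qed
    show "(\<lambda>n. ennreal (dissipation \<tau>) * indicator {1 / real (Suc n)..real (Suc n)} \<tau>) \<longlonglongrightarrow> ennreal (\<tau> powr (1 - 1) * dissipation \<tau>) * indicator {0<..} \<tau>" for \<tau>
    proof (cases "0 < \<tau>")
      case True
      have "\<forall>\<^sub>F n in sequentially. 1 / real (Suc n) < \<tau>"
        using LIMSEQ_Suc[OF lim_1_over_n] True by (rule order_tendstoD)
      moreover have "\<forall>\<^sub>F n in sequentially. \<tau> \<le> real n" by (rule eventually_sequentiallyI[of "nat \<lceil>\<tau>\<rceil>"]) linarith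
      ultimately have "\<forall>\<^sub>F n in sequentially. ennreal (dissipation \<tau>) * indicator {1 / real (Suc n)..real (Suc n)} \<tau> = ennreal (\<tau> powr (1 - 1) * dissipation \<tau>) * indicator {0<..} \<tau>"
        by eventually_elim (use True in \<open>auto simp: indicator_def\<close>)
      then show ?thesis by (rule tendsto_eventually)
    next
      case False
      then have *: "indicator {1 / real (Suc n)..real (Suc n)} \<tau> = (0::ennreal)" for n
        using le_less_trans[of "1 / real (Suc n)" \<tau> 0] by (auto simp: indicator_def not_less dest: order_trans)
      show ?thesis using False by (simp only: * mult_zero_right) simp
    qed
  qed measurable
  have "(\<integral>\<^sup>+\<tau>. ennreal (dissipation \<tau>) * indicator {1 / real (Suc n)..real (Suc n)} \<tau> \<partial>lborel) \<le> ennreal energy" for n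
  proof -
    have "1 / real (Suc n) \<le> 1" by simp
    also have "1 \<le> real (Suc n)" by simp
    finally show ?thesis
      using deficit_le_energy[of "real (Suc n)"] deficit_nonneg[of "1 / real (Suc n)"]
      by (subst nn_dissipation_Icc) (auto intro!: ennreal_leI)
  qed
  then show "\<exists>N. \<forall>n\<ge>N. (\<integral>\<^sup>+\<tau>. ennreal (dissipation \<tau>) * indicator {1 / real (Suc n)..real (Suc n)} \<tau> \<partial>lborel) \<le> ennreal energy" by blast
qed

end

section \<open>Interpolation of the moments\<close>

lemma not_nonpos_Ints_pos: "0 < (x::real) \<Longrightarrow> x \<notin> \<int>\<^sub>\<le>\<^sub>0"
  by (auto elim!: nonpos_Ints_cases)

text \<open>
  Divide \<open>f\<close> by the log-linear function \<open>c\<close> with the same boundary values.  If the quotient exceeded 1, its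
  leftmost maximum would be an interior point violating the midpoint inequality.
\<close>
lemma midpoint_log_convex_pos:
  fixes f :: "real \<Rightarrow> real"
  assumes ab: "a < b" and cont: "continuous_on {a..b} f" and pos: "\<And>x. x \<in> {a..b} \<Longrightarrow> 0 < f x"
    and mid: "\<And>x y. x \<in> {a..b} \<Longrightarrow> y \<in> {a..b} \<Longrightarrow> (f ((x + y) / 2))\<^sup>2 \<le> f x * f y"
    and \<theta>: "0 \<le> \<theta>" "\<theta> \<le> 1"
  shows "f (\<theta> * b + (1 - \<theta>) * a) \<le> f b powr \<theta> * f a powr (1 - \<theta>)"
proof -
  define w where "w x = (x - a) / (b - a)" for x
  define c where "c x = f b powr w x * f a powr (1 - w x)" for x
  define n where "n x = f x / c x" for x
  have fab: "0 < f a" "0 < f b" using pos[of a] pos[of b] ab by auto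
  have c_pos: "0 < c x" for x unfolding c_def using fab by simp
  have n_cont: "continuous_on {a..b} n"
    unfolding n_def c_def w_def using fab ab c_pos[unfolded c_def w_def]
    by (intro continuous_intros cont) (auto simp: less_imp_neq)
  have c_mid: "(c ((x + y) / 2))\<^sup>2 = c x * c y" for x y
  proof -
    have "(x + y) / 2 - a = ((x - a) + (y - a)) / 2" by (simp add: field_simps)
    then have w: "w ((x + y) / 2) = (w x + w y) / 2"
      unfolding w_def by (simp only: add_divide_distrib divide_divide_eq_left mult.commute)
    have "(c ((x + y) / 2))\<^sup>2 = f b powr (w ((x + y) / 2) + w ((x + y) / 2)) * f a powr ((1 - w ((x + y) / 2)) + (1 - w ((x + y) / 2)))"
      unfolding c_def powr_add by (simp add: power2_eq_square mult_ac)
    also have "\<dots> = f b powr (w x + w y) * f a powr ((1 - w x) + (1 - w y))"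
    proof -
      have e1: "(w x + w y) / 2 + (w x + w y) / 2 = w x + w y" by (rule field_sum_of_halves)
      have "(1 - q / 2) + (1 - q / 2) = 2 - q" for q :: real by simp
      from this[of "w x + w y"] have e2: "(1 - (w x + w y) / 2) + (1 - (w x + w y) / 2) = (1 - w x) + (1 - w y)"
        by (rule trans) simp
      show ?thesis unfolding w e1 e2 ..
    qed
    also have "\<dots> = c x * c y" unfolding c_def powr_add by (simp add: mult_ac)
    finally show ?thesis .
  qed
  have n_mid: "(n ((x + y) / 2))\<^sup>2 \<le> n x * n y" if "x \<in> {a..b}" "y \<in> {a..b}" for x y
  proof -
    have "(f ((x + y) / 2))\<^sup>2 / (c x * c y) \<le> (f x * f y) / (c x * c y)"
      using mid[OF that] c_pos[of x] c_pos[of y] by (intro divide_right_mono) auto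
    then show ?thesis unfolding n_def power_divide c_mid by simp
  qed
  have n_ends: "n a = 1" "n b = 1" using fab ab by (simp_all add: n_def c_def w_def)
  obtain m where m: "m \<in> {a..b}" "\<And>x. x \<in> {a..b} \<Longrightarrow> n x \<le> n m"
    using continuous_attains_sup[OF _ _ n_cont] ab by auto
  \<comment> \<open>the leftmost point at which the maximum is attained\<close>
  define T where "T = {x \<in> {a..b}. n x = n m}"
  have "compact T"
  proof -
    have "closed T" unfolding T_def by (rule continuous_closed_preimage_constant[OF n_cont]) simp
    moreover have "bounded T" by (rule bounded_subset[of "{a..b}"]) (auto simp: T_def)
    ultimately show ?thesis by (simp add: compact_eq_bounded_closed)
  qed
  moreover have "T \<noteq> {}" using m by (auto simp: T_def)
  ultimately have "\<exists>p\<in>T. \<forall>x\<in>T. p \<le> x" by (rule compact_attains_inf)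
  then obtain p where p: "p \<in> T" "\<And>x. x \<in> T \<Longrightarrow> p \<le> x" by blast
  have "n m \<le> 1"
  proof (cases "p = a \<or> p = b")
    case True
    then have "n p = 1" by (elim disjE) (simp_all only: n_ends)
    moreover have "n p = n m" using p(1) by (simp add: T_def)
    ultimately show ?thesis by simp
  next
    case False
    \<comment> \<open>the radius of the largest symmetric interval around \<open>p\<close> inside \<open>{a..b}\<close>\<close>
    define r where "r = min (p - a) (b - p)"
    have r: "0 < r" "p - r \<in> {a..b}" "p + r \<in> {a..b}"
      using False p(1) by (auto simp: T_def r_def)
    have np: "0 < n (p - r)" "0 < n (p + r)" using r pos c_pos by (simp_all add: n_def)
    have "p - r \<notin> T" using p(2)[of "p - r"] r by auto
    then have lt: "n (p - r) < n m" using m(2)[OF r(2)] r by (auto simp: T_def)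
    have "(n p)\<^sup>2 \<le> n (p - r) * n (p + r)" using n_mid[OF r(2,3)] by simp
    also have "\<dots> < n m * n m" 
      using lt m(2)[OF r(3)] np by (intro mult_strict_right_mono[THEN less_le_trans] mult_left_mono) auto
    finally show ?thesis using p(1) by (simp add: T_def power2_eq_square)
  qed
  moreover have mem: "\<theta> * b + (1 - \<theta>) * a \<in> {a..b}"
  proof -
    have "\<theta> * b + (1 - \<theta>) * a = a + \<theta> * (b - a)" by (simp add: algebra_simps)
    moreover have "\<theta> * (b - a) \<le> 1 * (b - a)" "0 \<le> \<theta> * (b - a)" using ab \<theta> by (auto intro!: mult_right_mono)
    ultimately show ?thesis by auto
  qed
  ultimately have "n (\<theta> * b + (1 - \<theta>) * a) \<le> 1" using m(2) by fastforce
  moreover have "w (\<theta> * b + (1 - \<theta>) * a) = \<theta>"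
  proof -
    have "\<theta> * b + (1 - \<theta>) * a - a = \<theta> * (b - a)" by (simp add: algebra_simps)
    then show ?thesis using ab by (simp add: w_def)
  qed
  moreover have "f x \<le> c x" if "n x \<le> 1" for x
    using that c_pos[of x] by (simp add: n_def divide_le_eq)
  ultimately show ?thesis unfolding c_def by metis
qed

text \<open>
  Adding a constant \<open>\<delta> > 0\<close> preserves the midpoint inequality, by the inequality between the
  arithmetic and the geometric mean.  Zeros of \<open>f\<close> are handled by letting \<open>\<delta>\<close> tend to 0.
\<close>
lemma midpoint_log_convex:
  fixes f :: "real \<Rightarrow> real"
  assumes ab: "a < b" and cont: "continuous_on {a..b} f" and nonneg: "\<And>x. x \<in> {a..b} \<Longrightarrow> 0 \<le> f x"
    and mid: "\<And>x y. x \<in> {a..b} \<Longrightarrow> y \<in> {a..b} \<Longrightarrow> (f ((x + y) / 2))\<^sup>2 \<le> f x * f y"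
    and \<theta>: "0 < \<theta>" "\<theta> < 1"
  shows "f (\<theta> * b + (1 - \<theta>) * a) \<le> f b powr \<theta> * f a powr (1 - \<theta>)"
proof (rule tendsto_le[of "at_right 0"])
  show "((\<lambda>\<delta>. f (\<theta> * b + (1 - \<theta>) * a) + \<delta>) \<longlongrightarrow> f (\<theta> * b + (1 - \<theta>) * a)) (at_right 0)"
    by (auto intro!: tendsto_eq_intros)
  have lim: "((\<lambda>\<delta>. (f x + \<delta>) powr t) \<longlongrightarrow> f x powr t) (at_right 0)" if "x \<in> {a..b}" "0 < t" for x t
  proof (rule tendsto_powr')
    show "((\<lambda>\<delta>. f x + \<delta>) \<longlongrightarrow> f x) (at_right 0)" by (auto intro!: tendsto_eq_intros)
    show "f x \<noteq> 0 \<or> 0 < t \<and> (\<forall>\<^sub>F \<delta> in at_right 0. 0 \<le> f x + \<delta>)"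
      using that nonneg[of x] by (auto simp: eventually_at_filter)
  qed simp
  show "((\<lambda>\<delta>. (f b + \<delta>) powr \<theta> * (f a + \<delta>) powr (1 - \<theta>)) \<longlongrightarrow> f b powr \<theta> * f a powr (1 - \<theta>)) (at_right 0)"
    using ab \<theta> by (intro tendsto_mult lim) auto
  have "f (\<theta> * b + (1 - \<theta>) * a) + \<delta> \<le> (f b + \<delta>) powr \<theta> * (f a + \<delta>) powr (1 - \<theta>)" if \<delta>: "0 < \<delta>" for \<delta>
  proof (rule midpoint_log_convex_pos[where f = "\<lambda>x. f x + \<delta>", OF ab])
    fix x y assume xy: "x \<in> {a..b}" "y \<in> {a..b}"
    define z where "z = f ((x + y) / 2)"
    have z: "0 \<le> z" "z\<^sup>2 \<le> f x * f y" using nonneg[of "(x + y) / 2"] xy mid[OF xy] by (auto simp: z_def)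
    have "(2 * z)\<^sup>2 \<le> (f x + f y)\<^sup>2"
      using z(2) sum_squares_bound[of "f x" "f y"] by (simp add: power2_sum power_mult_distrib)
    then have "2 * z \<le> f x + f y" using nonneg[OF xy(1)] nonneg[OF xy(2)] by (auto intro: power2_le_imp_le)
    then have "2 * z * \<delta> \<le> (f x + f y) * \<delta>" using \<delta> by (intro mult_right_mono) auto
    then show "(f ((x + y) / 2) + \<delta>)\<^sup>2 \<le> (f x + \<delta>) * (f y + \<delta>)"
      using z(2) unfolding z_def[symmetric] by (simp add: power2_sum algebra_simps power2_eq_square)
  qed (use \<delta> \<theta> nonneg in \<open>auto intro!: continuous_intros cont add_nonneg_pos\<close>)
  then show "\<forall>\<^sub>F \<delta> in at_right 0. f (\<theta> * b + (1 - \<theta>) * a) + \<delta> \<le> (f b + \<delta>) powr \<theta> * (f a + \<delta>) powr (1 - \<theta>)"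
    by (auto simp: eventually_at_filter)
qed simp

context square_integrable
begin

lemma moment_between:
  assumes "\<gamma> \<in> {a..b}" "moment (1 - a) < \<infinity>" "moment (1 - b) < \<infinity>"
  shows "moment (1 - \<gamma>) < \<infinity>"
  and "0 < \<tau> \<Longrightarrow> \<tau> powr (- \<gamma>) \<le> \<tau> powr (- a) + \<tau> powr (- b)"
proof -
  have le: "\<tau> powr (- \<gamma>) \<le> \<tau> powr (- a) + \<tau> powr (- b)" if "0 < \<tau>" for \<tau> :: real
  proof (cases "\<tau> \<le> 1")
    case True
    have "\<tau> powr (- \<gamma>) \<le> \<tau> powr (- b)" using True that assms(1) by (intro powr_mono') auto
    then show ?thesis by (simp add: add_increasing)
  next
    case False
    have "\<tau> powr (- \<gamma>) \<le> \<tau> powr (- a)" using False that assms(1) by (intro powr_mono) auto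
    then show ?thesis by (simp add: add_increasing2)
  qed
  then show "0 < \<tau> \<Longrightarrow> \<tau> powr (- \<gamma>) \<le> \<tau> powr (- a) + \<tau> powr (- b)" .
  have "moment (1 - \<gamma>) \<le> (\<integral>\<^sup>+\<tau>. ennreal (\<tau> powr (1 - a - 1) * dissipation \<tau>) * indicator {0<..} \<tau> + ennreal (\<tau> powr (1 - b - 1) * dissipation \<tau>) * indicator {0<..} \<tau> \<partial>lborel)"
    unfolding moment_def
  proof (rule nn_integral_mono)
    fix \<tau> :: real
    show "ennreal (\<tau> powr (1 - \<gamma> - 1) * dissipation \<tau>) * indicator {0<..} \<tau> \<le>
      ennreal (\<tau> powr (1 - a - 1) * dissipation \<tau>) * indicator {0<..} \<tau> + ennreal (\<tau> powr (1 - b - 1) * dissipation \<tau>) * indicator {0<..} \<tau>"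
    proof (cases "0 < \<tau>")
      case True
      have "\<tau> powr (- \<gamma>) * dissipation \<tau> \<le> (\<tau> powr (- a) + \<tau> powr (- b)) * dissipation \<tau>"
        using le[OF True] dissipation_nonneg[OF True] by (rule mult_right_mono)
      then show ?thesis using True dissipation_nonneg[OF True]
        by (simp add: distrib_right ennreal_leI flip: ennreal_plus)
    qed simp
  qed
  also have "\<dots> = moment (1 - a) + moment (1 - b)"
    unfolding moment_def by (rule nn_integral_add) measurable
  also have "\<dots> < \<infinity>" using assms by (simp add: less_top)
  finally show "moment (1 - \<gamma>) < \<infinity>" .
qed

lemma moment_has_integral:
  assumes "moment (1 - \<gamma>) < \<infinity>"
  shows "has_bochner_integral lborel (\<lambda>\<tau>. \<tau> powr (- \<gamma>) * dissipation \<tau> * indicator {0<..} \<tau>) (enn2real (moment (1 - \<gamma>)))"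
proof (rule has_bochner_integral_nn_integral)
  have "(\<integral>\<^sup>+\<tau>. ennreal (\<tau> powr (- \<gamma>) * dissipation \<tau> * indicator {0<..} \<tau>) \<partial>lborel) = moment (1 - \<gamma>)"
    unfolding moment_def by (intro nn_integral_cong) (simp add: indicator_def)
  then show "(\<integral>\<^sup>+\<tau>. ennreal (\<tau> powr (- \<gamma>) * dissipation \<tau> * indicator {0<..} \<tau>) \<partial>lborel) = ennreal (enn2real (moment (1 - \<gamma>)))"
    using assms by simp
  show "AE \<tau> in lborel. 0 \<le> \<tau> powr (- \<gamma>) * dissipation \<tau> * indicator {0<..} \<tau>"
    using dissipation_nonneg by (auto simp: indicator_def)
qed auto

lemma spectral_nonneg: "\<gamma> < 1 \<Longrightarrow> 0 \<le> spectral \<gamma>"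
  by (simp add: spectral_def)

text \<open>
  Dominated convergence: between \<open>a\<close> and \<open>b\<close> every power of \<open>\<tau>\<close> is at most the sum of the two extreme ones.
\<close>
lemma continuous_on_spectral:
  assumes "moment (1 - a) < \<infinity>" "moment (1 - b) < \<infinity>" "b < 1"
  shows "continuous_on {a..b} spectral"
proof -
  have "continuous_on {a..b} (\<lambda>\<gamma>. enn2real (moment (1 - \<gamma>)))"
    unfolding continuous_on_sequentially comp_def
  proof (intro allI ballI impI, elim conjE)
    fix X and \<gamma> assume \<gamma>: "\<gamma> \<in> {a..b}" and X: "\<forall>n. X n \<in> {a..b}" "X \<longlonglongrightarrow> \<gamma>"
    have eq: "enn2real (moment (1 - x)) = (\<integral>\<tau>. \<tau> powr (- x) * dissipation \<tau> * indicator {0<..} \<tau> \<partial>lborel)" if "x \<in> {a..b}" for x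
      using moment_has_integral[OF moment_between(1)[OF that assms(1,2)]] by (simp add: has_bochner_integral_iff)
    have "(\<lambda>n. \<integral>\<tau>. \<tau> powr (- X n) * dissipation \<tau> * indicator {0<..} \<tau> \<partial>lborel) \<longlonglongrightarrow> (\<integral>\<tau>. \<tau> powr (- \<gamma>) * dissipation \<tau> * indicator {0<..} \<tau> \<partial>lborel)"
    proof (rule integral_dominated_convergence)
      show "integrable lborel (\<lambda>\<tau>. \<tau> powr (- a) * dissipation \<tau> * indicator {0<..} \<tau> + \<tau> powr (- b) * dissipation \<tau> * indicator {0<..} \<tau>)"
        using moment_has_integral[OF assms(1)] moment_has_integral[OF assms(2)] by (simp add: has_bochner_integral_iff)
      show "AE \<tau> in lborel. (\<lambda>n. \<tau> powr (- X n) * dissipation \<tau> * indicator {0<..} \<tau>) \<longlonglongrightarrow> \<tau> powr (- \<gamma>) * dissipation \<tau> * indicator {0<..} \<tau>"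
      proof (rule AE_I2)
        fix \<tau> :: real
        show "(\<lambda>n. \<tau> powr (- X n) * dissipation \<tau> * indicator {0<..} \<tau>) \<longlonglongrightarrow> \<tau> powr (- \<gamma>) * dissipation \<tau> * indicator {0<..} \<tau>"
        proof (cases "0 < \<tau>")
          case True
          then show ?thesis using X(2) by (intro tendsto_intros) auto
        qed simp
      qed
      fix n
      show "AE \<tau> in lborel. norm (\<tau> powr (- X n) * dissipation \<tau> * indicator {0<..} \<tau>) \<le> \<tau> powr (- a) * dissipation \<tau> * indicator {0<..} \<tau> + \<tau> powr (- b) * dissipation \<tau> * indicator {0<..} \<tau>"
      proof (rule AE_I2)
        fix \<tau> :: real
        show "norm (\<tau> powr (- X n) * dissipation \<tau> * indicator {0<..} \<tau>) \<le> \<tau> powr (- a) * dissipation \<tau> * indicator {0<..} \<tau> + \<tau> powr (- b) * dissipation \<tau> * indicator {0<..} \<tau>"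
        proof (cases "0 < \<tau>")
          case True
          have "X n \<in> {a..b}" using X by blast
          from mult_right_mono[OF moment_between(2)[OF this assms(1,2) True] dissipation_nonneg[OF True]]
          show ?thesis using True dissipation_nonneg[OF True] by (simp add: abs_mult distrib_right)
        qed simp
      qed
    qed measurable
    then show "(\<lambda>n. enn2real (moment (1 - X n))) \<longlonglongrightarrow> enn2real (moment (1 - \<gamma>))"
      using eq[OF \<gamma>] eq X(1) by simp
  qed
  then show ?thesis
    unfolding spectral_def using assms(3)
    by (intro continuous_on_divide continuous_on_compose2[OF continuous_on_Gamma, of "{0<..}" _ "\<lambda>x. 1 - x"] continuous_intros)
      (auto simp: Gamma_eq_zero_iff not_nonpos_Ints_pos)
qed

lemma spectral_interpolation:
  assumes "a < b" "b < 1" "moment (1 - a) < \<infinity>" "moment (1 - b) < \<infinity>" "0 < \<theta>" "\<theta> < 1"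
  shows "spectral (\<theta> * b + (1 - \<theta>) * a) \<le> spectral b powr \<theta> * spectral a powr (1 - \<theta>)"
proof (rule midpoint_log_convex[OF assms(1)])
  show "continuous_on {a..b} spectral" by (intro continuous_on_spectral assms)
  show "0 \<le> spectral x" if "x \<in> {a..b}" for x using that assms by (intro spectral_nonneg) auto
  show "(spectral ((x + y) / 2))\<^sup>2 \<le> spectral x * spectral y" if "x \<in> {a..b}" "y \<in> {a..b}" for x y
    using that assms by (intro spectral_midpoint moment_between(1)[OF that(1) assms(3,4)] moment_between(1)[OF that(2) assms(3,4)]) auto
qed (use assms in auto)

lemma spectral_zero_le:
  "moment (1 - 0) < \<infinity>" "spectral 0 \<le> energy"
proof -
  have le: "moment (1 - 0) \<le> ennreal energy" using moment_one_le by simp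
  then show "moment (1 - 0) < \<infinity>" using ennreal_less_top le_less_trans by (metis infinity_ennreal_def)
  show "spectral 0 \<le> energy"
    using le energy_nonneg by (simp add: spectral_def enn2real_leI)
qed

lemma subordination_const_C:
  assumes "0 < s" "s < 1"
  shows "C_const DIM('a) s / 2 = (s / Gamma (1 - s)) * (subordination_const DIM('a) s / 2)"
proof -
  have G: "Gamma (2 - s) = (1 - s) * Gamma (1 - s)"
    using Gamma_plus1[of "1 - s"] assms by (simp add: not_nonpos_Ints_pos)
  have p: "(2::real) powr (2 * s) = 4 powr s"
    by (simp add: powr_powr[symmetric])
  have e: "(real DIM('a) + 2 * s) / 2 = real DIM('a) / 2 + s" by simp
  show ?thesis
    unfolding C_const_def subordination_const_def G p e using assms by simp
qed

text \<open>
  The Gamma factors in \<open>C_const\<close> cancel those of the subordination formula and leave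
  $s/\Gamma(1-s)$, the normalisation of \<open>spectral\<close>.
\<close>
lemma spectral_eq_gagliardo:
  assumes v: deficit_vanishes and s: "0 < s" "s < 1"
  shows "spectral s = C_const DIM('a) s / 2 * enn2real (gagliardo s)"
    and "moment (1 - s) < \<infinity> \<longleftrightarrow> gagliardo s < \<infinity>"
proof -
  have k: "0 < subordination_const DIM('a) s"
    using s by (auto simp: subordination_const_def intro!: divide_pos_pos mult_pos_pos Gamma_real_pos add_nonneg_pos)
  have m: "moment (1 - s) = ennreal s * (ennreal (subordination_const DIM('a) s / 2) * gagliardo s)"
    unfolding moment_eq_deficit[OF v s(1)] gagliardo_eq_deficit[OF s(1)] ..
  show "spectral s = C_const DIM('a) s / 2 * enn2real (gagliardo s)"
    unfolding spectral_def m subordination_const_C[OF s]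
    using s k by (simp add: enn2real_mult)
  show "moment (1 - s) < \<infinity> \<longleftrightarrow> gagliardo s < \<infinity>"
    unfolding m using s k by (auto simp: ennreal_mult_less_top ennreal_mult_eq_top_iff less_top[symmetric])
qed

lemma gagliardo_finite_imp_vanishes:
  assumes "0 < s" "gagliardo s < \<infinity>"
  shows deficit_vanishes
proof -
  have "(\<integral>\<^sup>+t. ennreal (deficit t * t powr (- 1 - s)) * indicator {0<..} t \<partial>lborel) < \<infinity>"
    unfolding gagliardo_eq_deficit[OF assms(1)] using assms(2) by (simp add: ennreal_mult_less_top)
  from deficit_le_powr[OF assms(1) this] show ?thesis using deficit_vanishesI[OF assms(1)] by metis
qed

text \<open>
  Use the linear bound up to time 1 and the energy bound afterwards.  As \<open>s\<close> tends to 1 the estimate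
  converges to \<open>L\<close>, which is how the endpoint \<open>s = 1\<close> is reached.
\<close>
lemma spectral_near_one:
  assumes L: "\<And>t. 0 < t \<Longrightarrow> deficit t \<le> L * t" and s: "0 < s" "s < 1"
  shows "moment (1 - s) < \<infinity>" "spectral s \<le> (s * L + (1 - s) * energy) / Gamma (2 - s)"
proof -
  have L0: "0 \<le> L" using L[of 1] deficit_nonneg[of 1] by simp
  have v: deficit_vanishes
    using L by (intro deficit_vanishesI[of 1 L]) auto
  have pow: "(\<integral>\<^sup>+t. ennreal (t powr (- s)) * indicator {0..1} t \<partial>lborel) = ennreal (1 / (1 - s))"
  proof -
    have "((\<lambda>t. t powr (- s)) has_integral 1 powr (- s + 1) / (- s + 1)) {0..1}"
      using s by (intro has_integral_powr_from_0) auto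
    then show ?thesis by (subst nn_integral_has_integral_lebesgue') auto
  qed
  have tail: "(\<integral>\<^sup>+t. ennreal (t powr (- 1 - s)) * indicator {1..} t \<partial>lborel) = ennreal (1 / s)"
    using nn_integral_powr_tail[OF s(1), of 1] by simp
  have "(\<integral>\<^sup>+t. ennreal (deficit t * t powr (- 1 - s)) * indicator {0<..} t \<partial>lborel)
    \<le> (\<integral>\<^sup>+t. ennreal L * (ennreal (t powr (- s)) * indicator {0..1} t) + ennreal energy * (ennreal (t powr (- 1 - s)) * indicator {1..} t) \<partial>lborel)"
  proof (rule nn_integral_mono)
    fix t :: real
    show "ennreal (deficit t * t powr (- 1 - s)) * indicator {0<..} t \<le>
      ennreal L * (ennreal (t powr (- s)) * indicator {0..1} t) + ennreal energy * (ennreal (t powr (- 1 - s)) * indicator {1..} t)"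
    proof (cases "0 < t")
      case t: True
      show ?thesis
      proof (cases "t \<le> 1")
        case True
        have "t * t powr (- 1 - s) = t powr 1 * t powr (- 1 - s)" using t by simp
        also have "\<dots> = t powr (- s)" unfolding powr_add[symmetric] by simp
        finally have "deficit t * t powr (- 1 - s) \<le> L * t powr (- s)"
          using mult_right_mono[OF L[OF t], of "t powr (- 1 - s)"] by (simp add: mult.assoc)
        then show ?thesis using t True L0 by (simp add: ennreal_mult[symmetric] ennreal_leI add_increasing2)
      next
        case False
        have "deficit t * t powr (- 1 - s) \<le> energy * t powr (- 1 - s)"
          by (intro mult_right_mono deficit_le_energy t) auto
        then show ?thesis using t False energy_nonneg by (simp add: ennreal_mult[symmetric] ennreal_leI)
      qed
    qed simp
  qed
  also have "\<dots> = ennreal L * ennreal (1 / (1 - s)) + ennreal energy * ennreal (1 / s)"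
    unfolding pow[symmetric] tail[symmetric] by (subst nn_integral_add) (auto simp: nn_integral_cmult)
  also have "\<dots> = ennreal (L / (1 - s) + energy / s)"
    using L0 energy_nonneg s by (simp add: ennreal_mult[symmetric])
  finally have "moment (1 - s) \<le> ennreal s * ennreal (L / (1 - s) + energy / s)"
    unfolding moment_eq_deficit[OF v s(1)] by (rule mult_left_mono) simp
  also have "\<dots> = ennreal (s * (L / (1 - s) + energy / s))"
    using L0 energy_nonneg s by (intro ennreal_mult[symmetric]) auto
  finally have le: "moment (1 - s) \<le> ennreal (s * (L / (1 - s) + energy / s))" .
  then show "moment (1 - s) < \<infinity>" using ennreal_less_top le_less_trans by (metis infinity_ennreal_def)
  have "enn2real (moment (1 - s)) \<le> s * (L / (1 - s) + energy / s)"
    using le L0 energy_nonneg s by (intro enn2real_leI) auto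
  then have "spectral s \<le> s * (L / (1 - s) + energy / s) / Gamma (1 - s)"
    unfolding spectral_def using s by (intro divide_right_mono) auto
  also have "\<dots> = (s * L + (1 - s) * energy) / ((1 - s) * Gamma (1 - s))"
  proof -
    have "s * (L / (1 - s) + energy / s) = (s * L + (1 - s) * energy) / (1 - s)"
      using s by (simp add: field_simps)
    then show ?thesis by simp
  qed
  also have "(1 - s) * Gamma (1 - s) = Gamma (2 - s)"
    using Gamma_plus1[of "1 - s"] s by (simp add: not_nonpos_Ints_pos)
  finally show "spectral s \<le> (s * L + (1 - s) * energy) / Gamma (2 - s)" .
qed

text \<open>
  Interpolate between \<open>a\<close> and \<open>s < 1\<close> and let \<open>s\<close> tend to 1 from the left.
\<close>
lemma spectral_interpolation_one:
  assumes L: "\<And>t. 0 < t \<Longrightarrow> deficit t \<le> L * t" and a: "0 \<le> a" "a < 1" "moment (1 - a) < \<infinity>"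
    and \<theta>: "0 < \<theta>" "\<theta> < 1"
  shows "spectral (\<theta> * 1 + (1 - \<theta>) * a) \<le> L powr \<theta> * spectral a powr (1 - \<theta>)"
proof -
  let ?\<eta> = "\<theta> * 1 + (1 - \<theta>) * a"
  let ?t = "\<lambda>s. (?\<eta> - a) / (s - a)"
  let ?U = "\<lambda>s. (s * L + (1 - s) * energy) / Gamma (2 - s)"
  have \<eta>: "a < ?\<eta>" "?\<eta> < 1"
  proof -
    have e: "?\<eta> - a = \<theta> * (1 - a)" "1 - ?\<eta> = (1 - \<theta>) * (1 - a)" by (simp_all add: algebra_simps)
    have "0 < ?\<eta> - a" unfolding e(1) using \<theta> a by (intro mult_pos_pos) auto
    then show "a < ?\<eta>" by (rule diff_gt_0_iff_gt[THEN iffD1])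
    have "0 < 1 - ?\<eta>" unfolding e(2) using \<theta> a by (intro mult_pos_pos) auto
    then show "?\<eta> < 1" by (rule diff_gt_0_iff_gt[THEN iffD1])
  qed
  have L0: "0 \<le> L" using L[of 1] deficit_nonneg[of 1] by simp
  have t1: "?t 1 = \<theta>"
  proof -
    have "?\<eta> - a = \<theta> * (1 - a)" by (simp add: algebra_simps)
    then show ?thesis using a by simp
  qed
  have lim_t: "(?t \<longlongrightarrow> \<theta>) (at_left 1)"
  proof -
    have "(?t \<longlongrightarrow> ?t 1) (at_left 1)" using a by (intro tendsto_intros) auto
    then show ?thesis unfolding t1 .
  qed
  have lim_U: "(?U \<longlongrightarrow> L) (at_left 1)"
  proof -
    have "isCont ?U 1" by (intro continuous_intros) (auto elim!: nonpos_Ints_cases simp: Gamma_eq_zero_iff)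
    then have "(?U \<longlongrightarrow> ?U 1) (at_left 1)"
      unfolding isCont_def by (rule tendsto_mono[OF at_le, rotated]) auto
    then show ?thesis by simp
  qed
  have ev: "\<forall>\<^sub>F s in at_left 1. ?\<eta> < s \<and> s < 1"
    using eventually_at_left_real[OF \<eta>(2)] by eventually_elim auto
  have ev_le: "\<forall>\<^sub>F s in at_left 1. spectral ?\<eta> \<le> ?U s powr ?t s * spectral a powr (1 - ?t s)"
    using ev
  proof eventually_elim
    case (elim s)
    have s: "0 < s" "a < s" using elim \<eta> a by auto
    have t: "0 < ?t s" "?t s < 1" using elim \<eta> s by (auto simp: divide_less_eq)
    have "?\<eta> = ?t s * s + (1 - ?t s) * a"
    proof -
      have e: "?t s * (s - a) = ?\<eta> - a" using s by simp
      have "T * s + (1 - T) * a = T * (s - a) + a" for T by (simp add: algebra_simps)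
      then have "?t s * s + (1 - ?t s) * a = ?t s * (s - a) + a" .
      then show ?thesis unfolding e by simp
    qed
    then have "spectral ?\<eta> = spectral (?t s * s + (1 - ?t s) * a)" by (rule arg_cong)
    also have "\<dots> \<le> spectral s powr ?t s * spectral a powr (1 - ?t s)"
      using s elim a t spectral_near_one(1)[OF L s(1)] by (intro spectral_interpolation) auto
    also have "\<dots> \<le> ?U s powr ?t s * spectral a powr (1 - ?t s)"
      using s elim t spectral_near_one(2)[OF L s(1)] spectral_nonneg[of s] by (intro mult_right_mono powr_mono2) auto
    finally show ?case .
  qed
  show ?thesis
  proof (rule tendsto_le[OF _ _ _ ev_le])
    have U0: "\<forall>\<^sub>F s in at_left 1. 0 \<le> ?U s"
      using ev by eventually_elim (use \<eta> a L0 energy_nonneg in \<open>auto intro!: divide_nonneg_nonneg add_nonneg_nonneg mult_nonneg_nonneg\<close>)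
    show "((\<lambda>s. ?U s powr ?t s * spectral a powr (1 - ?t s)) \<longlongrightarrow> L powr \<theta> * spectral a powr (1 - \<theta>)) (at_left 1)"
    proof (rule tendsto_mult)
      show "((\<lambda>s. ?U s powr ?t s) \<longlongrightarrow> L powr \<theta>) (at_left 1)"
        by (rule tendsto_powr'[OF lim_U lim_t]) (use \<theta> U0 in auto)
      show "((\<lambda>s. spectral a powr (1 - ?t s)) \<longlongrightarrow> spectral a powr (1 - \<theta>)) (at_left 1)"
        by (rule tendsto_powr'[OF tendsto_const tendsto_diff[OF tendsto_const lim_t]])
          (use \<theta> a spectral_nonneg[of a] in auto)
    qed
  qed (auto simp: trivial_limit_at_left_real)
qed

end

section \<open>Test functions and their density\<close>

primrec flat_poly :: "nat \<Rightarrow> real poly" where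
  "flat_poly 0 = 1"
| "flat_poly (Suc k) = [:0, 0, 1:] * (flat_poly k - pderiv (flat_poly k))"

text \<open>The derivatives of $e^{-1/x}$, extended by 0.\<close>
definition flat :: "nat \<Rightarrow> real \<Rightarrow> real" where
  "flat k x = (if 0 < x then poly (flat_poly k) (1 / x) * exp (- 1 / x) else 0)"

lemma tendsto_poly_times_exp_minus:
  fixes p :: "real poly"
  shows "((\<lambda>y. poly p y * exp (- y)) \<longlongrightarrow> 0) at_top"
proof -
  have "((\<lambda>y. \<Sum>i\<le>degree p. coeff p i * (y ^ i / exp y)) \<longlongrightarrow> (\<Sum>i\<le>degree p. coeff p i * 0)) at_top"
    by (intro tendsto_intros tendsto_power_div_exp_0)
  moreover have "(\<Sum>i\<le>degree p. coeff p i * (y ^ i / exp y)) = poly p y * exp (- y)" for y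
    by (simp add: poly_altdef sum_distrib_right exp_minus divide_inverse mult.assoc)
  ultimately show ?thesis by simp
qed

lemma DERIV_flat: "(flat k has_real_derivative flat (Suc k) x) (at x)"
proof (cases x "0::real" rule: linorder_cases)
  case greater
  have "((\<lambda>x. poly (flat_poly k) (1 / x) * exp (- 1 / x)) has_real_derivative flat (Suc k) x) (at x)"
    using greater
    by (auto intro!: derivative_eq_intros simp: flat_def power2_eq_square divide_simps) (simp add: algebra_simps)
  then show ?thesis
  proof (rule has_field_derivative_transform_within_open)
    show "open {0::real<..}" "x \<in> {0<..}" using greater by auto
  qed (simp add: flat_def)
next
  case less
  have "((\<lambda>x. 0) has_real_derivative flat (Suc k) x) (at x)"
    using less by (simp add: flat_def)
  then show ?thesis
  proof (rule has_field_derivative_transform_within_open)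
    show "open {..<0::real}" "x \<in> {..<0}" using less by auto
  qed (simp add: flat_def)
next
  case equal
  have "((\<lambda>h. (flat k (0 + h) - flat k 0) / h) \<longlongrightarrow> 0) (at 0)"
    unfolding filterlim_split_at_real
  proof (rule filterlim_split_at)
    have "\<forall>\<^sub>F h in at_left 0. 0 = (flat k (0 + h) - flat k 0) / h"
      unfolding eventually_at_filter by (simp add: flat_def)
    then show "((\<lambda>h. (flat k (0 + h) - flat k 0) / h) \<longlongrightarrow> 0) (at_left 0)"
      by (rule Lim_transform_eventually[OF tendsto_const])
    have "((\<lambda>h. poly (pCons 0 (flat_poly k)) (inverse h) * exp (- inverse h)) \<longlongrightarrow> 0) (at_right 0)"
      by (rule filterlim_compose[OF tendsto_poly_times_exp_minus filterlim_inverse_at_top_right])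
    moreover have "\<forall>\<^sub>F h in at_right 0. poly (pCons 0 (flat_poly k)) (inverse h) * exp (- inverse h) = (flat k (0 + h) - flat k 0) / h"
      unfolding eventually_at_filter by (simp add: flat_def field_simps)
    ultimately show "((\<lambda>h. (flat k (0 + h) - flat k 0) / h) \<longlongrightarrow> 0) (at_right 0)"
      by (rule Lim_transform_eventually)
  qed
  then show ?thesis using equal by (simp add: DERIV_def flat_def)
qed

lemma Ck_imp_continuous: "Ck k f \<Longrightarrow> continuous_on UNIV f"
proof (cases k)
  case (Suc n)
  assume "Ck k f"
  then show ?thesis
    using Suc by (auto simp: continuous_on_eq_continuous_at intro: differentiable_imp_continuous_within)
qed simp

lemma Ck_Suc_imp: "Ck (Suc k) f \<Longrightarrow> Ck k f"
proof (induction k arbitrary: f)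
  case 0
  then show ?case using Ck_imp_continuous by fastforce
next
  case (Suc k)
  have "f differentiable at x" for x using Suc.prems by simp
  moreover have "Ck (Suc k) (\<lambda>x. frechet_derivative f (at x) e)" if "e \<in> Basis" for e
    using Suc.prems that unfolding Ck.simps(2)[of "Suc k"] by blast
  ultimately show ?case using Suc.IH by simp
qed

lemma Ck_SucI:
  assumes "\<And>x. (f has_derivative D x) (at x)" "\<And>e. e \<in> Basis \<Longrightarrow> Ck k (\<lambda>x. D x e)"
  shows "Ck (Suc k) f"
proof -
  have "frechet_derivative f (at x) = D x" for x
    using frechet_derivative_at[OF assms(1)] by simp
  then show ?thesis using assms by (auto simp: differentiable_def)
qed

lemma Ck_SucD:
  assumes "Ck (Suc k) f"
  shows "(f has_derivative frechet_derivative f (at x)) (at x)" "e \<in> Basis \<Longrightarrow> Ck k (\<lambda>x. frechet_derivative f (at x) e)"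
  using assms frechet_derivative_works by auto

lemma Ck_const: "Ck k (\<lambda>x. c)"
proof (induction k arbitrary: c)
  case (Suc k)
  show ?case by (rule Ck_SucI[where D = "\<lambda>_ _. 0"]) (auto simp: Suc)
qed simp

lemma Ck_add: "Ck k f \<Longrightarrow> Ck k g \<Longrightarrow> Ck k (\<lambda>x. f x + g x)"
proof (induction k arbitrary: f g)
  case 0
  then show ?case by (simp add: continuous_on_add)
next
  case (Suc k)
  show ?case
  proof (rule Ck_SucI)
    show "((\<lambda>x. f x + g x) has_derivative (\<lambda>h. frechet_derivative f (at x) h + frechet_derivative g (at x) h)) (at x)" for x
      by (rule has_derivative_add[OF Ck_SucD(1)[OF Suc.prems(1)] Ck_SucD(1)[OF Suc.prems(2)]])
    show "Ck k (\<lambda>x. frechet_derivative f (at x) e + frechet_derivative g (at x) e)" if "e \<in> Basis" for e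
      by (rule Suc.IH[OF Ck_SucD(2)[OF Suc.prems(1) that] Ck_SucD(2)[OF Suc.prems(2) that]])
  qed
qed

lemma Ck_mult: "Ck k f \<Longrightarrow> Ck k g \<Longrightarrow> Ck k (\<lambda>x. f x * g x)"
proof (induction k arbitrary: f g)
  case 0
  then show ?case by (simp add: continuous_on_mult)
next
  case (Suc k)
  note D = Ck_SucD(1)[OF Suc.prems(1)] Ck_SucD(1)[OF Suc.prems(2)]
  note C = Ck_SucD(2)[OF Suc.prems(1)] Ck_SucD(2)[OF Suc.prems(2)]
  note S = Ck_Suc_imp[OF Suc.prems(1)] Ck_Suc_imp[OF Suc.prems(2)]
  show ?case
  proof (rule Ck_SucI)
    show "((\<lambda>x. f x * g x) has_derivative (\<lambda>h. f x * frechet_derivative g (at x) h + frechet_derivative f (at x) h * g x)) (at x)" for x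
      by (rule has_derivative_mult[OF D])
    show "Ck k (\<lambda>x. f x * frechet_derivative g (at x) e + frechet_derivative f (at x) e * g x)" if "e \<in> Basis" for e
      by (rule Ck_add[OF Suc.IH[OF S(1) C(2)[OF that]] Suc.IH[OF C(1)[OF that] S(2)]])
  qed
qed

lemma Ck_diff: "Ck k f \<Longrightarrow> Ck k g \<Longrightarrow> Ck k (\<lambda>x. f x - g x)"
  using Ck_add[of k f "\<lambda>x. - 1 * g x"] Ck_mult[OF Ck_const, of k g "- 1"] by simp

lemma Ck_power: "Ck k f \<Longrightarrow> Ck k (\<lambda>x. f x ^ n)"
  by (induction n) (auto intro: Ck_const Ck_mult)

lemma Ck_prod: "(\<And>i. i \<in> I \<Longrightarrow> Ck k (f i)) \<Longrightarrow> Ck k (\<lambda>x. \<Prod>i\<in>I. f i x)"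
  by (induction I rule: infinite_finite_induct) (auto intro: Ck_const Ck_mult)

lemma Ck_flat: "Ck n (\<lambda>x. flat k (c * (x \<bullet> b) + a))"
proof (induction n arbitrary: k)
  case 0
  have "isCont (flat k) x" for x by (rule DERIV_isCont[OF DERIV_flat])
  then have "continuous_on UNIV (flat k)" by (simp add: continuous_on_eq_continuous_at)
  then show ?case
    by (auto intro!: continuous_on_compose2[of UNIV "flat k"] continuous_intros)
next
  case (Suc n)
  have D: "((\<lambda>x. flat k (c * (x \<bullet> b) + a)) has_derivative (\<lambda>h. flat (Suc k) (c * (x \<bullet> b) + a) * (c * (h \<bullet> b)))) (at x)" for x
    by (rule has_derivative_compose[where f = "\<lambda>x. c * (x \<bullet> b) + a" and f' = "\<lambda>h. c * (h \<bullet> b)" and g = "flat k" and g' = "(*) (flat (Suc k) (c * (x \<bullet> b) + a))",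
          OF _ DERIV_flat[unfolded has_field_derivative_def]])
      (auto intro!: derivative_eq_intros)
  show ?case
  proof (rule Ck_SucI[OF D])
    fix e :: 'a
    show "Ck n (\<lambda>x. flat (Suc k) (c * (x \<bullet> b) + a) * (c * (e \<bullet> b)))"
      by (rule Ck_mult[OF Suc Ck_const])
  qed
qed

lemma Ck_shift: "Ck k f \<Longrightarrow> Ck k (\<lambda>x. f (x - c))"
proof (induction k arbitrary: f)
  case 0
  then show ?case by (auto intro!: continuous_on_compose2[of UNIV f] continuous_intros)
next
  case (Suc k)
  have D: "((\<lambda>x. f (x - c)) has_derivative frechet_derivative f (at (x - c))) (at x)" for x
    by (rule has_derivative_compose[where f = "\<lambda>x. x - c" and f' = "\<lambda>h. h" and g = f, OF _ Ck_SucD(1)[OF Suc.prems]])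
      (auto intro!: derivative_eq_intros)
  show ?case
  proof (rule Ck_SucI[OF D])
    fix e :: 'a assume "e \<in> Basis"
    then show "Ck k (\<lambda>x. frechet_derivative f (at (x - c)) e)"
      using Suc.IH[of "\<lambda>x. frechet_derivative f (at x) e"] Ck_SucD(2)[OF Suc.prems] by blast
  qed
qed

lemma test_function_iff: "test_function \<phi> \<longleftrightarrow> (\<forall>k. Ck k \<phi>) \<and> bounded {x. \<phi> x \<noteq> 0}"
  by (simp add: test_function_def compact_closure)

lemma test_function_add: "test_function \<phi> \<Longrightarrow> test_function \<psi> \<Longrightarrow> test_function (\<lambda>x. \<phi> x + \<psi> x)"
  unfolding test_function_iff
  by (auto intro!: Ck_add intro: bounded_subset[of "{x. \<phi> x \<noteq> 0} \<union> {x. \<psi> x \<noteq> 0}"])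

lemma test_function_cmult: "test_function \<phi> \<Longrightarrow> test_function (\<lambda>x. c * \<phi> x)"
  unfolding test_function_iff
  by (auto intro!: Ck_mult Ck_const intro: bounded_subset[of "{x. \<phi> x \<noteq> 0}"])

lemma test_function_shift:
  assumes "test_function \<phi>"
  shows "test_function (\<lambda>x. \<phi> (x - c))"
proof -
  have "{x. \<phi> (x - c) \<noteq> 0} = (\<lambda>x. c + x) ` {x. \<phi> x \<noteq> 0}"
    by (auto intro: image_eqI[of _ _ "x - c" for x])
  then show ?thesis using assms by (auto simp: test_function_iff Ck_shift bounded_translation)
qed

lemma test_function_continuous: "test_function \<phi> \<Longrightarrow> continuous_on UNIV \<phi>"
  unfolding test_function_def using Ck_imp_continuous by blast

lemma continuous_bounded_support:
  fixes f :: "'a::euclidean_space \<Rightarrow> real"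
  assumes "continuous_on UNIV f" "bounded {x. f x \<noteq> 0}"
  shows "f \<in> borel_measurable borel" "integrable lborel (\<lambda>x. (f x)\<^sup>2)"
proof -
  show "f \<in> borel_measurable borel" using assms(1) by (rule borel_measurable_continuous_onI)
  have c: "compact (closure {x. f x \<noteq> 0})" using assms(2) by (simp add: compact_closure)
  have "integrable lborel (\<lambda>x. indicator (closure {x. f x \<noteq> 0}) x *\<^sub>R (f x)\<^sup>2)"
    using borel_integrable_compact[OF c, of "\<lambda>x. (f x)\<^sup>2"] continuous_on_subset[OF continuous_on_power[OF assms(1)], of _ 2]
    unfolding set_integrable_def by simp
  moreover have eq: "indicator (closure {x. f x \<noteq> 0}) x *\<^sub>R (f x)\<^sup>2 = (f x)\<^sup>2" for x
    using closure_subset[of "{x. f x \<noteq> 0}"] by (auto simp: indicator_def)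
  ultimately show "integrable lborel (\<lambda>x. (f x)\<^sup>2)" by (simp only: eq)
qed

lemma test_function_derivative:
  assumes "test_function \<phi>"
  shows "(\<phi> has_derivative frechet_derivative \<phi> (at x)) (at x)"
    and "e \<in> Basis \<Longrightarrow> continuous_on UNIV (\<lambda>x. frechet_derivative \<phi> (at x) e)"
    and "bounded {x. frechet_derivative \<phi> (at x) e \<noteq> 0}"
proof -
  have C: "Ck (Suc 0) \<phi>" using assms by (simp only: test_function_def)
  show "(\<phi> has_derivative frechet_derivative \<phi> (at x)) (at x)" by (rule Ck_SucD[OF C])
  show "e \<in> Basis \<Longrightarrow> continuous_on UNIV (\<lambda>x. frechet_derivative \<phi> (at x) e)"
    using Ck_SucD(2)[OF C] by simp
  have "frechet_derivative \<phi> (at x) e = 0" if "x \<notin> closure {x. \<phi> x \<noteq> 0}" for x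
  proof -
    have "((\<lambda>x. 0) has_derivative (\<lambda>h. 0)) (at x)" by simp
    then have "(\<phi> has_derivative (\<lambda>h. 0)) (at x)"
    proof (rule has_derivative_transform_within_open)
      show "open (- closure {x. \<phi> x \<noteq> 0})" "x \<in> - closure {x. \<phi> x \<noteq> 0}" using that by auto
      show "0 = \<phi> y" if "y \<in> - closure {x. \<phi> x \<noteq> 0}" for y
        using that closure_subset[of "{x. \<phi> x \<noteq> 0}"] by auto
    qed
    then have "(\<lambda>h. 0) = frechet_derivative \<phi> (at x)" by (rule frechet_derivative_at)
    from fun_cong[OF this, of e] show ?thesis by simp
  qed
  then have "{x. frechet_derivative \<phi> (at x) e \<noteq> 0} \<subseteq> closure {x. \<phi> x \<noteq> 0}" by blast
  moreover have "bounded (closure {x. \<phi> x \<noteq> 0})" using assms by (auto simp: test_function_def compact_imp_bounded)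
  ultimately show "bounded {x. frechet_derivative \<phi> (at x) e \<noteq> 0}" by (rule bounded_subset[rotated])
qed

text \<open>
  A product of one-dimensional bumps in the coordinates.
\<close>
lemma box_bump:
  fixes a b :: "'a::euclidean_space"
  obtains \<beta> :: "'a \<Rightarrow> real" where "\<And>k. Ck k \<beta>" "\<And>x. 0 \<le> \<beta> x" "\<And>x. \<beta> x \<le> 1" "\<And>x. x \<in> box a b \<longleftrightarrow> 0 < \<beta> x"
proof
  define \<beta> where "\<beta> x = (\<Prod>i\<in>Basis. flat 0 (1 * (x \<bullet> i) + - (a \<bullet> i)) * flat 0 (- 1 * (x \<bullet> i) + b \<bullet> i))" for x :: 'a
  have f: "0 \<le> flat 0 t" "flat 0 t \<le> 1" "0 < flat 0 t \<longleftrightarrow> 0 < t" for t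
    by (auto simp: flat_def)
  show "Ck k \<beta>" for k unfolding \<beta>_def by (intro Ck_prod Ck_mult Ck_flat)
  show "0 \<le> \<beta> x" for x unfolding \<beta>_def by (intro prod_nonneg mult_nonneg_nonneg ballI f)
  show "\<beta> x \<le> 1" for x unfolding \<beta>_def by (intro prod_le_1 conjI mult_nonneg_nonneg mult_le_one f)
  show "x \<in> box a b \<longleftrightarrow> 0 < \<beta> x" for x
  proof
    assume "x \<in> box a b"
    then show "0 < \<beta> x" unfolding \<beta>_def by (intro prod_pos ballI mult_pos_pos) (auto simp: f mem_box)
  next
    assume "0 < \<beta> x"
    then have "flat 0 (1 * (x \<bullet> i) + - (a \<bullet> i)) * flat 0 (- 1 * (x \<bullet> i) + b \<bullet> i) \<noteq> 0" if "i \<in> Basis" for i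
      unfolding \<beta>_def using that by (metis (no_types, lifting) finite_Basis less_irrefl prod_zero)
    then have "flat 0 (1 * (x \<bullet> i) + - (a \<bullet> i)) \<noteq> 0" "flat 0 (- 1 * (x \<bullet> i) + b \<bullet> i) \<noteq> 0" if "i \<in> Basis" for i
      using that by auto
    then have "0 < flat 0 (1 * (x \<bullet> i) + - (a \<bullet> i))" "0 < flat 0 (- 1 * (x \<bullet> i) + b \<bullet> i)" if "i \<in> Basis" for i
      using that f(1) by (simp_all add: less_le)
    then show "x \<in> box a b" by (auto simp: f mem_box)
  qed
qed

text \<open>
  An open set is a countable union of boxes.  If \<open>\<beta> i\<close> is positive exactly on box number \<open>i\<close>, then
  $1 - \prod_{i<n} (1 - \beta_i)^n$ is smooth with bounded support, lies between 0 and 1, and tends to the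
  indicator.
\<close>
lemma open_indicator_limit:
  fixes U :: "'a::euclidean_space set"
  assumes "open U"
  obtains \<phi> :: "nat \<Rightarrow> 'a \<Rightarrow> real" where "\<And>n. test_function (\<phi> n)" "\<And>n x. 0 \<le> \<phi> n x" "\<And>n x. \<phi> n x \<le> indicator U x"
    "\<And>x. (\<lambda>n. \<phi> n x) \<longlonglongrightarrow> indicator U x"
proof -
  obtain \<D> where D: "countable \<D>" "\<D> \<subseteq> Pow U" "\<And>X. X \<in> \<D> \<Longrightarrow> \<exists>a b. X = box a b" "\<Union>\<D> = U"
    using open_countable_Union_open_box[OF assms] by metis
  have "\<exists>X::nat \<Rightarrow> 'a set. (\<forall>n. \<exists>a b. X n = box a b) \<and> (\<Union>n. X n) = U"
  proof (cases "\<D> = {}")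
    case True
    have "\<exists>a b. ({}::'a set) = box a b" by (metis box_eq_empty(1) order_refl nonempty_Basis ex_in_conv)
    then show ?thesis using D(4) True by (intro exI[of _ "\<lambda>_. {}"]) auto
  next
    case False
    then have r: "range (from_nat_into \<D>) = \<D>" using D(1) by (intro range_from_nat_into) auto
    have "from_nat_into \<D> n \<in> \<D>" for n using r by auto
    then show ?thesis using D r by (intro exI[of _ "from_nat_into \<D>"]) auto
  qed
  then obtain X :: "nat \<Rightarrow> 'a set" where X: "\<And>n. \<exists>a b. X n = box a b" "(\<Union>n. X n) = U" by blast
  then obtain a b where ab: "\<And>n. X n = box (a n) (b n)" by metis
  have "\<exists>\<beta> :: 'a \<Rightarrow> real. (\<forall>k. Ck k \<beta>) \<and> (\<forall>x. 0 \<le> \<beta> x) \<and> (\<forall>x. \<beta> x \<le> 1) \<and> (\<forall>x. x \<in> X n \<longleftrightarrow> 0 < \<beta> x)" for n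
    unfolding ab using box_bump[of "a n" "b n"] by metis
  then obtain \<beta> :: "nat \<Rightarrow> 'a \<Rightarrow> real" where \<beta>: "\<And>n k. Ck k (\<beta> n)" "\<And>n x. 0 \<le> \<beta> n x" "\<And>n x. \<beta> n x \<le> 1" "\<And>n x. x \<in> X n \<longleftrightarrow> 0 < \<beta> n x"
    by metis
  define \<phi> where "\<phi> n x = 1 - (\<Prod>i<n. (1 - \<beta> i x) ^ n)" for n x
  have p: "0 \<le> (\<Prod>i<n. (1 - \<beta> i x) ^ n)" "(\<Prod>i<n. (1 - \<beta> i x) ^ n) \<le> 1" for n x
    using \<beta>(2,3) by (auto intro!: prod_nonneg prod_le_1 power_le_one)
  have zero: "\<phi> n x = 0" if "x \<notin> (\<Union>i<n. X i)" for n x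
  proof -
    have "\<beta> i x = 0" if "i < n" for i
      using \<open>x \<notin> (\<Union>i<n. X i)\<close> that \<beta>(4)[of x i] \<beta>(2)[of i x] by force
    then show ?thesis by (simp add: \<phi>_def)
  qed
  show ?thesis
  proof
    fix n
    have "{x. \<phi> n x \<noteq> 0} \<subseteq> (\<Union>i<n. X i)" using zero by blast
    moreover have "bounded (\<Union>i<n. X i)" by (auto simp: ab bounded_box)
    ultimately have "bounded {x. \<phi> n x \<noteq> 0}" by (rule bounded_subset[rotated])
    moreover have "Ck k (\<phi> n)" for k
      unfolding \<phi>_def by (intro Ck_diff Ck_const Ck_prod Ck_power \<beta>)
    ultimately show "test_function (\<phi> n)" by (simp add: test_function_iff)
  next
    fix n x
    show "0 \<le> \<phi> n x" using p by (simp add: \<phi>_def)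
    show "\<phi> n x \<le> indicator U x"
    proof (cases "x \<in> U")
      case True
      then show ?thesis using p by (simp add: \<phi>_def)
    next
      case False
      then show ?thesis using zero[of x n] X(2) by auto
    qed
  next
    fix x
    show "(\<lambda>n. \<phi> n x) \<longlonglongrightarrow> indicator U x"
    proof (cases "x \<in> U")
      case True
      then obtain j where j: "x \<in> X j" using X(2) by auto
      have r: "0 \<le> 1 - \<beta> j x" "1 - \<beta> j x < 1" using \<beta>(4)[of x j] \<beta>(3)[of j x] j by auto
      have L: "(\<lambda>n. (1 - \<beta> j x) ^ n) \<longlonglongrightarrow> 0" using r by (intro LIMSEQ_realpow_zero)
      have "(\<lambda>n. \<Prod>i<n. (1 - \<beta> i x) ^ n) \<longlonglongrightarrow> 0"
      proof (rule tendsto_sandwich[OF _ _ tendsto_const L])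
        show "\<forall>\<^sub>F n in sequentially. 0 \<le> (\<Prod>i<n. (1 - \<beta> i x) ^ n)" by (simp add: p)
        show "\<forall>\<^sub>F n in sequentially. (\<Prod>i<n. (1 - \<beta> i x) ^ n) \<le> (1 - \<beta> j x) ^ n"
          using eventually_gt_at_top[of j]
        proof eventually_elim
          case (elim n)
          have "(\<Prod>i<n. (1 - \<beta> i x) ^ n) = (1 - \<beta> j x) ^ n * (\<Prod>i\<in>{..<n} - {j}. (1 - \<beta> i x) ^ n)"
            using elim by (intro prod.remove) auto
          also have "\<dots> \<le> (1 - \<beta> j x) ^ n * 1"
            using \<beta>(2,3) r by (intro mult_left_mono prod_le_1) (auto intro!: power_le_one)
          finally show ?case by simp
        qed
      qed
      from tendsto_diff[OF tendsto_const this, of 1] show ?thesis using True by (simp add: \<phi>_def)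
    next
      case False
      then have "\<phi> n x = 0" for n using zero[of x n] X(2) by auto
      then show ?thesis using False by simp
    qed
  qed
qed

definition L2_closure :: "('a::euclidean_space \<Rightarrow> real) \<Rightarrow> bool" where
  "L2_closure w \<longleftrightarrow> w \<in> borel_measurable borel \<and> integrable lborel (\<lambda>x. (w x)\<^sup>2) \<and>
     (\<forall>\<epsilon>>0. \<exists>\<phi>. test_function \<phi> \<and> (\<integral>x. (w x - \<phi> x)\<^sup>2 \<partial>lborel) < \<epsilon>)"

lemma square_add_le: "(x + y)\<^sup>2 \<le> 2 * x\<^sup>2 + 2 * (y::real)\<^sup>2"
  using sum_squares_bound[of x y] by (simp add: power2_sum)

lemma integrable_square_add:
  fixes f g :: "'a::euclidean_space \<Rightarrow> real"
  assumes [measurable]: "f \<in> borel_measurable borel" "g \<in> borel_measurable borel"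
    and i: "integrable lborel (\<lambda>x. (f x)\<^sup>2)" "integrable lborel (\<lambda>x. (g x)\<^sup>2)"
  shows "integrable lborel (\<lambda>x. (f x + g x)\<^sup>2)"
    "(\<integral>x. (f x + g x)\<^sup>2 \<partial>lborel) \<le> 2 * (\<integral>x. (f x)\<^sup>2 \<partial>lborel) + 2 * (\<integral>x. (g x)\<^sup>2 \<partial>lborel)"
proof -
  have I: "integrable lborel (\<lambda>x. 2 * (f x)\<^sup>2 + 2 * (g x)\<^sup>2)" using i by simp
  show 1: "integrable lborel (\<lambda>x. (f x + g x)\<^sup>2)"
    by (rule Bochner_Integration.integrable_bound[OF I]) (use square_add_le in auto)
  show "(\<integral>x. (f x + g x)\<^sup>2 \<partial>lborel) \<le> 2 * (\<integral>x. (f x)\<^sup>2 \<partial>lborel) + 2 * (\<integral>x. (g x)\<^sup>2 \<partial>lborel)"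
    using integral_mono[OF 1 I square_add_le] i by simp
qed

lemma test_function_square: "test_function \<phi> \<Longrightarrow> \<phi> \<in> borel_measurable borel \<and> integrable lborel (\<lambda>x. (\<phi> x)\<^sup>2)"
  using continuous_bounded_support[OF test_function_continuous] by (auto simp: test_function_iff)

lemma L2_closure_closed:
  assumes [measurable]: "w \<in> borel_measurable borel" and w: "integrable lborel (\<lambda>x. (w x)\<^sup>2)"
    and ap: "\<And>\<epsilon>. 0 < \<epsilon> \<Longrightarrow> \<exists>v. L2_closure v \<and> (\<integral>x. (w x - v x)\<^sup>2 \<partial>lborel) < \<epsilon>"
  shows "L2_closure w"
  unfolding L2_closure_def
proof (intro conjI allI impI assms)
  fix \<epsilon> :: real assume \<epsilon>: "0 < \<epsilon>"
  then obtain v where v: "L2_closure v" "(\<integral>x. (w x - v x)\<^sup>2 \<partial>lborel) < \<epsilon> / 4" using ap[of "\<epsilon> / 4"] by auto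
  have [measurable]: "v \<in> borel_measurable borel" and vi: "integrable lborel (\<lambda>x. (v x)\<^sup>2)" using v(1) by (auto simp: L2_closure_def)
  obtain \<phi> where \<phi>: "test_function \<phi>" "(\<integral>x. (v x - \<phi> x)\<^sup>2 \<partial>lborel) < \<epsilon> / 4" using v(1) \<epsilon> unfolding L2_closure_def by (meson divide_pos_pos zero_less_numeral)
  have [measurable]: "\<phi> \<in> borel_measurable borel" and \<phi>i: "integrable lborel (\<lambda>x. (\<phi> x)\<^sup>2)" using test_function_square[OF \<phi>(1)] by auto
  have "(\<integral>x. ((w x + - v x) + (v x + - \<phi> x))\<^sup>2 \<partial>lborel) \<le> 2 * (\<integral>x. (w x + - v x)\<^sup>2 \<partial>lborel) + 2 * (\<integral>x. (v x + - \<phi> x)\<^sup>2 \<partial>lborel)"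
    using w vi \<phi>i by (intro integrable_square_add) auto
  also have "\<dots> < \<epsilon>" using v(2) \<phi>(2) by simp
  finally show "\<exists>\<phi>. test_function \<phi> \<and> (\<integral>x. (w x - \<phi> x)\<^sup>2 \<partial>lborel) < \<epsilon>" using \<phi>(1) by auto
qed

lemma L2_closure_test: "test_function \<phi> \<Longrightarrow> L2_closure \<phi>"
  using test_function_square[of \<phi>] by (auto simp: L2_closure_def intro!: exI[of _ \<phi>])

lemma L2_closure_add:
  assumes "L2_closure v" "L2_closure w"
  shows "L2_closure (\<lambda>x. v x + w x)"
proof -
  have [measurable]: "v \<in> borel_measurable borel" "w \<in> borel_measurable borel"
    and i: "integrable lborel (\<lambda>x. (v x)\<^sup>2)" "integrable lborel (\<lambda>x. (w x)\<^sup>2)"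
    using assms by (auto simp: L2_closure_def)
  show ?thesis
  proof (rule L2_closure_closed)
    show "integrable lborel (\<lambda>x. (v x + w x)\<^sup>2)" using i by (intro integrable_square_add) auto
    fix \<epsilon> :: real assume "0 < \<epsilon>"
    then have e: "0 < \<epsilon> / 4" by simp
    obtain \<phi> \<psi> where \<phi>: "test_function \<phi>" "(\<integral>x. (v x - \<phi> x)\<^sup>2 \<partial>lborel) < \<epsilon> / 4" 
      and \<psi>: "test_function \<psi>" "(\<integral>x. (w x - \<psi> x)\<^sup>2 \<partial>lborel) < \<epsilon> / 4"
      using assms e unfolding L2_closure_def by meson
    have [measurable]: "\<phi> \<in> borel_measurable borel" "\<psi> \<in> borel_measurable borel"
      and ti: "integrable lborel (\<lambda>x. (\<phi> x)\<^sup>2)" "integrable lborel (\<lambda>x. (\<psi> x)\<^sup>2)"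
      using test_function_square[OF \<phi>(1)] test_function_square[OF \<psi>(1)] by auto
    have I1: "integrable lborel (\<lambda>x. (v x + - \<phi> x)\<^sup>2)"
      by (intro integrable_square_add) (use i ti in auto)
    have I2: "integrable lborel (\<lambda>x. (w x + - \<psi> x)\<^sup>2)"
      by (intro integrable_square_add) (use i ti in auto)
    have "(\<integral>x. ((v x + - \<phi> x) + (w x + - \<psi> x))\<^sup>2 \<partial>lborel) \<le> 2 * (\<integral>x. (v x + - \<phi> x)\<^sup>2 \<partial>lborel) + 2 * (\<integral>x. (w x + - \<psi> x)\<^sup>2 \<partial>lborel)"
      by (rule integrable_square_add(2)[OF _ _ I1 I2]) auto
    also have "\<dots> < \<epsilon>" using \<phi>(2) \<psi>(2) by simp
    finally have "(\<integral>x. (v x + w x - (\<phi> x + \<psi> x))\<^sup>2 \<partial>lborel) < \<epsilon>" by (simp add: algebra_simps)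
    then show "\<exists>z. L2_closure z \<and> (\<integral>x. (v x + w x - z x)\<^sup>2 \<partial>lborel) < \<epsilon>"
      using L2_closure_test[OF test_function_add[OF \<phi>(1) \<psi>(1)]] by blast
  qed measurable
qed

lemma L2_closure_cmult:
  assumes "L2_closure w"
  shows "L2_closure (\<lambda>x. c * w x)"
proof -
  have [measurable]: "w \<in> borel_measurable borel" and i: "integrable lborel (\<lambda>x. (w x)\<^sup>2)"
    using assms by (auto simp: L2_closure_def)
  show ?thesis
  proof (rule L2_closure_closed)
    show "integrable lborel (\<lambda>x. (c * w x)\<^sup>2)" using i by (simp add: power_mult_distrib)
    fix \<epsilon> :: real assume e: "0 < \<epsilon>"
    have c: "0 < c\<^sup>2 + 1" by (simp add: add_nonneg_pos)
    obtain \<phi> where \<phi>: "test_function \<phi>" "(\<integral>x. (w x - \<phi> x)\<^sup>2 \<partial>lborel) < \<epsilon> / (c\<^sup>2 + 1)"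
      using assms divide_pos_pos[OF e c] unfolding L2_closure_def by meson
    have "(\<integral>x. (c * w x - c * \<phi> x)\<^sup>2 \<partial>lborel) = c\<^sup>2 * (\<integral>x. (w x - \<phi> x)\<^sup>2 \<partial>lborel)"
      by (subst integral_mult_right_zero[symmetric]) (simp add: right_diff_distrib[symmetric] power_mult_distrib)
    also have "\<dots> \<le> (c\<^sup>2 + 1) * (\<integral>x. (w x - \<phi> x)\<^sup>2 \<partial>lborel)"
      by (intro mult_right_mono) auto
    also have "\<dots> < \<epsilon>" using \<phi>(2) c by (simp add: less_divide_eq mult.commute)
    finally show "\<exists>z. L2_closure z \<and> (\<integral>x. (c * w x - z x)\<^sup>2 \<partial>lborel) < \<epsilon>"
      using L2_closure_test[OF test_function_cmult[OF \<phi>(1)]] by blast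
  qed measurable
qed

lemma L2_closure_sum: "(\<And>i. i \<in> I \<Longrightarrow> L2_closure (f i)) \<Longrightarrow> L2_closure (\<lambda>x. \<Sum>i\<in>I. f i x)"
proof (induction I rule: infinite_finite_induct)
  case (insert i I)
  then show ?case by (simp add: L2_closure_add)
qed (use L2_closure_cmult[OF L2_closure_test, of "\<lambda>_. 0" 0] in \<open>auto simp: test_function_iff Ck_const\<close>)

lemma L2_closure_limit:
  fixes v :: "nat \<Rightarrow> 'a::euclidean_space \<Rightarrow> real"
  assumes v: "\<And>n. L2_closure (v n)" and [measurable]: "w \<in> borel_measurable borel" and lim: "\<And>x. (\<lambda>n. v n x) \<longlonglongrightarrow> w x"
    and dom: "\<And>n x. (w x - v n x)\<^sup>2 \<le> g x" and g: "integrable lborel g" and wi: "integrable lborel (\<lambda>x. (w x)\<^sup>2)"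
  shows "L2_closure w"
proof (rule L2_closure_closed[OF _ wi])
  have [measurable]: "v n \<in> borel_measurable borel" for n using v by (auto simp: L2_closure_def)
  have "(\<lambda>n. \<integral>x. (w x - v n x)\<^sup>2 \<partial>lborel) \<longlonglongrightarrow> (\<integral>x. 0 \<partial>(lborel::'a measure))"
  proof (rule integral_dominated_convergence[OF _ _ g])
    show "AE x in lborel. (\<lambda>n. (w x - v n x)\<^sup>2) \<longlonglongrightarrow> 0"
    proof (rule AE_I2)
      fix x
      have "(\<lambda>n. (w x - v n x)\<^sup>2) \<longlonglongrightarrow> (w x - w x)\<^sup>2" by (intro tendsto_intros lim)
      then show "(\<lambda>n. (w x - v n x)\<^sup>2) \<longlonglongrightarrow> 0" by simp
    qed
  qed (use dom in auto)
  then have "(\<lambda>n. \<integral>x. (w x - v n x)\<^sup>2 \<partial>lborel) \<longlonglongrightarrow> 0" by simp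
  note conv = this
  fix \<epsilon> :: real assume "0 < \<epsilon>"
  with conv have "\<forall>\<^sub>F n in sequentially. (\<integral>x. (w x - v n x)\<^sup>2 \<partial>lborel) < \<epsilon>" by (rule order_tendstoD)
  then obtain n where "(\<integral>x. (w x - v n x)\<^sup>2 \<partial>lborel) < \<epsilon>"
    using eventually_happens'[OF sequentially_bot] by blast
  then show "\<exists>v. L2_closure v \<and> (\<integral>x. (w x - v x)\<^sup>2 \<partial>lborel) < \<epsilon>"
    using v by blast
qed measurable

lemma L2_closure_open:
  fixes U :: "'a::euclidean_space set"
  assumes "open U" "emeasure lborel U < \<infinity>"
  shows "L2_closure (indicator U)"
proof -
  obtain \<phi> :: "nat \<Rightarrow> 'a \<Rightarrow> real" where \<phi>: "\<And>n. test_function (\<phi> n)" "\<And>n x. 0 \<le> \<phi> n x" "\<And>n x. \<phi> n x \<le> indicator U x"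
    "\<And>x. (\<lambda>n. \<phi> n x) \<longlonglongrightarrow> indicator U x" using open_indicator_limit[OF assms(1)] by metis
  have [measurable]: "U \<in> sets borel" using assms by auto
  have I: "integrable lborel (indicator U :: 'a \<Rightarrow> real)" using assms by simp
  have sq: "(indicator U x)\<^sup>2 = (indicator U x :: real)" for x :: 'a by (auto simp: indicator_def)
  show ?thesis
  proof (rule L2_closure_limit[OF L2_closure_test[OF \<phi>(1)] _ \<phi>(4) _ I])
    show "(indicator U x - \<phi> n x)\<^sup>2 \<le> indicator U x" for n x
      using \<phi>(2)[of n x] \<phi>(3)[of n x] by (auto simp: indicator_def power_le_one split: if_splits)
    show "integrable lborel (\<lambda>x. (indicator U x :: real)\<^sup>2)" unfolding sq by (rule I)
  qed measurable
qed

text \<open>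
  Outer regularity of Lebesgue measure.
\<close>
lemma L2_closure_indicator:
  fixes A :: "'a::euclidean_space set"
  assumes [measurable]: "A \<in> sets borel" and fin: "emeasure lborel A < \<infinity>"
  shows "L2_closure (indicator A)"
proof (rule L2_closure_closed)
  have sq: "(indicator A x)\<^sup>2 = (indicator A x :: real)" for x :: 'a by (auto simp: indicator_def)
  show "integrable lborel (\<lambda>x. (indicator A x :: real)\<^sup>2)" unfolding sq using fin by simp
  fix \<epsilon> :: real assume "0 < \<epsilon>"
  then obtain U where U: "open U" "A \<subseteq> U" "emeasure lborel (U - A) < \<epsilon>"
    using outer_regular_lborel[OF assms(1)] by metis
  have [measurable]: "U \<in> sets borel" using U by auto
  have "emeasure lborel U = emeasure lborel A + emeasure lborel (U - A)"
    using U(2) by (subst plus_emeasure) (auto simp: Un_absorb1)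
  also have "\<dots> < \<infinity>" using fin U(3) ennreal_less_top[of \<epsilon>] by (auto simp: less_top[symmetric] top_unique)
  finally have L: "L2_closure (indicator U :: 'a \<Rightarrow> real)" by (rule L2_closure_open[OF U(1)])
  have "(indicator A x - indicator U x)\<^sup>2 = (indicator (U - A) x :: real)" for x
    using U(2) by (auto simp: indicator_def)
  then have "(\<integral>x. (indicator A x - indicator U x)\<^sup>2 \<partial>lborel) = measure lborel (U - A)" by simp
  also have "\<dots> < \<epsilon>"
  proof -
    have "emeasure lborel (U - A) \<noteq> top" using U(3) by auto
    then show ?thesis
      using U(3) by (simp add: emeasure_eq_ennreal_measure ennreal_less_iff)
  qed
  finally show "\<exists>v. L2_closure v \<and> (\<integral>x. (indicator A x - v x)\<^sup>2 \<partial>lborel) < \<epsilon>" using L by blast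
qed measurable

text \<open>
  Test functions are dense in $L^2$: approximate by simple functions dominated by a multiple of \<open>w\<close>, whose
  level sets for nonzero values have finite measure.
\<close>
lemma L2_closure_all:
  fixes w :: "'a::euclidean_space \<Rightarrow> real"
  assumes w [measurable]: "w \<in> borel_measurable borel" and wi: "integrable lborel (\<lambda>x. (w x)\<^sup>2)"
  shows "L2_closure w"
proof -
  have wl: "w \<in> borel_measurable lborel" by simp
  obtain F where F: "\<And>i. simple_function lborel (F i)" "\<And>x. (\<lambda>i. F i x) \<longlonglongrightarrow> w x" "\<And>i x. \<bar>F i x\<bar> \<le> 2 * \<bar>w x\<bar>"
    using borel_measurable_implies_sequence_metric[OF wl, of 0] by (auto simp: dist_norm)
  have Fm [measurable]: "F i \<in> borel_measurable borel" for i
    using borel_measurable_simple_function[OF F(1)] by simp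
  have F2: "(F i x)\<^sup>2 \<le> 4 * (w x)\<^sup>2" for i x
    using power_mono[OF F(3)[of i x], of 2] by (simp add: power_mult_distrib)
  have Fi: "integrable lborel (\<lambda>x. (F i x)\<^sup>2)" for i
    by (rule Bochner_Integration.integrable_bound[OF integrable_mult_right[OF wi, of 4]]) (use F2 in auto)
  have "L2_closure (F i)" for i
  proof -
    have fin: "finite (range (F i))" using F(1)[of i] by (simp add: simple_function_def)
    have "(\<Sum>y\<in>range (F i). y * indicator (F i -` {y}) x) = F i x" for x
      by (subst sum.mono_neutral_cong_right[of _ "{F i x}" _ "\<lambda>y. y"]) (auto simp: fin indicator_def)
    then have eq: "(\<lambda>x. \<Sum>y\<in>range (F i). y * indicator (F i -` {y}) x) = F i"
      by (rule ext)
    have "L2_closure (\<lambda>x. \<Sum>y\<in>range (F i). y * indicator (F i -` {y}) x)"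
    proof (rule L2_closure_sum)
      fix y
      show "L2_closure (\<lambda>x. y * indicator (F i -` {y}) x)"
      proof (cases "y = 0")
        case True
        then show ?thesis using L2_closure_test[of "\<lambda>_. 0"] by (simp add: test_function_iff Ck_const)
      next
        case False
        have m: "F i -` {y} \<in> sets borel" using measurable_sets[OF Fm[of i], of "{y}"] by simp
        have "ennreal (y\<^sup>2) * emeasure lborel (F i -` {y}) = (\<integral>\<^sup>+x. ennreal (y\<^sup>2) * indicator (F i -` {y}) x \<partial>lborel)"
          using m by (simp add: nn_integral_cmult_indicator)
        also have "\<dots> \<le> (\<integral>\<^sup>+x. ennreal ((F i x)\<^sup>2) \<partial>lborel)"
          by (intro nn_integral_mono) (auto simp: indicator_def)
        also have "\<dots> < \<infinity>" using Fi[of i] by (simp add: integrable_iff_bounded)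
        finally have "emeasure lborel (F i -` {y}) < \<infinity>"
          using False by (auto simp: ennreal_mult_less_top)
        then show ?thesis by (intro L2_closure_cmult L2_closure_indicator m)
      qed
    qed
    then show ?thesis unfolding eq .
  qed
  then show ?thesis
  proof (rule L2_closure_limit[OF _ w F(2) _ _ wi])
    show "integrable lborel (\<lambda>x. 10 * (w x)\<^sup>2)" using wi by simp
    show "(w x - F n x)\<^sup>2 \<le> 10 * (w x)\<^sup>2" for n x
      using square_add_le[of "w x" "- F n x"] F2[of n x] by simp
  qed
qed

section \<open>The gradient bounds the deficit\<close>

lemma test_function_borel: "test_function \<phi> \<Longrightarrow> \<phi> \<in> borel_measurable borel"
  using test_function_square by blast

lemma integrable_mult_of_squares:
  fixes f g :: "'a::euclidean_space \<Rightarrow> real"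
  assumes [measurable]: "f \<in> borel_measurable borel" "g \<in> borel_measurable borel"
    and i: "integrable lborel (\<lambda>x. (f x)\<^sup>2)" "integrable lborel (\<lambda>x. (g x)\<^sup>2)"
  shows "integrable lborel (\<lambda>x. f x * g x)"
    "(\<integral>x. \<bar>f x * g x\<bar> \<partial>lborel) \<le> ((\<integral>x. (f x)\<^sup>2 \<partial>lborel) + (\<integral>x. (g x)\<^sup>2 \<partial>lborel)) / 2"
proof -
  have I: "integrable lborel (\<lambda>x. ((f x)\<^sup>2 + (g x)\<^sup>2) / 2)" using i by simp
  have le: "\<bar>f x * g x\<bar> \<le> ((f x)\<^sup>2 + (g x)\<^sup>2) / 2" for x
    using sum_squares_bound[of "\<bar>f x\<bar>" "\<bar>g x\<bar>"] by (simp add: abs_mult)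
  show 1: "integrable lborel (\<lambda>x. f x * g x)"
    by (rule Bochner_Integration.integrable_bound[OF I]) (use le in auto)
  show "(\<integral>x. \<bar>f x * g x\<bar> \<partial>lborel) \<le> ((\<integral>x. (f x)\<^sup>2 \<partial>lborel) + (\<integral>x. (g x)\<^sup>2 \<partial>lborel)) / 2"
    using integral_mono[OF integrable_abs[OF 1] I le] i by simp
qed

lemma integral_shift:
  fixes f :: "'a::euclidean_space \<Rightarrow> real"
  assumes "integrable lborel f"
  shows "integrable lborel (\<lambda>x. f (x - c))" "(\<integral>x. f (x - c) \<partial>lborel) = (\<integral>x. f x \<partial>lborel)"
  using has_bochner_integral_shift_minus[of f "integral\<^sup>L lborel f" c] assms by (auto simp: has_bochner_integral_iff)

text \<open>
  By duality.  Against a test function \<open>\<phi>\<close>, the increment of \<open>v\<close> becomes an increment of \<open>\<phi>\<close>, hence an integral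
  of derivatives of translates of \<open>\<phi>\<close>, onto which the weak derivative can be moved.  This bounds
  $\int w\phi$ by $(\|\phi\|^2 + \|g\|^2)/2$, where \<open>w\<close> is the increment and \<open>g\<close> the directional derivative.
  Expanding $\|w - \phi\|^2$ for \<open>\<phi>\<close> close to \<open>w\<close> gives $\|w\|^2 \le \|g\|^2$ in the limit.
\<close>
lemma weak_derivative_translation:
  fixes v :: "'a::euclidean_space \<Rightarrow> real"
  assumes [measurable]: "v \<in> borel_measurable borel" and vi: "integrable lborel (\<lambda>x. (v x)\<^sup>2)"
    and G: "\<And>e. e \<in> Basis \<Longrightarrow> G e \<in> borel_measurable borel" "\<And>e. e \<in> Basis \<Longrightarrow> integrable lborel (\<lambda>x. (G e x)\<^sup>2)"
    and weak: "\<And>\<phi> e. test_function \<phi> \<Longrightarrow> e \<in> Basis \<Longrightarrow>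
       (\<integral>x. frechet_derivative \<phi> (at x) e * v x \<partial>lborel) = - (\<integral>x. \<phi> x * G e x \<partial>lborel)"
  shows "(\<integral>x. (v (x + z) - v x)\<^sup>2 \<partial>lborel) \<le> (\<integral>x. (\<Sum>e\<in>Basis. (z \<bullet> e) * G e x)\<^sup>2 \<partial>lborel)"
proof -
  define g where "g x = (\<Sum>e\<in>Basis. (z \<bullet> e) * G e x)" for x
  define w where "w x = v (x + z) - v x" for x
  have g_meas [measurable]: "g \<in> borel_measurable borel" unfolding g_def using G(1) by measurable
  have w_meas [measurable]: "w \<in> borel_measurable borel" unfolding w_def by measurable
  have gi: "integrable lborel (\<lambda>x. (g x)\<^sup>2)"
  proof -
    have "L2_closure g"
      unfolding g_def by (intro L2_closure_sum L2_closure_cmult L2_closure_all G)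
    then show ?thesis by (simp add: L2_closure_def)
  qed
  have vzi: "integrable lborel (\<lambda>x. (v (x + z))\<^sup>2)"
    using integral_shift(1)[OF vi, of "- z"] by simp
  have wi: "integrable lborel (\<lambda>x. (w x)\<^sup>2)"
    unfolding w_def diff_conv_add_uminus by (intro integrable_square_add) (use vi vzi in auto)
  have dual: "(\<integral>x. w x * \<phi> x \<partial>lborel) \<le> ((\<integral>x. (\<phi> x)\<^sup>2 \<partial>lborel) + (\<integral>x. (g x)\<^sup>2 \<partial>lborel)) / 2"
    if \<phi>: "test_function \<phi>" for \<phi>
  proof -
    note [measurable] = test_function_borel[OF \<phi>]
    have \<phi>i: "integrable lborel (\<lambda>x. (\<phi> x)\<^sup>2)" using test_function_square[OF \<phi>] by blast
    define d where "d x = frechet_derivative \<phi> (at x) z" for x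
    have d_sum: "d x = (\<Sum>e\<in>Basis. (z \<bullet> e) * frechet_derivative \<phi> (at x) e)" for x
    proof -
      have lin: "linear (frechet_derivative \<phi> (at x))"
        using test_function_derivative(1)[OF \<phi>] by (rule has_derivative_linear)
      have "d x = frechet_derivative \<phi> (at x) (\<Sum>e\<in>Basis. (z \<bullet> e) *\<^sub>R e)"
        unfolding d_def euclidean_representation ..
      also have "\<dots> = (\<Sum>e\<in>Basis. (z \<bullet> e) * frechet_derivative \<phi> (at x) e)"
        using lin by (simp add: linear_sum linear_cmul)
      finally show ?thesis .
    qed
    have d_cont: "continuous_on UNIV d"
      unfolding d_sum by (intro continuous_intros test_function_derivative[OF \<phi>])
    have d_meas [measurable]: "d \<in> borel_measurable borel" and di: "integrable lborel (\<lambda>x. (d x)\<^sup>2)"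
    proof -
      have "bounded {x. d x \<noteq> 0}" unfolding d_def by (rule test_function_derivative(3)[OF \<phi>])
      then show "d \<in> borel_measurable borel" "integrable lborel (\<lambda>x. (d x)\<^sup>2)"
        by (rule continuous_bounded_support[OF d_cont])+
    qed
    have sq_shift: "integrable lborel (\<lambda>x. (f (x - c))\<^sup>2)" "(\<integral>x. (f (x - c))\<^sup>2 \<partial>lborel) = (\<integral>x. (f x)\<^sup>2 \<partial>lborel)"
      if "integrable lborel (\<lambda>x. (f x)\<^sup>2)" for f :: "'a \<Rightarrow> real" and c
      using integral_shift[OF that, of c] by simp_all
    \<comment> \<open>the fundamental theorem of calculus along the segment\<close>
    have ftc: "has_bochner_integral lborel (\<lambda>t. - d (x - t *\<^sub>R z) * indicator {0..1} t) (\<phi> (x - z) - \<phi> x)" for x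
    proof -
      have "has_bochner_integral lborel (\<lambda>t. - d (x - t *\<^sub>R z) * indicator {0..1::real} t) (\<phi> (x - 1 *\<^sub>R z) - \<phi> (x - 0 *\<^sub>R z))"
      proof (rule has_bochner_integral_FTC_Icc_real)
        fix t :: real
        have lin: "linear (frechet_derivative \<phi> (at (x - t *\<^sub>R z)))"
          using test_function_derivative(1)[OF \<phi>] by (rule has_derivative_linear)
        have "((\<lambda>t. \<phi> (x - t *\<^sub>R z)) has_derivative (\<lambda>h. frechet_derivative \<phi> (at (x - t *\<^sub>R z)) (- (h *\<^sub>R z)))) (at t)"
          by (rule has_derivative_compose[where f = "\<lambda>t. x - t *\<^sub>R z" and f' = "\<lambda>h. - (h *\<^sub>R z)" and g = \<phi>, OF _ test_function_derivative(1)[OF \<phi>]])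
            (auto intro!: derivative_eq_intros)
        moreover have "(\<lambda>h. frechet_derivative \<phi> (at (x - t *\<^sub>R z)) (- (h *\<^sub>R z))) = (*) (- d (x - t *\<^sub>R z))"
          using lin by (auto simp: d_def linear_neg linear_cmul)
        ultimately show "((\<lambda>t. \<phi> (x - t *\<^sub>R z)) has_real_derivative - d (x - t *\<^sub>R z)) (at t)"
          by (simp add: has_field_derivative_def)
        have "isCont d (x - t *\<^sub>R z)" using d_cont by (simp add: continuous_on_eq_continuous_at)
        then show "isCont (\<lambda>t. - d (x - t *\<^sub>R z)) t"
          by (intro continuous_intros isCont_o2[where f = "\<lambda>t. x - t *\<^sub>R z" and g = d]) auto
      qed simp
      then show ?thesis by simp
    qed
    define F where "F = (\<lambda>(t, x). v x * (- d (x - t *\<^sub>R z) * indicator {0..1::real} t))"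
    have F_int: "integrable (lborel \<Otimes>\<^sub>M lborel) F"
    proof (rule lborel_pair.Fubini_integrable)
      show "F \<in> borel_measurable (lborel \<Otimes>\<^sub>M lborel)" unfolding F_def by measurable
      define K where "K = ((\<integral>x. (v x)\<^sup>2 \<partial>lborel) + (\<integral>x. (d x)\<^sup>2 \<partial>lborel)) / 2"
      have K0: "0 \<le> K" by (simp add: K_def)
      have vd: "integrable lborel (\<lambda>x. v x * d (x - t *\<^sub>R z))" "(\<integral>x. \<bar>v x * d (x - t *\<^sub>R z)\<bar> \<partial>lborel) \<le> K" for t
        using integrable_mult_of_squares[of v "\<lambda>x. d (x - t *\<^sub>R z)", OF _ _ vi sq_shift(1)[OF di]] sq_shift(2)[OF di, of "t *\<^sub>R z"]
        by (simp_all add: K_def)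
      have F_eq: "F (t, x) = - indicator {0..1} t * (v x * d (x - t *\<^sub>R z))" for t x by (simp add: F_def)
      show "AE t in lborel. integrable lborel (\<lambda>x. F (t, x))"
        unfolding F_eq using vd(1) by auto
      have I: "integrable lborel (\<lambda>t::real. K * indicator {0..1} t)"
        by (intro integrable_mult_right integrable_real_indicator emeasure_compact_finite) auto
      show "integrable lborel (\<lambda>t. \<integral>x. norm (F (t, x)) \<partial>lborel)"
      proof (rule Bochner_Integration.integrable_bound[OF I])
        show "AE t in lborel. norm (\<integral>x. norm (F (t, x)) \<partial>lborel) \<le> norm (K * indicator {0..1} t)"
        proof (rule AE_I2)
          fix t :: real
          show "norm (\<integral>x. norm (F (t, x)) \<partial>lborel) \<le> norm (K * indicator {0..1} t)"
            unfolding F_eq using vd(2)[of t] K0 by (cases "t \<in> {0..1}") auto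
        qed
      qed (unfold F_eq, measurable)
    qed
    have "(\<integral>x. w x * \<phi> x \<partial>lborel) = (\<integral>x. v (x + z) * \<phi> x - v x * \<phi> x \<partial>lborel)"
      by (simp add: w_def left_diff_distrib)
    also have "\<dots> = (\<integral>x. v (x + z) * \<phi> x \<partial>lborel) - (\<integral>x. v x * \<phi> x \<partial>lborel)"
      by (intro Bochner_Integration.integral_diff integrable_mult_of_squares) (use vi vzi \<phi>i in auto)
    also have "(\<integral>x. v (x + z) * \<phi> x \<partial>lborel) = (\<integral>x. v x * \<phi> (x - z) \<partial>lborel)"
      using integral_shift(2)[OF integrable_mult_of_squares(1)[of "\<lambda>x. v (x + z)" \<phi>, OF _ _ vzi \<phi>i], of z] by simp
    also have "(\<integral>x. v x * \<phi> (x - z) \<partial>lborel) - (\<integral>x. v x * \<phi> x \<partial>lborel) = (\<integral>x. v x * \<phi> (x - z) - v x * \<phi> x \<partial>lborel)"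
      by (intro Bochner_Integration.integral_diff[symmetric] integrable_mult_of_squares) (use vi sq_shift(1)[OF \<phi>i] \<phi>i in auto)
    also have "\<dots> = (\<integral>x. (\<integral>t. F (t, x) \<partial>lborel) \<partial>lborel)"
    proof (rule Bochner_Integration.integral_cong[OF refl])
      fix x
      have "(\<integral>t. F (t, x) \<partial>lborel) = v x * (\<integral>t. - d (x - t *\<^sub>R z) * indicator {0..1::real} t \<partial>lborel)"
        unfolding F_def prod.case by (rule integral_mult_right_zero)
      moreover have "(\<integral>t. - d (x - t *\<^sub>R z) * indicator {0..1::real} t \<partial>lborel) = \<phi> (x - z) - \<phi> x"
        using ftc[of x] unfolding has_bochner_integral_iff by (rule conjunct2)
      ultimately show "v x * \<phi> (x - z) - v x * \<phi> x = (\<integral>t. F (t, x) \<partial>lborel)"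
        by (simp only: right_diff_distrib)
    qed
    also have "\<dots> = (\<integral>t. (\<integral>x. F (t, x) \<partial>lborel) \<partial>lborel)"
      using lborel_pair.Fubini_integral[of "\<lambda>t x. F (t, x)"] F_int by simp
    also have "\<dots> = (\<integral>t. indicator {0..1} t * (\<integral>x. \<phi> (x - t *\<^sub>R z) * g x \<partial>lborel) \<partial>lborel)"
    proof (rule Bochner_Integration.integral_cong[OF refl])
      fix t :: real
      let ?\<phi> = "\<lambda>x. \<phi> (x - t *\<^sub>R z)"
      have t: "test_function ?\<phi>" by (rule test_function_shift[OF \<phi>])
      have fd: "frechet_derivative ?\<phi> (at x) = frechet_derivative \<phi> (at (x - t *\<^sub>R z))" for x
      proof (rule frechet_derivative_at[symmetric])
        show "(?\<phi> has_derivative frechet_derivative \<phi> (at (x - t *\<^sub>R z))) (at x)"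
          by (rule has_derivative_compose[where f = "\<lambda>x. x - t *\<^sub>R z" and f' = "\<lambda>h. h" and g = \<phi>, OF _ test_function_derivative(1)[OF \<phi>]])
            (auto intro!: derivative_eq_intros)
      qed
      have De: "integrable lborel (\<lambda>x. frechet_derivative ?\<phi> (at x) e * v x)" if e: "e \<in> Basis" for e
      proof (rule integrable_mult_of_squares[OF _ _ _ vi])
        note c = continuous_bounded_support[OF test_function_derivative(2)[OF t e] test_function_derivative(3)[OF t]]
        show "(\<lambda>x. frechet_derivative ?\<phi> (at x) e) \<in> borel_measurable borel" "integrable lborel (\<lambda>x. (frechet_derivative ?\<phi> (at x) e)\<^sup>2)"
          by (rule c)+
      qed simp
      have Ge: "integrable lborel (\<lambda>x. ?\<phi> x * G e x)" if e: "e \<in> Basis" for e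
        by (rule integrable_mult_of_squares[OF _ _ sq_shift(1)[OF \<phi>i] G(2)[OF e]]) (use G(1)[OF e] in auto)
      have "(\<integral>x. F (t, x) \<partial>lborel) = - indicator {0..1} t * (\<integral>x. d (x - t *\<^sub>R z) * v x \<partial>lborel)"
        unfolding F_def prod.case by (subst integral_mult_right_zero[symmetric]) (simp add: mult_ac)
      also have "(\<integral>x. d (x - t *\<^sub>R z) * v x \<partial>lborel) = (\<integral>x. (\<Sum>e\<in>Basis. (z \<bullet> e) * (frechet_derivative ?\<phi> (at x) e * v x)) \<partial>lborel)"
        unfolding d_sum fd by (simp add: sum_distrib_right mult.assoc)
      also have "\<dots> = (\<Sum>e\<in>Basis. (z \<bullet> e) * (\<integral>x. frechet_derivative ?\<phi> (at x) e * v x \<partial>lborel))"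
        using De by (subst Bochner_Integration.integral_sum) auto
      also have "\<dots> = - (\<Sum>e\<in>Basis. (z \<bullet> e) * (\<integral>x. ?\<phi> x * G e x \<partial>lborel))"
        using weak[OF t] by (simp add: sum_negf)
      also have "(\<Sum>e\<in>Basis. (z \<bullet> e) * (\<integral>x. ?\<phi> x * G e x \<partial>lborel)) = (\<integral>x. (\<Sum>e\<in>Basis. (z \<bullet> e) * (?\<phi> x * G e x)) \<partial>lborel)"
        using Ge by (subst Bochner_Integration.integral_sum) auto
      also have "\<dots> = (\<integral>x. ?\<phi> x * g x \<partial>lborel)"
        unfolding g_def by (simp add: sum_distrib_left mult_ac)
      finally show "(\<integral>x. F (t, x) \<partial>lborel) = indicator {0..1} t * (\<integral>x. ?\<phi> x * g x \<partial>lborel)" by simp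
    qed
    also have "\<dots> \<le> (\<integral>t. indicator {0..1::real} t * (((\<integral>x. (\<phi> x)\<^sup>2 \<partial>lborel) + (\<integral>x. (g x)\<^sup>2 \<partial>lborel)) / 2) \<partial>lborel)"
    proof (rule integral_mono')
      show "integrable lborel (\<lambda>t::real. indicator {0..1} t * (((\<integral>x. (\<phi> x)\<^sup>2 \<partial>lborel) + (\<integral>x. (g x)\<^sup>2 \<partial>lborel)) / 2))"
        by (intro integrable_mult_left integrable_real_indicator emeasure_compact_finite) auto
      fix t :: real
      note m = integrable_mult_of_squares[of "\<lambda>x. \<phi> (x - t *\<^sub>R z)" g, OF _ _ sq_shift(1)[OF \<phi>i] gi]
      have "(\<integral>x. \<phi> (x - t *\<^sub>R z) * g x \<partial>lborel) \<le> (\<integral>x. \<bar>\<phi> (x - t *\<^sub>R z) * g x\<bar> \<partial>lborel)"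
        by (intro integral_mono integrable_abs m) auto
      also have "\<dots> \<le> ((\<integral>x. (\<phi> x)\<^sup>2 \<partial>lborel) + (\<integral>x. (g x)\<^sup>2 \<partial>lborel)) / 2"
        using m(2) sq_shift(2)[OF \<phi>i] by simp
      finally show "indicator {0..1} t * (\<integral>x. \<phi> (x - t *\<^sub>R z) * g x \<partial>lborel) \<le> indicator {0..1} t * (((\<integral>x. (\<phi> x)\<^sup>2 \<partial>lborel) + (\<integral>x. (g x)\<^sup>2 \<partial>lborel)) / 2)"
        by (intro mult_left_mono) auto
      show "0 \<le> indicator {0..1} t * (((\<integral>x. (\<phi> x)\<^sup>2 \<partial>lborel) + (\<integral>x. (g x)\<^sup>2 \<partial>lborel)) / 2)" by simp
    qed
    also have "\<dots> = ((\<integral>x. (\<phi> x)\<^sup>2 \<partial>lborel) + (\<integral>x. (g x)\<^sup>2 \<partial>lborel)) / 2"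
      by (subst integral_mult_left_zero) simp
    finally show ?thesis .
  qed
  have "(\<integral>x. (w x)\<^sup>2 \<partial>lborel) \<le> (\<integral>x. (g x)\<^sup>2 \<partial>lborel)"
  proof (rule field_le_epsilon)
    fix \<epsilon> :: real assume "0 < \<epsilon>"
    then obtain \<phi> where \<phi>: "test_function \<phi>" "(\<integral>x. (w x - \<phi> x)\<^sup>2 \<partial>lborel) < \<epsilon>"
      using L2_closure_all[OF w_meas wi] unfolding L2_closure_def by blast
    have [measurable]: "\<phi> \<in> borel_measurable borel" and \<phi>i: "integrable lborel (\<lambda>x. (\<phi> x)\<^sup>2)"
      using test_function_square[OF \<phi>(1)] by auto
    have w\<phi>: "integrable lborel (\<lambda>x. w x * \<phi> x)"
      by (rule integrable_mult_of_squares[OF _ _ wi \<phi>i]) auto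
    have "(\<integral>x. (w x - \<phi> x)\<^sup>2 \<partial>lborel) = (\<integral>x. (w x)\<^sup>2 + (\<phi> x)\<^sup>2 - 2 * (w x * \<phi> x) \<partial>lborel)"
      by (simp add: power2_diff mult.assoc)
    also have "\<dots> = (\<integral>x. (w x)\<^sup>2 \<partial>lborel) + (\<integral>x. (\<phi> x)\<^sup>2 \<partial>lborel) - 2 * (\<integral>x. w x * \<phi> x \<partial>lborel)"
      using wi \<phi>i w\<phi> by simp
    finally show "(\<integral>x. (w x)\<^sup>2 \<partial>lborel) \<le> (\<integral>x. (g x)\<^sup>2 \<partial>lborel) + \<epsilon>"
      using dual[OF \<phi>(1)] \<phi>(2) by simp
  qed
  then show ?thesis unfolding w_def g_def .
qed

context square_integrable
begin

text \<open>
  Average the translation estimate against the heat kernel, whose covariance is \<open>2 * t\<close> times the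
  identity: only the diagonal terms $\|\partial_e u\|^2$ survive.
\<close>
lemma deficit_le_gradient:
  assumes G: "\<And>e. e \<in> Basis \<Longrightarrow> G e \<in> borel_measurable borel" "\<And>e. e \<in> Basis \<Longrightarrow> integrable lborel (\<lambda>x. (norm (G e x))\<^sup>2)"
    and weak: "\<And>\<phi> e. test_function \<phi> \<Longrightarrow> e \<in> Basis \<Longrightarrow>
       (\<integral>x. frechet_derivative \<phi> (at x) e *\<^sub>R u x \<partial>lborel) = - (\<integral>x. \<phi> x *\<^sub>R G e x \<partial>lborel)"
    and t: "0 < t"
  shows "deficit t \<le> (\<Sum>e\<in>Basis. \<integral>x. (norm (G e x))\<^sup>2 \<partial>lborel) * t"
proof -
  have comp: "integrable lborel (\<lambda>x. (f x \<bullet> b)\<^sup>2)"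
    if "f \<in> borel_measurable borel" "integrable lborel (\<lambda>x. (norm (f x))\<^sup>2)" "b \<in> Basis" for f :: "'a \<Rightarrow> 'b" and b
    by (rule Bochner_Integration.integrable_bound[OF that(2)])
      (use that in \<open>auto intro!: AE_I2 power_mono Basis_le_norm simp: abs_le_square_iff[symmetric]\<close>)
  have scal: "integrable lborel (\<lambda>x. c x *\<^sub>R f x)"
    if [measurable]: "c \<in> borel_measurable borel" "f \<in> borel_measurable borel" and i: "integrable lborel (\<lambda>x. (c x)\<^sup>2)" "integrable lborel (\<lambda>x. (norm (f x))\<^sup>2)"
    for c :: "'a \<Rightarrow> real" and f :: "'a \<Rightarrow> 'b"
  proof -
    have "integrable lborel (\<lambda>x. c x * norm (f x))"
      by (rule integrable_mult_of_squares) (use i in auto)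
    then show ?thesis by (rule Bochner_Integration.integrable_bound) auto
  qed
  define a where "a e e' = (\<integral>x. G e x \<bullet> G e' x \<partial>lborel)" for e e'
  have GG: "integrable lborel (\<lambda>x. G e x \<bullet> G e' x)" if "e \<in> Basis" "e' \<in> Basis" for e e'
  proof -
    have "integrable lborel (\<lambda>x. norm (G e x) * norm (G e' x))"
      by (rule integrable_mult_of_squares) (use G that in auto)
    then show ?thesis
      by (rule Bochner_Integration.integrable_bound) (use G that in \<open>auto simp: Cauchy_Schwarz_ineq2\<close>)
  qed
  have quad: "2 * (energy - autocorr z) \<le> (\<Sum>e\<in>Basis. \<Sum>e'\<in>Basis. (z \<bullet> e) * (z \<bullet> e') * a e e')" for z
  proof -
    let ?w = "\<lambda>x. u (x + z) - u x" and ?g = "\<lambda>x. \<Sum>e\<in>Basis. (z \<bullet> e) *\<^sub>R G e x"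
    have gm [measurable]: "?g \<in> borel_measurable borel" using G(1) by measurable
    have nrm: "(norm y)\<^sup>2 = (\<Sum>b\<in>Basis. (y \<bullet> b)\<^sup>2)" for y :: 'b
      unfolding power2_norm_eq_inner unfolding euclidean_inner[of y y] power2_eq_square ..
    have w2: "integrable lborel (\<lambda>x. (norm (?w x))\<^sup>2)"
      using nn_integral_diff_square[of z] by (intro integrableI_nonneg) auto
    have g_expand: "(norm (?g x))\<^sup>2 = (\<Sum>e\<in>Basis. \<Sum>e'\<in>Basis. (z \<bullet> e) * (z \<bullet> e') * (G e x \<bullet> G e' x))" for x
      by (simp add: power2_norm_eq_inner inner_sum_left inner_sum_right sum_distrib_left mult_ac inner_commute)
    have g2: "has_bochner_integral lborel (\<lambda>x. (norm (?g x))\<^sup>2) (\<Sum>e\<in>Basis. \<Sum>e'\<in>Basis. (z \<bullet> e) * (z \<bullet> e') * a e e')"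
      unfolding g_expand
      by (intro has_bochner_integral_sum has_bochner_integral_mult_right) (simp add: has_bochner_integral_iff GG a_def)
    have "2 * (energy - autocorr z) = (\<integral>x. (norm (?w x))\<^sup>2 \<partial>lborel)"
      using nn_integral_diff_square[of z] nn_integral_eq_integral[OF w2] abs_autocorr_le[of z]
      by (simp add: abs_le_iff)
    also have "\<dots> = (\<Sum>b\<in>Basis. \<integral>x. (?w x \<bullet> b)\<^sup>2 \<partial>lborel)"
      unfolding nrm by (rule Bochner_Integration.integral_sum) (rule comp[OF _ w2], auto)
    also have "\<dots> \<le> (\<Sum>b\<in>Basis. \<integral>x. (?g x \<bullet> b)\<^sup>2 \<partial>lborel)"
    proof (rule sum_mono)
      fix b :: 'b assume b: "b \<in> Basis"
      have "(\<integral>x. (u (x + z) \<bullet> b - u x \<bullet> b)\<^sup>2 \<partial>lborel) \<le> (\<integral>x. (\<Sum>e\<in>Basis. (z \<bullet> e) * (G e x \<bullet> b))\<^sup>2 \<partial>lborel)"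
      proof (rule weak_derivative_translation)
        show "integrable lborel (\<lambda>x. (u x \<bullet> b)\<^sup>2)" by (rule comp[OF measurable_u integrable_u b])
        show "integrable lborel (\<lambda>x. (G e x \<bullet> b)\<^sup>2)" if "e \<in> Basis" for e by (rule comp[OF G(1)[OF that] G(2)[OF that] b])
        show "(\<lambda>x. G e x \<bullet> b) \<in> borel_measurable borel" if "e \<in> Basis" for e using G(1)[OF that] by measurable
        fix \<phi> :: "'a \<Rightarrow> real" and e :: 'a assume \<phi>: "test_function \<phi>" and e: "e \<in> Basis"
        note c = continuous_bounded_support[OF test_function_derivative(2)[OF \<phi> e] test_function_derivative(3)[OF \<phi>]]
        have i1: "integrable lborel (\<lambda>x. frechet_derivative \<phi> (at x) e *\<^sub>R u x)"
          by (rule scal[OF c(1) measurable_u c(2) integrable_u])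
        have i2: "integrable lborel (\<lambda>x. \<phi> x *\<^sub>R G e x)"
          using test_function_square[OF \<phi>] by (intro scal G e) auto
        have "(\<integral>x. frechet_derivative \<phi> (at x) e * (u x \<bullet> b) \<partial>lborel) = (\<integral>x. (frechet_derivative \<phi> (at x) e *\<^sub>R u x) \<bullet> b \<partial>lborel)" by simp
        also have "\<dots> = (\<integral>x. frechet_derivative \<phi> (at x) e *\<^sub>R u x \<partial>lborel) \<bullet> b" by (rule integral_inner_left[OF i1])
        also have "\<dots> = - ((\<integral>x. \<phi> x *\<^sub>R G e x \<partial>lborel) \<bullet> b)" unfolding weak[OF \<phi> e] by simp
        also have "(\<integral>x. \<phi> x *\<^sub>R G e x \<partial>lborel) \<bullet> b = (\<integral>x. (\<phi> x *\<^sub>R G e x) \<bullet> b \<partial>lborel)" by (rule integral_inner_left[OF i2, symmetric])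
        finally show "(\<integral>x. frechet_derivative \<phi> (at x) e * (u x \<bullet> b) \<partial>lborel) = - (\<integral>x. \<phi> x * (G e x \<bullet> b) \<partial>lborel)" by simp
      qed measurable
      then show "(\<integral>x. (?w x \<bullet> b)\<^sup>2 \<partial>lborel) \<le> (\<integral>x. (?g x \<bullet> b)\<^sup>2 \<partial>lborel)"
        by (simp add: inner_diff_left inner_sum_left)
    qed
    also have "\<dots> = (\<integral>x. (norm (?g x))\<^sup>2 \<partial>lborel)"
      unfolding nrm by (rule Bochner_Integration.integral_sum[symmetric]) (rule comp[OF gm], use g2 in \<open>auto simp: has_bochner_integral_iff\<close>)
    also have "\<dots> = (\<Sum>e\<in>Basis. \<Sum>e'\<in>Basis. (z \<bullet> e) * (z \<bullet> e') * a e e')"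
      using g2 by (simp add: has_bochner_integral_iff)
    finally show ?thesis .
  qed
  have "has_bochner_integral lborel (\<lambda>z::'a. \<Sum>e\<in>Basis. \<Sum>e'\<in>Basis. (heat t z * (z \<bullet> e) * (z \<bullet> e')) * (a e e' / 2))
     (\<Sum>e\<in>(Basis::'a set). \<Sum>e'\<in>Basis. (2 * t * (e \<bullet> e')) * (a e e' / 2))"
    by (intro has_bochner_integral_sum has_bochner_integral_mult_left heat_moment2_Basis t)
  then have H: "has_bochner_integral lborel (\<lambda>z::'a. \<Sum>e\<in>Basis. \<Sum>e'\<in>Basis. (heat t z * (z \<bullet> e) * (z \<bullet> e')) * (a e e' / 2))
     ((\<Sum>e\<in>Basis. a e e) * t)"
  proof -
    have "(\<Sum>e'\<in>Basis. (2 * t * (e \<bullet> e')) * (a e e' / 2)) = a e e * t" if e: "e \<in> Basis" for e :: 'a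
    proof -
      have "(\<Sum>e'\<in>Basis. (2 * t * (e \<bullet> e')) * (a e e' / 2)) = (\<Sum>e'\<in>Basis. if e = e' then a e e * t else 0)"
        using e by (intro sum.cong refl) (auto simp: inner_Basis)
      then show ?thesis using e by simp
    qed
    then have "(\<Sum>e\<in>(Basis::'a set). \<Sum>e'\<in>Basis. (2 * t * (e \<bullet> e')) * (a e e' / 2)) = (\<Sum>e\<in>Basis. a e e) * t"
      by (simp add: sum_distrib_right)
    with \<open>has_bochner_integral _ _ _\<close> show ?thesis by (simp only:)
  qed
  have "deficit t \<le> (\<integral>z. (\<Sum>e\<in>Basis. \<Sum>e'\<in>Basis. (heat t z * (z \<bullet> e) * (z \<bullet> e')) * (a e e' / 2)) \<partial>lborel)"
    unfolding deficit_def
  proof (rule integral_mono')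
    show "integrable lborel (\<lambda>z::'a. \<Sum>e\<in>Basis. \<Sum>e'\<in>Basis. (heat t z * (z \<bullet> e) * (z \<bullet> e')) * (a e e' / 2))"
      using H by (simp add: has_bochner_integral_iff)
    fix z :: 'a
    have "heat t z * (energy - autocorr z) \<le> heat t z * ((\<Sum>e\<in>Basis. \<Sum>e'\<in>Basis. (z \<bullet> e) * (z \<bullet> e') * a e e') / 2)"
      using quad[of z] by (intro mult_left_mono) auto
    also have "\<dots> = (\<Sum>e\<in>Basis. \<Sum>e'\<in>Basis. (heat t z * (z \<bullet> e) * (z \<bullet> e')) * (a e e' / 2))"
      by (simp add: sum_distrib_left sum_divide_distrib mult_ac)
    finally show *: "heat t z * (energy - autocorr z) \<le> (\<Sum>e\<in>Basis. \<Sum>e'\<in>Basis. (heat t z * (z \<bullet> e) * (z \<bullet> e')) * (a e e' / 2))" .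
    have "0 \<le> heat t z * (energy - autocorr z)"
      using abs_autocorr_le[of z] by (simp add: abs_le_iff)
    with * show "0 \<le> (\<Sum>e\<in>Basis. \<Sum>e'\<in>Basis. (heat t z * (z \<bullet> e) * (z \<bullet> e')) * (a e e' / 2))" by linarith
  qed
  also have "\<dots> = (\<Sum>e\<in>Basis. a e e) * t"
    using H by (simp add: has_bochner_integral_iff)
  also have "(\<Sum>e\<in>Basis. a e e) = (\<Sum>e\<in>Basis. \<integral>x. (norm (G e x))\<^sup>2 \<partial>lborel)"
    by (simp add: a_def power2_norm_eq_inner)
  finally show ?thesis .
qed

end

section \<open>Comparison of the normalising constants\<close>

lemma Gamma_log_convex:
  fixes x y \<theta> :: real
  assumes "0 < x" "0 < y" "0 \<le> \<theta>" "\<theta> \<le> 1"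
  shows "Gamma (\<theta> * x + (1 - \<theta>) * y) \<le> Gamma x powr \<theta> * Gamma y powr (1 - \<theta>)"
proof -
  have pos: "0 < \<theta> * x + (1 - \<theta>) * y"
    using assms by (cases "\<theta> = 0") (auto intro!: add_pos_nonneg)
  have "ln (Gamma ((1 - \<theta>) *\<^sub>R y + \<theta> *\<^sub>R x)) \<le> (1 - \<theta>) * ln (Gamma y) + \<theta> * ln (Gamma x)"
    using convex_onD[OF log_convex_Gamma_real, of \<theta> y x] assms by simp
  then have "ln (Gamma (\<theta> * x + (1 - \<theta>) * y)) \<le> ln (Gamma x powr \<theta> * Gamma y powr (1 - \<theta>))"
    using assms by (simp add: ln_mult ln_powr add.commute Gamma_real_pos less_imp_neq[symmetric])
  moreover have "0 < Gamma x powr \<theta> * Gamma y powr (1 - \<theta>)"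
    using Gamma_real_pos[OF assms(1)] Gamma_real_pos[OF assms(2)] by simp
  ultimately show ?thesis
    using Gamma_real_pos[OF pos] by (simp only: ln_le_cancel_iff)
qed

text \<open>
  Log-convexity gives $\Gamma(a+h) \le a^h\,\Gamma(a)$ and
  $a\,\Gamma(a) \le \Gamma(a+t)\,(a+t)^{1-t}$ with \<open>t = \<theta> * h\<close>.  The quotient is at most
  $(1 + t/a)^{1-t} \le 1 + 2t(1-t) < 2$.
\<close>
lemma Gamma_interpolation_le:
  fixes a h \<theta> :: real
  assumes a: "1 / 2 \<le> a" and h: "0 \<le> h" "h \<le> 1" and \<theta>: "0 \<le> \<theta>" "\<theta> \<le> 1"
  shows "Gamma (a + h) powr \<theta> * Gamma a powr (1 - \<theta>) \<le> 2 * Gamma (a + \<theta> * h)"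
proof -
  define t where "t = \<theta> * h"
  have t: "0 \<le> t" "t \<le> 1" using h \<theta> by (auto simp: t_def mult_le_one)
  have a0: "0 < a" and at: "0 < a + t" using a t by auto
  have Ga: "0 < Gamma a" and Gat: "0 < Gamma (a + t)" using a0 at by simp_all
  have G1: "Gamma (x + 1) = x * Gamma x" if "0 < x" for x :: real
    using Gamma_plus1[of x] that by (simp add: not_nonpos_Ints_pos)
  have "Gamma (a + h) = Gamma (h * (a + 1) + (1 - h) * a)" by (simp add: algebra_simps)
  also have "\<dots> \<le> Gamma (a + 1) powr h * Gamma a powr (1 - h)"
    using a0 h by (intro Gamma_log_convex) auto
  also have "\<dots> = a powr h * (Gamma a powr h * Gamma a powr (1 - h))"
    using a0 by (simp add: G1 powr_mult)
  also have "\<dots> = a powr h * Gamma a" unfolding powr_add[symmetric] using Ga by simp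
  finally have "Gamma (a + h) powr \<theta> \<le> (a powr h * Gamma a) powr \<theta>"
    using a0 h \<theta> by (intro powr_mono2) auto
  also have "\<dots> = a powr t * Gamma a powr \<theta>"
    using Ga by (simp add: powr_mult powr_powr t_def mult.commute)
  finally have "Gamma (a + h) powr \<theta> * Gamma a powr (1 - \<theta>) \<le> a powr t * Gamma a powr \<theta> * Gamma a powr (1 - \<theta>)"
    by (rule mult_right_mono) simp
  also have "\<dots> = a powr t * (Gamma a powr \<theta> * Gamma a powr (1 - \<theta>))" by simp
  also have "\<dots> = a powr t * Gamma a" unfolding powr_add[symmetric] using Ga by simp
  finally have 1: "Gamma (a + h) powr \<theta> * Gamma a powr (1 - \<theta>) \<le> a powr t * Gamma a" .
  have "a * Gamma a = Gamma (t * (a + t) + (1 - t) * (a + t + 1))"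
    using G1[OF a0] by (simp add: algebra_simps)
  also have "\<dots> \<le> Gamma (a + t) powr t * Gamma (a + t + 1) powr (1 - t)"
    using at t by (intro Gamma_log_convex) auto
  also have "\<dots> = (Gamma (a + t) powr t * Gamma (a + t) powr (1 - t)) * (a + t) powr (1 - t)"
    using at Gat by (simp add: G1 powr_mult)
  also have "\<dots> = Gamma (a + t) * (a + t) powr (1 - t)" unfolding powr_add[symmetric] using Gat by simp
  finally have 2: "a * Gamma a \<le> Gamma (a + t) * (a + t) powr (1 - t)" .
  have "(a + t) powr (1 - t) \<le> 2 * a powr (1 - t)"
  proof -
    have "((a + t) / a) powr (1 - t) \<le> 2"
    proof (cases "t = 0 \<or> t = 1")
      case True
      then show ?thesis using a0 by auto
    next
      case False
      then have t': "0 < t" "t < 1" using t by auto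
      have "((a + t) / a) powr (1 - t) * 1 powr t \<le> (1 - t) * ((a + t) / a) + t * 1"
        using t' a0 at by (intro Youngs_inequality_0) auto
      also have "\<dots> = 1 + (1 - t) * t / a" using a0 by (simp add: field_simps)
      also have "(1 - t) * t / a \<le> (1 - t) * t / (1 / 2)"
        using t' a by (intro divide_left_mono) auto
      also have "(1 - t) * t / (1 / 2) \<le> 1"
      proof -
        have "0 \<le> (t - 1 / 2)\<^sup>2" by simp
        then show ?thesis by (simp add: power2_eq_square algebra_simps)
      qed
      finally show ?thesis by simp
    qed
    then show ?thesis using a0 at by (simp add: powr_divide divide_le_eq)
  qed
  then have "a * Gamma a \<le> Gamma (a + t) * (2 * a powr (1 - t))"
    using 2 Gat by (meson less_imp_le mult_left_mono order_trans)
  then have "a powr (t - 1) * (a * Gamma a) \<le> a powr (t - 1) * (Gamma (a + t) * (2 * a powr (1 - t)))"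
    by (intro mult_left_mono) auto
  also have "\<dots> = (a powr (t - 1) * a powr (1 - t)) * (2 * Gamma (a + t))" by (simp add: mult_ac)
  also have "\<dots> = 2 * Gamma (a + t)" unfolding powr_add[symmetric] using a0 by simp
  also have "a powr (t - 1) * (a * Gamma a) = (a powr (t - 1) * a powr 1) * Gamma a" using a0 by simp
  also have "\<dots> = a powr t * Gamma a" unfolding powr_add[symmetric] by simp
  finally show ?thesis using 1 unfolding t_def by linarith
qed

text \<open>
  One formula covers the endpoints, since $\Gamma(2) = \Gamma(1) = 1$ and
  $\Gamma(d/2 + 1) = (d/2)\,\Gamma(d/2)$.
\<close>
lemma B_const_eq:
  assumes "0 < d" "0 \<le> s" "s \<le> 1"
  shows "B_const d s = 2 powr (2 * s - 1) * Gamma (real d / 2 + s) / (pi powr (real d / 2) * Gamma (2 - s))"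
proof -
  consider "s = 0" | "s = 1" | "0 < s" "s < 1" using assms by linarith
  then show ?thesis
  proof cases
    case 1
    have "Gamma (2::real) = 1" using Gamma_fact[of 1, where 'a=real] by simp
    then show ?thesis using 1 by (simp add: B_const_def sphere_area_def powr_minus field_simps)
  next
    case 2
    have "Gamma (real d / 2 + 1) = real d / 2 * Gamma (real d / 2)"
      using Gamma_plus1[of "real d / 2"] assms by (simp add: not_nonpos_Ints_pos)
    then show ?thesis using 2 by (simp add: B_const_def sphere_area_def)
  next
    case 3
    have p: "(2::real) powr (2 * s - 1) = 2 powr (2 * s) / 2" by (simp add: powr_diff)
    have e: "(real d + 2 * s) / 2 = real d / 2 + s" by simp
    have cancel: "s * k * P * G / D / (2 * s * k) = P / 2 * G / D" if "k \<noteq> 0" for k P G D :: real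
      using that 3 by simp
    have "B_const d s = C_const d s / (2 * s * (1 - s))" using 3 by (simp add: B_const_def)
    also have "\<dots> = 2 powr (2 * s) / 2 * Gamma (real d / 2 + s) / (pi powr (real d / 2) * Gamma (2 - s))"
      unfolding C_const_def e by (rule cancel) (use 3 in simp)
    finally show ?thesis unfolding p .
  qed
qed

lemma B_const_pos: "0 < d \<Longrightarrow> 0 \<le> s \<Longrightarrow> s \<le> 1 \<Longrightarrow> 0 < B_const d s"
  by (subst B_const_eq) (auto intro!: divide_pos_pos mult_pos_pos Gamma_real_pos add_pos_nonneg)

text \<open>
  The powers of 2 and of $\pi$ interpolate exactly and cancel.  The factor with \<open>2 - s\<close> is at most 1 by
  log-convexity of the Gamma function; the other is at most 2.
\<close>
lemma B_const_interpolation_le: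
  assumes d: "0 < d" and \<sigma>: "0 \<le> \<sigma>" "\<sigma> \<le> s" "s \<le> 1" and \<theta>: "0 \<le> \<theta>" "\<theta> \<le> 1"
  shows "B_const d s powr \<theta> * B_const d \<sigma> powr (1 - \<theta>) / B_const d (\<theta> * s + (1 - \<theta>) * \<sigma>) \<le> 2"
proof -
  define \<eta> where "\<eta> = \<theta> * s + (1 - \<theta>) * \<sigma>"
  have \<eta>: "\<sigma> \<le> \<eta>" "\<eta> \<le> s"
  proof -
    have e: "\<eta> - \<sigma> = \<theta> * (s - \<sigma>)" "s - \<eta> = (1 - \<theta>) * (s - \<sigma>)" by (simp_all add: \<eta>_def algebra_simps)
    have "0 \<le> \<eta> - \<sigma>" unfolding e(1) using \<sigma> \<theta> by simp
    then show "\<sigma> \<le> \<eta>" by simp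
    have "0 \<le> s - \<eta>" unfolding e(2) using \<sigma> \<theta> by simp
    then show "\<eta> \<le> s" by simp
  qed
  let ?g = "\<lambda>x. Gamma (real d / 2 + x)" and ?p = "pi powr (real d / 2)" and ?q = "\<lambda>x. Gamma (2 - x)"
  let ?e = "\<lambda>x. 2 powr (2 * x - 1) :: real"
  have gp: "0 < ?g x" "0 < ?q x" if "0 \<le> x" "x \<le> 1" for x using that d by (simp_all add: Gamma_real_pos add_pos_nonneg)
  have B: "B_const d x = ?e x * ?g x / (?p * ?q x)" if "0 \<le> x" "x \<le> 1" for x
    using B_const_eq[OF d that] .
  have s: "0 \<le> s" "\<sigma> \<le> 1" "0 \<le> \<eta>" "\<eta> \<le> 1" using \<sigma> \<eta> by auto
  have e: "?e s powr \<theta> * ?e \<sigma> powr (1 - \<theta>) = ?e \<eta>"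
    unfolding powr_powr powr_add[symmetric] by (rule arg_cong[where f = "\<lambda>x. 2 powr x"]) (simp add: \<eta>_def algebra_simps)
  have p: "?p powr \<theta> * ?p powr (1 - \<theta>) = ?p" unfolding powr_add[symmetric] by simp
  have num: "?g s powr \<theta> * ?g \<sigma> powr (1 - \<theta>) \<le> 2 * ?g \<eta>"
  proof -
    have eq: "real d / 2 + \<sigma> + (s - \<sigma>) = real d / 2 + s" "real d / 2 + \<sigma> + \<theta> * (s - \<sigma>) = real d / 2 + \<eta>"
      by (simp_all add: \<eta>_def algebra_simps)
    have "1 / 2 \<le> real d / 2 + \<sigma>" using d \<sigma> by (simp add: add_increasing2)
    from Gamma_interpolation_le[OF this, of "s - \<sigma>" \<theta>] show ?thesis
      using \<sigma> \<theta> unfolding eq by simp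
  qed
  have den: "?q \<eta> \<le> ?q s powr \<theta> * ?q \<sigma> powr (1 - \<theta>)"
  proof -
    have "2 - \<eta> = \<theta> * (2 - s) + (1 - \<theta>) * (2 - \<sigma>)" by (simp add: \<eta>_def algebra_simps)
    then show ?thesis using Gamma_log_convex[of "2 - s" "2 - \<sigma>" \<theta>] \<sigma> \<theta> by simp
  qed
  have "B_const d s powr \<theta> * B_const d \<sigma> powr (1 - \<theta>) =
    (?e s powr \<theta> * ?e \<sigma> powr (1 - \<theta>)) * (?g s powr \<theta> * ?g \<sigma> powr (1 - \<theta>)) / ((?p powr \<theta> * ?p powr (1 - \<theta>)) * (?q s powr \<theta> * ?q \<sigma> powr (1 - \<theta>)))"
  proof -
    have "a * g / (p * q) * (a' * g' / (p' * q')) = (a * a') * (g * g') / ((p * p') * (q * q'))" for a g p q a' g' p' q' :: real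
      by (simp add: mult_ac)
    then show ?thesis unfolding B[OF s(1) \<sigma>(3)] B[OF \<sigma>(1) s(2)] powr_divide powr_mult .
  qed
  also have "\<dots> = ?e \<eta> * (?g s powr \<theta> * ?g \<sigma> powr (1 - \<theta>)) / (?p * (?q s powr \<theta> * ?q \<sigma> powr (1 - \<theta>)))"
    unfolding e p ..
  also have "\<dots> \<le> ?e \<eta> * (2 * ?g \<eta>) / (?p * ?q \<eta>)"
    using gp[OF s(3,4)] num den by (intro frac_le mult_left_mono mult_pos_pos) auto
  also have "\<dots> = 2 * B_const d \<eta>" unfolding B[OF s(3,4)] by simp
  finally show ?thesis
    using B_const_pos[OF d s(3,4)] unfolding \<eta>_def[symmetric] by (simp add: divide_le_eq)
qed

section \<open>The interpolation inequalities\<close>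

lemma lebesgue_ex_borel:
  fixes u :: "'a::euclidean_space \<Rightarrow> 'b::euclidean_space"
  assumes "u \<in> borel_measurable lebesgue"
  obtains u' where "u' \<in> borel_measurable borel" "AE x in lborel. u x = u' x"
proof -
  have "\<exists>f. f \<in> borel_measurable lborel \<and> (AE x in lborel. u x \<bullet> b = f x)" for b
  proof -
    have "(\<lambda>x. u x \<bullet> b) \<in> borel_measurable lebesgue" using assms by (intro borel_measurable_inner) auto
    then show ?thesis using completion_ex_borel_measurable_real by blast
  qed
  then obtain f where f: "\<And>b. f b \<in> borel_measurable lborel" "\<And>b. AE x in lborel. u x \<bullet> b = f b x" by metis
  show ?thesis
  proof
    show "(\<lambda>x. \<Sum>b\<in>Basis. f b x *\<^sub>R b) \<in> borel_measurable borel"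
      using f(1) by (intro borel_measurable_sum borel_measurable_scaleR) auto
    have "AE x in lborel. \<forall>b\<in>Basis. u x \<bullet> b = f b x" using f(2) by (intro AE_finite_allI) auto
    then show "AE x in lborel. u x = (\<Sum>b\<in>Basis. f b x *\<^sub>R b)"
      by eventually_elim (metis (mono_tags, lifting) euclidean_representation sum.cong)
  qed
qed

lemma L2_ex_borel:
  fixes u :: "'a::euclidean_space \<Rightarrow> 'b::euclidean_space"
  assumes "u \<in> L2"
  obtains u' where "square_integrable u'" "AE x in lborel. u x = u' x"
    "(\<integral>x. (norm (u x))\<^sup>2 \<partial>lebesgue) = (\<integral>x. (norm (u' x))\<^sup>2 \<partial>lborel)"
proof -
  have u: "u \<in> borel_measurable lebesgue" "integrable lebesgue (\<lambda>x. (norm (u x))\<^sup>2)" using assms by (auto simp: L2_def)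
  obtain u' where u': "u' \<in> borel_measurable borel" "AE x in lborel. u x = u' x" using lebesgue_ex_borel[OF u(1)] by blast
  have m: "u' \<in> borel_measurable lebesgue" using u'(1) by (intro measurable_completion) simp
  have ae: "AE x in lebesgue. u x = u' x" using u'(2) by (rule AE_completion)
  have "integrable lebesgue (\<lambda>x. (norm (u' x))\<^sup>2)"
    by (rule integrable_cong_AE_imp[OF u(2)]) (use m ae in auto)
  then have i: "integrable lborel (\<lambda>x. (norm (u' x))\<^sup>2)"
    using u'(1) by (simp add: integrable_completion)
  have "(\<integral>x. (norm (u x))\<^sup>2 \<partial>lebesgue) = (\<integral>x. (norm (u' x))\<^sup>2 \<partial>lebesgue)"
    by (rule integral_cong_AE) (use m u(1) ae in auto)
  also have "\<dots> = (\<integral>x. (norm (u' x))\<^sup>2 \<partial>lborel)"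
    using u'(1) by (intro integral_completion) auto
  finally show ?thesis using that[of u'] u' i by (simp add: square_integrable_def)
qed

lemma gagliardo_integral_cong_AE:
  assumes "AE x in lborel. u x = u' x"
  shows "gagliardo_integral s u = gagliardo_integral s u'"
  unfolding gagliardo_integral_def nn_integral_completion
proof (rule nn_integral_cong_AE, use assms in eventually_elim)
  case (elim x)
  show ?case by (rule nn_integral_cong_AE, use assms in eventually_elim) (use elim in simp)
qed

text \<open>
  A function with a Borel representative \<open>u'\<close>; seminorms are stated for \<open>u\<close> and computed with \<open>u'\<close>.
\<close>
locale L2_function =
  square_integrable u' for u u' :: "'a::euclidean_space \<Rightarrow> 'b::euclidean_space" +
  assumes u_L2: "u \<in> L2" and ae_eq: "AE x in lborel. u x = u' x"
    and norm_eq: "(\<integral>x. (norm (u x))\<^sup>2 \<partial>lebesgue) = (\<integral>x. (norm (u' x))\<^sup>2 \<partial>lborel)"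
begin

lemma gagliardo_u: "gagliardo_integral s u = gagliardo s"
  using gagliardo_integral_cong_AE[OF ae_eq] gagliardo_integral_eq by simp

lemma L2_norm_u: "L2_norm u = sqrt energy"
  by (simp add: L2_norm_def energy_def norm_eq)

lemma deficit_le_L2_norm_grad:
  assumes "in_H 1 u" "0 < t"
  shows "deficit t \<le> (L2_norm_grad u)\<^sup>2 * t"
proof -
  have wg: "has_L2_weak_grad u (weak_grad u)"
    using assms(1) unfolding in_H_def weak_grad_def by (metis someI_ex zero_neq_one)
  then have G: "weak_grad u e \<in> L2" "has_weak_partial u e (weak_grad u e)" if "e \<in> Basis" for e
    using that by (auto simp: has_L2_weak_grad_def)
  have "\<exists>G'. e \<in> Basis \<longrightarrow> square_integrable G' \<and> (AE x in lborel. weak_grad u e x = G' x) \<and>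
     (\<integral>x. (norm (weak_grad u e x))\<^sup>2 \<partial>lebesgue) = (\<integral>x. (norm (G' x))\<^sup>2 \<partial>lborel)" for e
  proof (cases "e \<in> Basis")
    case True
    from L2_ex_borel[OF G(1)[OF this]] show ?thesis by blast
  qed simp
  then have "\<forall>e. \<exists>G'. e \<in> Basis \<longrightarrow> square_integrable G' \<and> (AE x in lborel. weak_grad u e x = G' x) \<and>
     (\<integral>x. (norm (weak_grad u e x))\<^sup>2 \<partial>lebesgue) = (\<integral>x. (norm (G' x))\<^sup>2 \<partial>lborel)" ..
  from choice[OF this] obtain G' where G'_all: "\<forall>e. e \<in> Basis \<longrightarrow> square_integrable (G' e) \<and> (AE x in lborel. weak_grad u e x = G' e x) \<and>
     (\<integral>x. (norm (weak_grad u e x))\<^sup>2 \<partial>lebesgue) = (\<integral>x. (norm (G' e x))\<^sup>2 \<partial>lborel)" ..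
  then have G': "square_integrable (G' e)" "AE x in lborel. weak_grad u e x = G' e x"
    "(\<integral>x. (norm (weak_grad u e x))\<^sup>2 \<partial>lebesgue) = (\<integral>x. (norm (G' e x))\<^sup>2 \<partial>lborel)" if "e \<in> Basis" for e
    using that by simp_all
  have G'm: "G' e \<in> borel_measurable borel" if "e \<in> Basis" for e
    using G'(1)[OF that] by (simp add: square_integrable_def)
  have leb: "(\<integral>x. c x *\<^sub>R f x \<partial>lebesgue) = (\<integral>x. c x *\<^sub>R f' x \<partial>lborel)"
    if "c \<in> borel_measurable borel" "f \<in> L2" "f' \<in> borel_measurable borel" "AE x in lborel. f x = f' x"
    for c and f f' :: "'a \<Rightarrow> 'b"
  proof -
    have cm: "c \<in> borel_measurable lebesgue" and fm': "f' \<in> borel_measurable lebesgue" and fm: "f \<in> borel_measurable lebesgue"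
      using that by (auto simp: L2_def intro!: measurable_completion)
    have "(\<integral>x. c x *\<^sub>R f x \<partial>lebesgue) = (\<integral>x. c x *\<^sub>R f' x \<partial>lebesgue)"
      by (rule integral_cong_AE) (use cm fm fm' AE_completion[OF that(4)] in auto)
    also have "\<dots> = (\<integral>x. c x *\<^sub>R f' x \<partial>lborel)"
      using that by (intro integral_completion) auto
    finally show ?thesis .
  qed
  have "deficit t \<le> (\<Sum>e\<in>Basis. \<integral>x. (norm (G' e x))\<^sup>2 \<partial>lborel) * t"
  proof (rule deficit_le_gradient[OF _ _ _ assms(2)])
    fix e :: 'a assume e: "e \<in> Basis"
    show "G' e \<in> borel_measurable borel" by (rule G'm[OF e])
    show "integrable lborel (\<lambda>x. (norm (G' e x))\<^sup>2)" using G'(1)[OF e] by (simp add: square_integrable_def)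
    fix \<phi> :: "'a \<Rightarrow> real" assume \<phi>: "test_function \<phi>"
    note dm = continuous_bounded_support(1)[OF test_function_derivative(2)[OF \<phi> e] test_function_derivative(3)[OF \<phi>]]
    show "(\<integral>x. frechet_derivative \<phi> (at x) e *\<^sub>R u' x \<partial>lborel) = - (\<integral>x. \<phi> x *\<^sub>R G' e x \<partial>lborel)"
      using G(2)[OF e] \<phi> leb[OF dm u_L2 measurable_u ae_eq]
        leb[OF test_function_borel[OF \<phi>] G(1)[OF e] G'm[OF e] G'(2)[OF e]]
      by (simp add: has_weak_partial_def)
  qed
  also have "(\<Sum>e\<in>Basis. \<integral>x. (norm (G' e x))\<^sup>2 \<partial>lborel) = (\<integral>x. (\<Sum>e\<in>Basis. (norm (weak_grad u e x))\<^sup>2) \<partial>lebesgue)"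
    using G(1) by (subst Bochner_Integration.integral_sum) (auto simp: L2_def G'(3))
  also have "\<dots> = (L2_norm_grad u)\<^sup>2"
    unfolding L2_norm_grad_def by (simp add: sum_nonneg)
  finally show ?thesis .
qed

text \<open>
  Here the product in the interpolation inequality may be \<open>0 * \<infinity>\<close>, which is 0; so it has to be shown
  that a vanishing seminorm of any order forces those of fractional order to vanish.
\<close>
lemma star_zero_imp_gagliardo_zero:
  assumes "0 \<le> \<gamma>" "\<gamma> \<le> 1" "H_seminorm_star \<gamma> u = 0" "0 < \<eta>"
  shows "gagliardo \<eta> = 0"
proof -
  have H: "in_H \<gamma> u" using assms(3) by (auto simp: H_seminorm_star_def split: if_splits)
  consider "\<gamma> = 0" | "\<gamma> = 1" | "0 < \<gamma>" "\<gamma> < 1" using assms by linarith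
  then show ?thesis
  proof cases
    case 1
    then have "energy = 0"
      using H assms(3) energy_nonneg by (auto simp: H_seminorm_star_def L2_norm_u ennreal_eq_0_iff)
    moreover have "autocorr h = 0" for h using abs_autocorr_le[of h] \<open>energy = 0\<close> by simp
    ultimately show ?thesis by (simp add: gagliardo_def)
  next
    case 2
    have "0 \<le> L2_norm_grad u"
      by (auto simp: L2_norm_grad_def intro!: Bochner_Integration.integral_nonneg sum_nonneg)
    then have "L2_norm_grad u = 0" using H assms(3) 2 by (auto simp: H_seminorm_star_def ennreal_eq_0_iff)
    then have "deficit t = 0" if "0 < t" for t
      using deficit_le_L2_norm_grad[of t] deficit_nonneg[of t] H 2 that by simp
    then have *: "ennreal (deficit t * t powr (- 1 - \<eta>)) * indicator {0<..} t = 0" for t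
      by (auto simp: indicator_def)
    have "ennreal (subordination_const DIM('a) \<eta> / 2) * gagliardo \<eta> = 0"
      unfolding gagliardo_eq_deficit[OF assms(4), symmetric] by (simp only: *) simp
    moreover have "0 < subordination_const DIM('a) \<eta>"
      using assms(4) by (auto simp: subordination_const_def intro!: divide_pos_pos mult_pos_pos Gamma_real_pos add_nonneg_pos)
    ultimately show ?thesis by (auto simp: ennreal_eq_0_iff)
  next
    case 3
    have C: "0 < C_const DIM('a) \<gamma>"
      using 3 by (auto simp: C_const_def intro!: divide_pos_pos mult_pos_pos Gamma_real_pos)
    have fin: "gagliardo \<gamma> < \<infinity>" using H 3 by (simp add: in_H_def gagliardo_u)
    have "sqrt (C_const DIM('a) \<gamma> / 2 * enn2real (gagliardo \<gamma>)) \<le> 0"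
      using assms(3) H 3 by (simp add: H_seminorm_star_def gagliardo_u ennreal_eq_0_iff)
    then have "C_const DIM('a) \<gamma> / 2 * enn2real (gagliardo \<gamma>) \<le> 0" by simp
    then have "enn2real (gagliardo \<gamma>) = 0"
      using C by (simp add: mult_le_0_iff antisym)
    then have "gagliardo \<gamma> = 0" using fin by (auto simp: enn2real_eq_0_iff)
    then have "AE h in lborel. ennreal (2 * (energy - autocorr h) / norm h powr (real DIM('a) + 2 * \<gamma>)) = 0"
      unfolding gagliardo_def by (subst (asm) nn_integral_0_iff_AE) auto
    then have "AE h in lborel. ennreal (2 * (energy - autocorr h) / norm h powr (real DIM('a) + 2 * \<eta>)) = 0"
    proof eventually_elim
      case (elim h)
      show ?case
      proof (cases "h = 0")
        case False
        then have "energy - autocorr h \<le> 0" using elim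
          by (auto simp: ennreal_eq_0_iff divide_le_0_iff)
        then show ?thesis by (auto simp: ennreal_eq_0_iff intro!: divide_nonpos_nonneg)
      qed simp
    qed
    then show ?thesis unfolding gagliardo_def by (subst nn_integral_0_iff_AE) auto
  qed
qed

text \<open>
  All seminorms are square roots of \<open>spectral\<close>, except that the endpoint of order 0 is only bounded below by
  \<open>spectral 0\<close>, and the endpoint of order 1 is reached as a limit; both enter on the larger side only.
\<close>
lemma star_finite:
  assumes \<sigma>: "0 \<le> \<sigma>" "\<sigma> < \<eta>" "\<eta> < s" "s \<le> 1" and \<theta>: "0 < \<theta>" "\<theta> < 1" "\<eta> = \<theta> * s + (1 - \<theta>) * \<sigma>"
    and H: "in_H s u" "in_H \<sigma> u"
  shows "H_seminorm_star \<eta> u \<le> ennreal_powr (H_seminorm_star s u) \<theta> * ennreal_powr (H_seminorm_star \<sigma> u) (1 - \<theta>)"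
proof -
  define p where "p = (if s = 1 then L2_norm_grad u else sqrt (spectral s))"
  define q where "q = (if \<sigma> = 0 then sqrt energy else sqrt (spectral \<sigma>))"
  have \<eta>: "0 < \<eta>" "\<eta> < 1" using \<sigma> by auto
  have grad0: "0 \<le> L2_norm_grad u"
    by (auto simp: L2_norm_grad_def intro!: Bochner_Integration.integral_nonneg sum_nonneg)
  have v: deficit_vanishes
  proof (cases "s = 1")
    case True
    then show ?thesis
      using deficit_le_L2_norm_grad H(1) by (intro deficit_vanishesI[of 1 "(L2_norm_grad u)\<^sup>2"]) auto
  next
    case False
    then show ?thesis using H(1) \<sigma> by (intro gagliardo_finite_imp_vanishes[of s]) (auto simp: in_H_def gagliardo_u)
  qed
  have star_eq: "H_seminorm_star \<gamma> u = ennreal (sqrt (spectral \<gamma>))" if "in_H \<gamma> u" "0 < \<gamma>" "\<gamma> < 1" for \<gamma>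
    unfolding spectral_eq_gagliardo(1)[OF v that(2,3)] using that by (simp add: H_seminorm_star_def gagliardo_u)
  have p_eq: "H_seminorm_star s u = ennreal p"
    using H(1) \<sigma> star_eq[of s] by (auto simp: p_def H_seminorm_star_def)
  have q_eq: "H_seminorm_star \<sigma> u = ennreal q"
    using H(2) \<sigma> star_eq[of \<sigma>] by (auto simp: q_def H_seminorm_star_def L2_norm_u)
  have p0: "0 \<le> p" using grad0 \<sigma> spectral_nonneg[of s] by (auto simp: p_def)
  have q0: "0 \<le> q" using energy_nonneg \<sigma> spectral_nonneg[of \<sigma>] by (auto simp: q_def)
  have m\<sigma>: "moment (1 - \<sigma>) < \<infinity>"
    using spectral_zero_le(1) H(2) \<sigma> spectral_eq_gagliardo(2)[OF v, of \<sigma>] by (cases "\<sigma> = 0") (auto simp: in_H_def gagliardo_u)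
  have q2: "spectral \<sigma> \<le> q\<^sup>2" using spectral_zero_le(2) energy_nonneg \<sigma> spectral_nonneg[of \<sigma>] by (auto simp: q_def)
  have main: "spectral \<eta> \<le> (p\<^sup>2) powr \<theta> * (spectral \<sigma>) powr (1 - \<theta>)" and m\<eta>: "moment (1 - \<eta>) < \<infinity>"
  proof -
    show "spectral \<eta> \<le> (p\<^sup>2) powr \<theta> * (spectral \<sigma>) powr (1 - \<theta>)"
    proof (cases "s = 1")
      case True
      then show ?thesis
        using spectral_interpolation_one[of "(L2_norm_grad u)\<^sup>2" \<sigma> \<theta>] deficit_le_L2_norm_grad H(1) \<sigma> m\<sigma> \<theta>
        by (simp add: p_def)
    next
      case False
      then have "moment (1 - s) < \<infinity>"
        using H(1) \<sigma> spectral_eq_gagliardo(2)[OF v, of s] by (auto simp: in_H_def gagliardo_u)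
      then show ?thesis
        using spectral_interpolation[of \<sigma> s \<theta>] False \<sigma> m\<sigma> \<theta> spectral_nonneg[of s] by (simp add: p_def)
    qed
    show "moment (1 - \<eta>) < \<infinity>"
    proof (cases "s = 1")
      case True
      then show ?thesis
        using spectral_near_one(1)[of "(L2_norm_grad u)\<^sup>2" \<eta>] deficit_le_L2_norm_grad H(1) \<eta> by simp
    next
      case False
      then have "moment (1 - s) < \<infinity>"
        using H(1) \<sigma> spectral_eq_gagliardo(2)[OF v, of s] by (auto simp: in_H_def gagliardo_u)
      then show ?thesis using moment_between(1)[of \<eta> \<sigma> s] m\<sigma> \<sigma> by auto
    qed
  qed
  have "in_H \<eta> u"
    using m\<eta> spectral_eq_gagliardo(2)[OF v \<eta>] \<eta> u_L2 by (simp add: in_H_def gagliardo_u)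
  then have "H_seminorm_star \<eta> u = ennreal (sqrt (spectral \<eta>))" by (rule star_eq[OF _ \<eta>])
  also have "\<dots> \<le> ennreal (p powr \<theta> * q powr (1 - \<theta>))"
  proof (intro ennreal_leI real_le_lsqrt)
    \<comment> \<open>The interpolation inequality for squared seminorms is the square of the one to be proved.\<close>
    have sq: "(x\<^sup>2) powr t = (x powr t)\<^sup>2" if "0 \<le> x" for x t :: real
      by (cases "x = 0") (use that in \<open>auto simp: power2_eq_square powr_mult\<close>)
    have "spectral \<eta> \<le> (p\<^sup>2) powr \<theta> * (q\<^sup>2) powr (1 - \<theta>)"
    proof (rule order_trans[OF main], rule mult_left_mono)
      show "spectral \<sigma> powr (1 - \<theta>) \<le> (q\<^sup>2) powr (1 - \<theta>)"
        using q2 spectral_nonneg[of \<sigma>] \<sigma> \<theta> by (intro powr_mono2) auto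
    qed simp
    also have "\<dots> = (p powr \<theta> * q powr (1 - \<theta>))\<^sup>2"
      using p0 q0 by (simp add: sq power_mult_distrib)
    finally show "spectral \<eta> \<le> (p powr \<theta> * q powr (1 - \<theta>))\<^sup>2" .
  qed (use spectral_nonneg \<eta> in auto)
  also have "\<dots> = ennreal_powr (H_seminorm_star s u) \<theta> * ennreal_powr (H_seminorm_star \<sigma> u) (1 - \<theta>)"
    unfolding p_eq q_eq ennreal_powr_def using p0 q0 by (simp add: ennreal_mult)
  finally show ?thesis .
qed

lemma ennreal_powr_nonzero: "x \<noteq> 0 \<Longrightarrow> ennreal_powr x a \<noteq> 0"
  by (cases x) (auto simp: ennreal_powr_def)

lemma star_interpolation:
  assumes \<sigma>: "0 \<le> \<sigma>" "\<sigma> < \<eta>" "\<eta> < s" "s \<le> 1" and \<theta>: "0 < \<theta>" "\<theta> < 1" "\<eta> = \<theta> * s + (1 - \<theta>) * \<sigma>"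
  shows "H_seminorm_star \<eta> u \<le> ennreal_powr (H_seminorm_star s u) \<theta> * ennreal_powr (H_seminorm_star \<sigma> u) (1 - \<theta>)"
proof -
  have \<eta>: "0 < \<eta>" "\<eta> < 1" using \<sigma> by auto
  consider "H_seminorm_star s u = 0 \<or> H_seminorm_star \<sigma> u = 0"
    | "H_seminorm_star s u \<noteq> 0" "H_seminorm_star \<sigma> u \<noteq> 0" "\<not> in_H s u \<or> \<not> in_H \<sigma> u"
    | "in_H s u" "in_H \<sigma> u" by blast
  then show ?thesis
  proof cases
    case 1
    then have "gagliardo \<eta> = 0"
      using star_zero_imp_gagliardo_zero[of s \<eta>] star_zero_imp_gagliardo_zero[of \<sigma> \<eta>] \<sigma> \<eta> by auto
    then have "H_seminorm_star \<eta> u = 0"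
      using \<eta> u_L2 by (simp add: H_seminorm_star_def in_H_def gagliardo_u)
    then show ?thesis by simp
  next
    case 2
    have "ennreal_powr (H_seminorm_star s u) \<theta> * ennreal_powr (H_seminorm_star \<sigma> u) (1 - \<theta>) = \<infinity>"
      using 2(3)
    proof
      assume "\<not> in_H s u"
      then have "ennreal_powr (H_seminorm_star s u) \<theta> = \<infinity>" by (simp add: H_seminorm_star_def ennreal_powr_def)
      then show ?thesis using ennreal_powr_nonzero[OF 2(2)] by (simp add: ennreal_top_mult)
    next
      assume "\<not> in_H \<sigma> u"
      then have "ennreal_powr (H_seminorm_star \<sigma> u) (1 - \<theta>) = \<infinity>" by (simp add: H_seminorm_star_def ennreal_powr_def)
      then show ?thesis using ennreal_powr_nonzero[OF 2(1)] by (simp add: ennreal_mult_top)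
    qed
    then show ?thesis by simp
  next
    case 3
    then show ?thesis using star_finite assms by blast
  qed
qed

end

lemma star_eq_B_const:
  fixes u :: "'a::euclidean_space \<Rightarrow> 'b::euclidean_space"
  assumes "0 \<le> s" "s \<le> 1"
  shows "H_seminorm_star s u = ennreal (sqrt (B_const DIM('a) s)) * H_seminorm s u"
proof -
  have B: "0 < B_const DIM('a) s" using assms by (intro B_const_pos) auto
  have S: "0 < sphere_area DIM('a)" by (simp add: sphere_area_def)
  have L: "0 \<le> L2_norm u" by (simp add: L2_norm_def)
  have G: "0 \<le> L2_norm_grad u" by (auto simp: L2_norm_grad_def intro!: Bochner_Integration.integral_nonneg sum_nonneg)
  show ?thesis
  proof (cases "in_H s u")
    case False
    then show ?thesis using B by (simp add: H_seminorm_star_def H_seminorm_def ennreal_mult_top ennreal_eq_0_iff)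
  next
    case True
    consider "s = 0" | "s = 1" | "0 < s" "s < 1" using assms by linarith
    then show ?thesis
    proof cases
      case 1
      have "L2_norm u = sqrt (B_const DIM('a) s) * sqrt (sphere_area DIM('a) * (L2_norm u)\<^sup>2)"
        using 1 S L by (simp add: B_const_def real_sqrt_mult[symmetric] del: real_sqrt_mult)
      then show ?thesis using 1 True L S B by (simp add: H_seminorm_star_def H_seminorm_def ennreal_mult[symmetric])
    next
      case 2
      have "L2_norm_grad u = sqrt (B_const DIM('a) s) * sqrt (sphere_area DIM('a) / (2 * real DIM('a)) * (L2_norm_grad u)\<^sup>2)"
        using 2 S G by (simp add: B_const_def real_sqrt_mult[symmetric] del: real_sqrt_mult)
      then show ?thesis using 2 True G S B by (simp add: H_seminorm_star_def H_seminorm_def ennreal_mult[symmetric])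
    next
      case 3
      let ?g = "enn2real (gagliardo_integral s u)"
      have "C_const DIM('a) s / 2 * ?g = B_const DIM('a) s * (s * (1 - s) * ?g)"
      proof -
        have "c / 2 * g = c / (2 * s * k) * (s * k * g)" if "k \<noteq> 0" for c g k :: real using that 3 by simp
        then have "C_const DIM('a) s / 2 * ?g = C_const DIM('a) s / (2 * s * (1 - s)) * (s * (1 - s) * ?g)"
          using 3 by (metis diff_gt_0_iff_gt less_irrefl)
        moreover have "B_const DIM('a) s = C_const DIM('a) s / (2 * s * (1 - s))"
          using 3 by (simp add: B_const_def)
        ultimately show ?thesis by (simp only:)
      qed
      then have "sqrt (C_const DIM('a) s / 2 * ?g) = sqrt (B_const DIM('a) s) * sqrt (s * (1 - s) * ?g)"
        by (simp only: real_sqrt_mult)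
      then show ?thesis using 3 True B by (simp add: H_seminorm_star_def H_seminorm_def ennreal_mult[symmetric])
    qed
  qed
qed

lemma ennreal_powr_mult:
  assumes "0 < c"
  shows "ennreal_powr (ennreal c * x) a = ennreal (c powr a) * ennreal_powr x a"
proof (cases x)
  case (real r)
  then show ?thesis using assms
    by (simp add: ennreal_powr_def ennreal_mult[symmetric] powr_mult)
next
  case top
  then show ?thesis using assms by (simp add: ennreal_powr_def ennreal_mult_top ennreal_eq_0_iff)
qed

theorem theorem5p9:
  fixes u :: "'a::euclidean_space \<Rightarrow> 'b::euclidean_space"
    and \<sigma> \<eta> s \<theta> :: real
  assumes "u \<in> L2"
    and "0 \<le> \<sigma>" and "\<sigma> < \<eta>" and "\<eta> < s" and "s \<le> 1"
    and "0 < \<theta>" and "\<theta> < 1"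
    and "\<eta> = \<theta> * s + (1 - \<theta>) * \<sigma>"
  shows
        "H_seminorm_star \<eta> u \<le>
           ennreal_powr (H_seminorm_star s u) \<theta> * ennreal_powr (H_seminorm_star \<sigma> u) (1 - \<theta>) \<and>
         H_seminorm \<eta> u \<le>
           ennreal (N_tilde DIM('a) \<sigma> \<eta> s) *
           (ennreal_powr (H_seminorm s u) \<theta> * ennreal_powr (H_seminorm \<sigma> u) (1 - \<theta>)) \<and>
         N_tilde DIM('a) \<sigma> \<eta> s =
           sqrt (B_const DIM('a) s powr \<theta> * B_const DIM('a) \<sigma> powr (1 - \<theta>) / B_const DIM('a) \<eta>) \<and>
         N_tilde DIM('a) \<sigma> \<eta> s \<le> sqrt (2 * real DIM('a))"
proof (intro conjI)
  obtain u' where u': "square_integrable u'" "AE x in lborel. u x = u' x"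
    "(\<integral>x. (norm (u x))\<^sup>2 \<partial>lebesgue) = (\<integral>x. (norm (u' x))\<^sup>2 \<partial>lborel)"
    using L2_ex_borel[OF assms(1)] by blast
  interpret L2_function u u'
    using u' assms(1) by (simp add: L2_function_def L2_function_axioms_def)
  show star: "H_seminorm_star \<eta> u \<le> ennreal_powr (H_seminorm_star s u) \<theta> * ennreal_powr (H_seminorm_star \<sigma> u) (1 - \<theta>)"
    using assms by (intro star_interpolation) auto
  let ?B = "B_const DIM('a)"
  have B: "0 < ?B \<sigma>" "0 < ?B \<eta>" "0 < ?B s" using assms by (auto intro!: B_const_pos)
  have \<theta>_eq: "(\<eta> - \<sigma>) / (s - \<sigma>) = \<theta>"
  proof -
    have "\<eta> - \<sigma> = \<theta> * (s - \<sigma>)" unfolding assms(8) by (simp add: algebra_simps)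
    then show ?thesis using assms by simp
  qed
  show N_eq: "N_tilde DIM('a) \<sigma> \<eta> s = sqrt (?B s powr \<theta> * ?B \<sigma> powr (1 - \<theta>) / ?B \<eta>)"
    unfolding N_tilde_def Let_def \<theta>_eq ..
  have "?B s powr \<theta> * ?B \<sigma> powr (1 - \<theta>) / ?B \<eta> \<le> 2"
    unfolding assms(8) using assms by (intro B_const_interpolation_le) auto
  also have "2 \<le> 2 * real DIM('a)" using DIM_positive[where 'a='a] by simp
  finally show "N_tilde DIM('a) \<sigma> \<eta> s \<le> sqrt (2 * real DIM('a))"
    unfolding N_eq by (rule real_sqrt_le_mono)
  let ?X = "ennreal_powr (H_seminorm s u) \<theta> * ennreal_powr (H_seminorm \<sigma> u) (1 - \<theta>)"
  have "H_seminorm \<eta> u = ennreal (1 / sqrt (?B \<eta>)) * H_seminorm_star \<eta> u"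
    using star_eq_B_const[of \<eta> u] assms B by (simp add: mult.assoc[symmetric] ennreal_mult[symmetric])
  also have "\<dots> \<le> ennreal (1 / sqrt (?B \<eta>)) * (ennreal_powr (H_seminorm_star s u) \<theta> * ennreal_powr (H_seminorm_star \<sigma> u) (1 - \<theta>))"
    by (intro mult_left_mono star) simp
  also have "ennreal_powr (H_seminorm_star s u) \<theta> = ennreal (sqrt (?B s) powr \<theta>) * ennreal_powr (H_seminorm s u) \<theta>"
    using star_eq_B_const[of s u] assms B by (simp add: ennreal_powr_mult)
  also have "ennreal_powr (H_seminorm_star \<sigma> u) (1 - \<theta>) = ennreal (sqrt (?B \<sigma>) powr (1 - \<theta>)) * ennreal_powr (H_seminorm \<sigma> u) (1 - \<theta>)"
    using star_eq_B_const[of \<sigma> u] assms B by (simp add: ennreal_powr_mult)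
  also have "ennreal (1 / sqrt (?B \<eta>)) * (ennreal (sqrt (?B s) powr \<theta>) * ennreal_powr (H_seminorm s u) \<theta> *
        (ennreal (sqrt (?B \<sigma>) powr (1 - \<theta>)) * ennreal_powr (H_seminorm \<sigma> u) (1 - \<theta>)))
      = (ennreal (1 / sqrt (?B \<eta>)) * (ennreal (sqrt (?B s) powr \<theta>) * ennreal (sqrt (?B \<sigma>) powr (1 - \<theta>)))) * ?X"
    by (simp only: mult_ac)
  also have "ennreal (1 / sqrt (?B \<eta>)) * (ennreal (sqrt (?B s) powr \<theta>) * ennreal (sqrt (?B \<sigma>) powr (1 - \<theta>)))
      = ennreal (N_tilde DIM('a) \<sigma> \<eta> s)"
  proof -
    have sq: "sqrt x powr t = sqrt (x powr t)" if "0 < x" for x t :: real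
      using that by (simp add: powr_half_sqrt[symmetric] powr_powr mult.commute)
    show ?thesis
      unfolding N_eq using B by (simp add: ennreal_mult[symmetric] sq real_sqrt_mult real_sqrt_divide)
  qed
  finally show "H_seminorm \<eta> u \<le> ennreal (N_tilde DIM('a) \<sigma> \<eta> s) * ?X" .
qed

end
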